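(* There is a deterministic algorithm and an absolute constant $C$ such that, for every integer $n\ge 1$, given the coefficients of a bivariate polynomial $p\in\mathbb{R}_n[x,y]$, the algorithm decides whether or not $p$ is real stable using at most $C n^5$ arithmetic operations (that is, $O(n^5)$ arithmetic operations), assuming exact arithmetic.
   Context: $\mathbb{R}_n[x,y]$ denotes the vector space of real polynomials in $x,y$ of degree at most $n$ in each variable. A polynomial $p\in\mathbb{R}[x,y]$ is called real stable if it is identically zero or if $p(z_1,z_2)\neq 0$ whenever $z_1,z_2\in\mathbb{C}$ satisfy $\mathrm{Im}(z_1)>0$ and $\mathrm{Im}(z_2)>0$. The computational model is exact arithmetic on real numbers: each addition, subtraction, multiplication, division, and comparison/sign test of real numbers counts as one arithmetic operation. *)

theory Defs
  imports Complex_Main "HOL-Computational_Algebra.Polynomial"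
begin

section \<open>Real stable bivariate polynomials\<close>

text \<open>
  A polynomial in \<open>\<real>[x, y]\<close> is a value of type \<open>real poly poly\<close>, read as an element of
  \<open>\<real>[x][y]\<close>: the coefficient of \<open>x^i y^j\<close> in \<open>p\<close> is \<open>coeff (coeff p j) i\<close>.
\<close>

definition bipolys :: "nat \<Rightarrow> real poly poly set" where
  "bipolys n = {p. degree p \<le> n \<and> (\<forall>j. degree (coeff p j) \<le> n)}"

definition complex_eval2 :: "real poly poly \<Rightarrow> complex \<Rightarrow> complex \<Rightarrow> complex" where
  "complex_eval2 p z1 z2 = poly (poly (map_poly (map_poly complex_of_real) p) [:z2:]) z1"

definition real_stable :: "real poly poly \<Rightarrow> bool" where
  "real_stable p \<longleftrightarrow>
     p = 0 \<or> (\<forall>z1 z2. Im z1 > 0 \<longrightarrow> Im z2 > 0 \<longrightarrow> complex_eval2 p z1 z2 \<noteq> 0)"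


section \<open>Exact real arithmetic programs\<close>

text \<open>
  A while language over natural number variables (used for loop counters, addresses and the
  answer) and arrays of exact real numbers.  Real data influence the natural number variables only
  through the tests, and there is no conversion from natural numbers to reals.  The only real
  constants are integer literals, so a program cannot carry non-uniform advice in its constants.
  The cost of a run is the number of operations and tests on real numbers that it executes; index
  arithmetic, index tests, literals and copying are not charged.
\<close>

datatype iexp =
    INum nat
  | IVar string
  | IAdd iexp iexp
  | ISub iexp iexp
  | IMul iexp iexp

datatype rexp =
    RNum int
  | RCell string iexp
  | RAdd rexp rexp
  | RSub rexp rexp
  | RMul rexp rexp
  | RDiv rexp rexp

datatype test =
    ILess iexp iexp
  | RLess rexp rexp
  | REq rexp rexp

datatype com =
    Skip
  | IAssign string iexp
  | RAssign string iexp rexp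
  | Seq com com
  | If test com com
  | While test com

record state =
  ivars :: "string \<Rightarrow> nat"
  arrays :: "string \<Rightarrow> nat \<Rightarrow> real"

fun ival :: "iexp \<Rightarrow> state \<Rightarrow> nat" where
  "ival (INum k) s = k"
| "ival (IVar v) s = ivars s v"
| "ival (IAdd a b) s = ival a s + ival b s"
| "ival (ISub a b) s = ival a s - ival b s"
| "ival (IMul a b) s = ival a s * ival b s"

fun rval :: "rexp \<Rightarrow> state \<Rightarrow> real" where
  "rval (RNum k) s = of_int k"
| "rval (RCell v a) s = arrays s v (ival a s)"
| "rval (RAdd a b) s = rval a s + rval b s"
| "rval (RSub a b) s = rval a s - rval b s"
| "rval (RMul a b) s = rval a s * rval b s"
| "rval (RDiv a b) s = rval a s / rval b s"

text \<open>Evaluation divides by zero nowhere; otherwise the program is stuck.\<close>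

fun rdefined :: "rexp \<Rightarrow> state \<Rightarrow> bool" where
  "rdefined (RNum k) s \<longleftrightarrow> True"
| "rdefined (RCell v a) s \<longleftrightarrow> True"
| "rdefined (RAdd a b) s \<longleftrightarrow> rdefined a s \<and> rdefined b s"
| "rdefined (RSub a b) s \<longleftrightarrow> rdefined a s \<and> rdefined b s"
| "rdefined (RMul a b) s \<longleftrightarrow> rdefined a s \<and> rdefined b s"
| "rdefined (RDiv a b) s \<longleftrightarrow> rdefined a s \<and> rdefined b s \<and> rval b s \<noteq> 0"

fun rcost :: "rexp \<Rightarrow> nat" where
  "rcost (RNum k) = 0"
| "rcost (RCell v a) = 0"
| "rcost (RAdd a b) = rcost a + rcost b + 1"
| "rcost (RSub a b) = rcost a + rcost b + 1"
| "rcost (RMul a b) = rcost a + rcost b + 1"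
| "rcost (RDiv a b) = rcost a + rcost b + 1"

fun tval :: "test \<Rightarrow> state \<Rightarrow> bool" where
  "tval (ILess a b) s \<longleftrightarrow> ival a s < ival b s"
| "tval (RLess a b) s \<longleftrightarrow> rval a s < rval b s"
| "tval (REq a b) s \<longleftrightarrow> rval a s = rval b s"

fun tdefined :: "test \<Rightarrow> state \<Rightarrow> bool" where
  "tdefined (ILess a b) s \<longleftrightarrow> True"
| "tdefined (RLess a b) s \<longleftrightarrow> rdefined a s \<and> rdefined b s"
| "tdefined (REq a b) s \<longleftrightarrow> rdefined a s \<and> rdefined b s"

fun tcost :: "test \<Rightarrow> nat" where
  "tcost (ILess a b) = 0"
| "tcost (RLess a b) = rcost a + rcost b + 1"
| "tcost (REq a b) = rcost a + rcost b + 1"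

text \<open>
  \<open>run c s k t\<close>: started in state \<open>s\<close>, the program \<open>c\<close> terminates in state \<open>t\<close> after exactly \<open>k\<close>
  arithmetic operations, without dividing by zero.
\<close>

inductive run :: "com \<Rightarrow> state \<Rightarrow> nat \<Rightarrow> state \<Rightarrow> bool" where
  Skip: "run Skip s 0 s"
| IAssign: "run (IAssign v a) s 0 (s\<lparr>ivars := (ivars s)(v := ival a s)\<rparr>)"
| RAssign: "rdefined e s \<Longrightarrow>
    run (RAssign v a e) s (rcost e)
      (s\<lparr>arrays := (arrays s)(v := (arrays s v)(ival a s := rval e s))\<rparr>)"
| Seq: "run c1 s k1 s' \<Longrightarrow> run c2 s' k2 t \<Longrightarrow> run (Seq c1 c2) s (k1 + k2) t"
| IfTrue: "tdefined b s \<Longrightarrow> tval b s \<Longrightarrow> run c1 s k t \<Longrightarrow> run (If b c1 c2) s (tcost b + k) t"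
| IfFalse: "tdefined b s \<Longrightarrow> \<not> tval b s \<Longrightarrow> run c2 s k t \<Longrightarrow> run (If b c1 c2) s (tcost b + k) t"
| WhileTrue: "tdefined b s \<Longrightarrow> tval b s \<Longrightarrow> run c s k1 s' \<Longrightarrow> run (While b c) s' k2 t \<Longrightarrow>
    run (While b c) s (tcost b + k1 + k2) t"
| WhileFalse: "tdefined b s \<Longrightarrow> \<not> tval b s \<Longrightarrow> run (While b c) s (tcost b) s"

inductive_cases run_SkipE: "run Skip s k t"
inductive_cases run_IAssignE: "run (IAssign v a) s k t"
inductive_cases run_RAssignE: "run (RAssign v a e) s k t"
inductive_cases run_SeqE: "run (Seq c1 c2) s k t"
inductive_cases run_IfE: "run (If b c1 c2) s k t"
inductive_cases run_WhileE: "run (While b c) s k t"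

lemma run_deterministic:
  "run c s k t \<Longrightarrow> run c s k' t' \<Longrightarrow> k' = k \<and> t' = t"
proof (induction arbitrary: k' t' rule: run.induct)
  case (Skip s)
  then show ?case by (auto elim: run_SkipE)
next
  case (IAssign v a s)
  then show ?case by (auto elim: run_IAssignE)
next
  case (RAssign e s v a)
  from RAssign(2) show ?case by (auto elim: run_RAssignE)
next
  case (Seq c1 s k1 s' c2 k2 t)
  from Seq.prems show ?case by (rule run_SeqE) (use Seq.IH in blast)
next
  case (IfTrue b s c1 k t c2)
  from IfTrue.prems show ?case by (rule run_IfE) (use IfTrue in blast)+
next
  case (IfFalse b s c2 k t c1)
  from IfFalse.prems show ?case by (rule run_IfE) (use IfFalse in blast)+
next
  case (WhileTrue b s c k1 s' k2 t)
  from WhileTrue.prems show ?case by (rule run_WhileE) (use WhileTrue in blast)+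
next
  case (WhileFalse b s c)
  from WhileFalse.prems show ?case by (rule run_WhileE) (use WhileFalse in blast)+
qed

text \<open>
  Initially the variable \<open>n\<close> holds the degree bound, and for \<open>i, j \<le> n\<close> the cell \<open>i * (n + 1) + j\<close> of
  the array \<open>p\<close> holds the coefficient of \<open>x^i y^j\<close>.  Everything else is zero; in particular so are
  the cells of \<open>p\<close> from \<open>(n + 1)^2\<close> on, since they would belong to \<open>x\<close>-exponents \<open>i > n\<close>.
\<close>

definition input_state :: "nat \<Rightarrow> real poly poly \<Rightarrow> state" where
  "input_state n p =
     \<lparr>ivars = (\<lambda>_. 0)(''n'' := n),
      arrays = (\<lambda>_ _. 0)(''p'' := (\<lambda>m. coeff (coeff p (m mod (n + 1))) (m div (n + 1))))\<rparr>"

end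

theory Submission
  imports Defs
    "HOL-Computational_Algebra.Fundamental_Theorem_Algebra"
    "HOL-Complex_Analysis.Complex_Analysis"
    "Jordan_Normal_Form.Determinant"
begin

text \<open>
  The elliptic Moebius maps \<open>M g x = (x + g) / (1 - g x)\<close> fix \<open>i\<close> and are rotations in the disc
  model.  A maximum modulus argument shows that \<open>p \<noteq> 0\<close> is stable iff \<open>p(i, i) \<noteq> 0\<close> and, for all but
  finitely many real \<open>g\<close>, the numerator of \<open>p(t, M g t)\<close> has only real roots in \<open>t\<close>.  By Hermite's
  theorem the latter holds iff the Bezoutian of this numerator and its derivative is positive
  semidefinite.  The entries of the Bezoutian are polynomials in \<open>g\<close>; because of its Hankel structure
  it is positive semidefinite for almost all \<open>g\<close> iff its leading minors are nonnegative on the real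
  line and it is positive semidefinite at more sample points than the degrees of the minors.

  There are \<open>O(n^2)\<close> samples, and one elimination in \<open>O(n^3)\<close> both decides semidefiniteness and yields
  the values of all minors.  Each of the \<open>O(n)\<close> minors is then interpolated in \<open>O(n^4)\<close>, and its
  nonnegativity is decided in \<open>O(n^4)\<close> by computing two Cauchy indices with Euclid's algorithm.
\<close>

section \<open>Stability and the elliptic pencil\<close>

text \<open>Restricting \<open>p\<close> to real lines of positive direction would give a
  two-parameter family. Turning one variable about \<open>\<i>\<close> leaves the single parameter
  \<open>g\<close>; the price is the separate test at \<open>(\<i>, \<i>)\<close>, where the maximum
  modulus argument is anchored. The estimate for real-rooted polynomials is uniform in
  \<open>g\<close>, so finitely many exceptional \<open>g\<close>, and g at infinity, do no harm.

  The main obstacle is degeneracy: if \<open>p\<close> is, say, the square of a nonconstant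
  polynomial, high minors vanish identically, and nonnegative leading minors alone do not imply
  semidefiniteness. Let \<open>r\<close> be the largest order of a minor that is not identically
  zero. There are more samples than its degree, so it is nonzero at one of them; semidefiniteness
  there makes all minors up to order \<open>r\<close> positive at that point. Hence none of them
  vanishes identically, and being nonnegative they are positive for almost every \<open>g\<close>.

  With \<open>m\<close> the degree in \<open>x\<close> and \<open>N = m + n\<close>, the minors have
  degree at most \<open>2 n N\<close>, so \<open>K = 2 n N + 1\<close> samples suffice. As
  \<open>K \<le> 5 n^2\<close> and \<open>N \<le> 2 n\<close>, both \<open>K n^3\<close> and
  \<open>N K^2\<close> are of order \<open>n^5\<close>.\<close>

abbreviation cpoly :: "real poly \<Rightarrow> complex poly" where
  "cpoly \<equiv> map_poly complex_of_real"

definition real_rooted :: "real poly \<Rightarrow> bool" where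
  "real_rooted f \<longleftrightarrow> (\<forall>z. poly (cpoly f) z = 0 \<longrightarrow> Im z = 0)"

text \<open>\<open>n\<close> only bounds the degree in the second variable: when it is larger than
  that degree, the surplus factors \<open>1 - g t\<close> contribute nothing but real roots.\<close>

definition pencil :: "nat \<Rightarrow> real poly poly \<Rightarrow> real \<Rightarrow> real poly" where
  "pencil n p g = (\<Sum>j\<le>n. coeff p j * [:g, 1:] ^ j * [:1, - g:] ^ (n - j))"

lemma cpoly_mult: "cpoly (f * g) = cpoly f * cpoly g"
  by (rule poly_eqI) (simp add: coeff_map_poly coeff_mult)

lemma cpoly_power: "cpoly (f ^ k) = cpoly f ^ k"
  by (induction k) (simp_all add: cpoly_mult one_pCons map_poly_pCons)

lemma cpoly_sum: "cpoly (sum f A) = (\<Sum>i\<in>A. cpoly (f i))"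
  by (rule poly_eqI) (simp add: coeff_map_poly coeff_sum)

lemma degree_cpoly [simp]: "degree (cpoly f) = degree f"
  by (simp add: degree_map_poly)

lemma complex_eval2_sum:
  assumes "degree p \<le> n"
  shows "complex_eval2 p x y = (\<Sum>j\<le>n. poly (cpoly (coeff p j)) x * y ^ j)"
proof -
  have deg: "degree (map_poly cpoly p) \<le> n"
    using assms by (intro degree_le) (simp add: coeff_map_poly coeff_eq_0)
  have "poly (map_poly cpoly p) [:y:] = (\<Sum>j\<le>n. coeff (map_poly cpoly p) j * [:y:] ^ j)"
    unfolding poly_altdef using deg
    by (intro sum.mono_neutral_left) (auto simp: coeff_eq_0)
  then show ?thesis
    by (simp add: complex_eval2_def poly_sum coeff_map_poly)
qed

lemma poly_pencil:
  assumes "degree p \<le> n" "1 - complex_of_real g * z \<noteq> 0"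
  shows "poly (cpoly (pencil n p g)) z =
    (1 - of_real g * z) ^ n * complex_eval2 p z ((z + of_real g) / (1 - of_real g * z))"
proof -
  let ?d = "1 - complex_of_real g * z"
  have "poly (cpoly (pencil n p g)) z =
      (\<Sum>j\<le>n. poly (cpoly (coeff p j)) z * (z + of_real g) ^ j * ?d ^ (n - j))"
    by (simp add: pencil_def cpoly_sum cpoly_mult cpoly_power poly_sum map_poly_pCons add.commute
        mult.commute[of z])
  also have "\<dots> = (\<Sum>j\<le>n. ?d ^ n * (poly (cpoly (coeff p j)) z * ((z + of_real g) / ?d) ^ j))"
  proof (rule sum.cong[OF refl])
    fix j assume "j \<in> {..n}"
    then have "?d ^ n = ?d ^ j * ?d ^ (n - j)" by (simp flip: power_add)
    then show "poly (cpoly (coeff p j)) z * (z + of_real g) ^ j * ?d ^ (n - j) =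
        ?d ^ n * (poly (cpoly (coeff p j)) z * ((z + of_real g) / ?d) ^ j)"
      using assms(2) by (simp add: power_divide)
  qed
  finally show ?thesis
    using assms(1) by (simp add: complex_eval2_sum sum_distrib_left)
qed

lemma degree_pencil:
  assumes "\<And>j. degree (coeff p j) \<le> m"
  shows "degree (pencil n p g) \<le> m + n"
  unfolding pencil_def
proof (rule degree_sum_le)
  fix j assume j: "j \<in> {..n}"
  have "degree ([:g, 1:] ^ j) \<le> j" "degree ([:1, - g:] ^ (n - j)) \<le> n - j"
    using degree_power_le[of "[:g, 1:]" j] degree_power_le[of "[:1, -g:]" "n - j"]
    by (auto split: if_splits)
  moreover have "degree (coeff p j * [:g, 1:] ^ j * [:1, - g:] ^ (n - j)) \<le>
      degree (coeff p j) + degree ([:g, 1:] ^ j) + degree ([:1, - g:] ^ (n - j))"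
    by (meson add_right_mono degree_mult_le order_trans)
  ultimately show "degree (coeff p j * [:g, 1:] ^ j * [:1, - g:] ^ (n - j)) \<le> m + n"
    using assms[of j] j by simp
qed auto

lemma one_minus_real_mult_nonzero:
  "Im z > 0 \<Longrightarrow> 1 - complex_of_real g * z \<noteq> 0"
  by (auto simp: complex_eq_iff)

text \<open>The Moebius map with matrix rows \<open>(1, g)\<close> and \<open>(-g, 1)\<close> has
  determinant \<open>1 + g^2 > 0\<close> and so preserves the upper half-plane; a zero of the pencil
  there would give a zero of \<open>p\<close>. Real coefficients then exclude the lower
  half-plane.\<close>

lemma stable_imp_pencil_real_rooted:
  assumes "real_stable p" "p \<noteq> 0" "degree p \<le> n"
  shows "complex_eval2 p \<i> \<i> \<noteq> 0" "real_rooted (pencil n p g)"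
proof -
  have ne: "complex_eval2 p z w \<noteq> 0" if "Im z > 0" "Im w > 0" for z w
    using assms that by (auto simp: real_stable_def)
  show "complex_eval2 p \<i> \<i> \<noteq> 0" by (rule ne) auto
  have up: "poly (cpoly (pencil n p g)) z \<noteq> 0" if "Im z > 0" for z
  proof -
    let ?d = "1 - complex_of_real g * z"
    have d: "?d \<noteq> 0" using that by (rule one_minus_real_mult_nonzero)
    have "Im ((z + of_real g) / ?d) = Im z * (1 + g\<^sup>2) / (cmod ?d)\<^sup>2"
      by (subst Im_divide) (simp add: cmod_power2, simp add: algebra_simps power2_eq_square)
    also have "\<dots> > 0" using that d by (simp add: add_pos_nonneg)
    finally show ?thesis
      using ne[OF that] d by (simp add: poly_pencil[OF assms(3) d])
  qed
  show "real_rooted (pencil n p g)"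
    unfolding real_rooted_def
  proof (intro allI impI)
    fix z assume z: "poly (cpoly (pencil n p g)) z = 0"
    have "poly (cpoly (pencil n p g)) (cnj z) = cnj (poly (cpoly (pencil n p g)) z)"
      by (subst poly_cnj_real) (auto simp: coeff_map_poly)
    then have "\<not> Im (cnj z) > 0" "\<not> Im z > 0"
      using z up[of z] up[of "cnj z"] by auto
    then show "Im z = 0" by simp
  qed
qed

section \<open>A quantitative form of real-rootedness\<close>

lemma prod_mset_norm_nonneg: "(\<Prod>x\<in>#A. cmod (f x)) \<ge> 0"
  by (induction A) auto

text \<open>For a real root \<open>x\<close>, \<open>|z - x|\<close> is at least
  \<open>Im z\<close>, so replacing \<open>z\<close> by \<open>\<i>\<close> in one factor costs at
  most \<open>1 + |\<i> - z| / Im z\<close>. The bound involves neither the roots nor the leading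
  coefficient, which lets nonvanishing survive limits in \<open>g\<close>.\<close>

lemma real_rooted_bound:
  assumes "real_rooted f" "degree f \<le> N" "Im z > 0"
  shows "cmod (poly (cpoly f) \<i>) \<le> (1 + cmod (\<i> - z) / Im z) ^ N * cmod (poly (cpoly f) z)"
proof (cases "f = 0")
  case False
  let ?K = "1 + cmod (\<i> - z) / Im z"
  have K: "?K \<ge> 1" using assms(3) by simp
  obtain A where A: "size A = degree (cpoly f)"
    "cpoly f = Polynomial.smult (lead_coeff (cpoly f)) (\<Prod>x\<in>#A. [:- x, 1:])"
    using alg_closed_imp_factorization[of "cpoly f"] False by (auto simp: map_poly_eq_0_iff)
  have ev: "cmod (poly (cpoly f) w) = cmod (lead_coeff (cpoly f)) * (\<Prod>x\<in>#A. cmod (w - x))" for w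
  proof -
    have "cmod (poly (\<Prod>x\<in>#B. [:- x, 1:]) w) = (\<Prod>x\<in>#B. cmod (w - x))" for B
      by (induction B) (simp_all add: norm_mult flip: left_diff_distrib)
    then show ?thesis by (subst A(2)) (simp add: norm_mult)
  qed
  have re: "Im x = 0" if "x \<in># A" for x
  proof -
    have "poly (cpoly f) x = 0"
      by (subst A(2)) (use that in \<open>auto simp: poly_prod_mset prod_mset_zero_iff\<close>)
    then show ?thesis using assms(1) by (auto simp: real_rooted_def)
  qed
  have "(\<Prod>x\<in>#B. cmod (\<i> - x)) \<le> ?K ^ size B * (\<Prod>x\<in>#B. cmod (z - x))"
    if "\<And>x. x \<in># B \<Longrightarrow> Im x = 0" for B
    using that
  proof (induction B)
    case (add x B)
    have "Im z \<le> cmod (z - x)"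
      using add.prems[of x] abs_Im_le_cmod[of "z - x"] by simp
    then have "cmod (\<i> - z) \<le> cmod (\<i> - z) / Im z * cmod (z - x)"
      using assms(3) mult_right_mono[of "Im z" "cmod (z - x)" "cmod (\<i> - z)"]
      by (simp add: field_simps)
    moreover have "cmod (\<i> - x) \<le> cmod (\<i> - z) + cmod (z - x)"
      by (metis norm_triangle_ineq diff_add_cancel add_diff_eq)
    ultimately have "cmod (\<i> - x) \<le> ?K * cmod (z - x)" by (simp add: algebra_simps)
    then have "cmod (\<i> - x) * (\<Prod>x\<in>#B. cmod (\<i> - x)) \<le>
        (?K * cmod (z - x)) * (?K ^ size B * (\<Prod>x\<in>#B. cmod (z - x)))"
      using add K by (intro mult_mono) (auto intro!: prod_mset_norm_nonneg)
    then show ?case by (simp add: algebra_simps)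
  qed auto
  from this[of A] re have 1: "(\<Prod>x\<in>#A. cmod (\<i> - x)) \<le> ?K ^ size A * (\<Prod>x\<in>#A. cmod (z - x))"
    by blast
  \<comment> \<open>The pencil may drop in degree for some \<open>g\<close>; since \<open>?K\<close>
    is at least 1, the exponent can be raised to the common bound \<open>N\<close>.\<close>
  also have "\<dots> \<le> ?K ^ N * (\<Prod>x\<in>#A. cmod (z - x))"
    using K A(1) assms(2) by (intro mult_right_mono power_increasing) (auto intro!: prod_mset_norm_nonneg)
  finally show ?thesis
    by (simp add: ev mult_left_mono mult.left_commute)
qed auto

section \<open>The Cayley transform and the disc model\<close>

definition cayley :: "complex \<Rightarrow> complex" where
  "cayley w = \<i> * (1 + w) / (1 - w)"

lemma Im_cayley: "cmod w < 1 \<Longrightarrow> Im (cayley w) > 0"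
proof -
  assume w: "cmod w < 1"
  have "1 - w \<noteq> 0" using w by auto
  have "Im (cayley w) = (1 - (cmod w)\<^sup>2) / (cmod (1 - w))\<^sup>2"
    unfolding cayley_def by (subst Im_divide) (simp add: cmod_power2, simp add: algebra_simps power2_eq_square)
  also have "\<dots> > 0" using w \<open>1 - w \<noteq> 0\<close>
    by (simp add: power_less_one_iff abs_square_less_1)
  finally show ?thesis .
qed

lemma cayley_surj:
  assumes "Im z > 0"
  obtains w where "cmod w < 1" "cayley w = z"
proof -
  have ne: "z + \<i> \<noteq> 0" using assms by (auto simp: complex_eq_iff)
  have "(cmod (z - \<i>))\<^sup>2 < (cmod (z + \<i>))\<^sup>2"
    unfolding cmod_power2 using assms by (simp add: power2_eq_square algebra_simps)
  then have "cmod (z - \<i>) < cmod (z + \<i>)" by (rule power_less_imp_less_base) simp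
  then have "cmod ((z - \<i>) / (z + \<i>)) < 1" using ne by (simp add: norm_divide)
  moreover have "cayley ((z - \<i>) / (z + \<i>)) = z"
  proof -
    have "1 + (z - \<i>) / (z + \<i>) = 2 * z / (z + \<i>)" "1 - (z - \<i>) / (z + \<i>) = 2 * \<i> / (z + \<i>)"
      using ne by (simp_all add: field_simps)
    then show ?thesis using ne by (simp add: cayley_def)
  qed
  ultimately show ?thesis using that by blast
qed

text \<open>\<open>g\<close> is the tangent of half the argument of \<open>v\<close>, and the
  equation is \<open>v = (1 + \<i> g) / (1 - \<i> g)\<close> cleared of its denominator. The point
  \<open>-1\<close> corresponds to g at infinity.\<close>

lemma unit_circle_tangent:
  assumes "cmod v = 1" "v \<noteq> -1"
  defines "g \<equiv> Im v / (1 + Re v)"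
  shows "v * (1 - \<i> * of_real g) = 1 + \<i> * of_real g"
proof -
  have n: "(Re v)\<^sup>2 + (Im v)\<^sup>2 = 1" using assms(1) by (simp add: cmod_def)
  have re: "1 + Re v \<noteq> 0"
  proof
    assume "1 + Re v = 0"
    then have "Re v = -1" by simp
    then have "Im v = 0" using n by simp
    with \<open>Re v = -1\<close> assms(2) show False by (simp add: complex_eq_iff)
  qed
  then have g: "g * (1 + Re v) = Im v" by (simp add: g_def)
  have "(Re v + Im v * g - 1) * (1 + Re v) = Im v * (g * (1 + Re v)) - (1 - (Re v)\<^sup>2)"
    by (simp add: algebra_simps power2_eq_square)
  also have "\<dots> = 0" unfolding g using n by (simp add: power2_eq_square)
  finally have "Re v + Im v * g = 1" using re by simp
  then show ?thesis using g by (simp add: complex_eq_iff algebra_simps)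
qed

text \<open>Conjugates multiplication by \<open>u\<close> in the disc to the elliptic map with
  parameter \<open>g\<close>. After multiplication by \<open>1 - w\<close>, the relation
  \<open>u (1 - \<i> g) = 1 + \<i> g\<close> turns numerator and denominator into multiples of
  \<open>1 - \<i> g\<close>.\<close>

lemma cayley_rotate:
  assumes "cmod w < 1" "cmod u = 1" "u \<noteq> -1"
  defines "g \<equiv> Im u / (1 + Re u)"
  shows "cayley (u * w) = (cayley w + of_real g) / (1 - of_real g * cayley w)"
proof -
  have i0: "1 - \<i> * of_real g \<noteq> 0" by (auto simp: complex_eq_iff)
  have u: "u * (1 - \<i> * of_real g) = 1 + \<i> * of_real g"
    unfolding g_def using assms(2,3) by (rule unit_circle_tangent)
  have w1: "1 - w \<noteq> 0" using assms(1) by auto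
  have "cmod (u * w) < 1" using assms(1,2) by (simp add: norm_mult)
  then have uw1: "1 - u * w \<noteq> 0" by auto
  have d: "1 - of_real g * cayley w \<noteq> 0"
    using Im_cayley[OF assms(1)] by (rule one_minus_real_mult_nonzero)
  have eq1: "(1 - of_real g * cayley w) * (1 - w) = (1 - w) - \<i> * of_real g * (1 + w)"
    using w1 by (simp add: cayley_def field_simps)
  have eq2: "(cayley w + of_real g) * (1 - w) = \<i> * (1 + w) + of_real g * (1 - w)"
    using w1 by (simp add: cayley_def field_simps)
  have a: "(1 - w) - \<i> * of_real g * (1 + w) = (1 - \<i> * of_real g) * (1 - u * w)"
  proof -
    have "(1 - \<i> * of_real g) * (1 - u * w) = (1 - \<i> * of_real g) - (u * (1 - \<i> * of_real g)) * w"
      by (simp add: algebra_simps)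
    then show ?thesis unfolding u by (simp add: algebra_simps)
  qed
  have b: "\<i> * (1 + w) + of_real g * (1 - w) = (1 - \<i> * of_real g) * (\<i> * (1 + u * w))"
  proof -
    have "(1 - \<i> * of_real g) * (\<i> * (1 + u * w)) =
        \<i> * (1 - \<i> * of_real g) + \<i> * (u * (1 - \<i> * of_real g)) * w"
      by (simp add: algebra_simps)
    then show ?thesis unfolding u by (simp add: algebra_simps)
  qed
  have "(cayley w + of_real g) / (1 - of_real g * cayley w) =
      ((cayley w + of_real g) * (1 - w)) / ((1 - of_real g * cayley w) * (1 - w))"
    using w1 by simp
  also have "\<dots> = cayley (u * w)"
    unfolding eq1 eq2 a b using i0 by (simp add: cayley_def)
  finally show ?thesis by simp
qed

section \<open>From the torus to the bidisc\<close>

lemma poly_continuous_complex_eval2: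
  "continuous_on S f \<Longrightarrow> continuous_on S g \<Longrightarrow> continuous_on S (\<lambda>u. complex_eval2 p (f u) (g u))"
  by (subst complex_eval2_sum[OF order_refl]) (intro continuous_intros)

lemma poly_holomorphic_complex_eval2:
  "f holomorphic_on S \<Longrightarrow> g holomorphic_on S \<Longrightarrow>
   (\<lambda>u. complex_eval2 p (f u) (g u)) holomorphic_on S"
  by (subst complex_eval2_sum[OF order_refl]) (intro holomorphic_intros)

text \<open>On the ray through the zero closest to the origin, \<open>1 / G\<close> is holomorphic in the first variable up to
  that zero, so by the maximum modulus principle it stays bounded by its values on the torus.\<close>

lemma no_zero_from_torus:
  fixes G :: "complex \<Rightarrow> complex \<Rightarrow> complex"
  assumes cont: "continuous_on (ball 0 1 \<times> ball 0 1) (\<lambda>x. G (fst x) (snd x))"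
    and hol: "\<And>b. cmod b < 1 \<Longrightarrow> (\<lambda>u. G (u * b) b) holomorphic_on cball 0 1"
    and torus: "\<And>u w. cmod u = 1 \<Longrightarrow> cmod w < 1 \<Longrightarrow> G (u * w) w \<noteq> 0"
    and origin: "G 0 0 \<noteq> 0"
    and ab: "cmod a \<le> cmod b" "cmod b < 1"
  shows "G a b \<noteq> 0"
proof
  assume zero: "G a b = 0"
  have b0: "b \<noteq> 0" using ab zero origin by auto
  \<comment> \<open>\<open>snd x\<close> moves along the ray through \<open>b\<close>, and
    \<open>fst x\<close> is the quotient of the two arguments of \<open>G\<close>; modulus 1 of
    \<open>fst x\<close> is the torus, and the supposed zero has the coordinates
    \<open>(a / b, 1)\<close>.\<close>
  define h where "h x = G (fst x * (of_real (snd x) * b)) (of_real (snd x) * b)" for x :: "complex \<times> real"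
  let ?D = "cball (0::complex) 1 \<times> {0..1::real}"
  have in_ball: "cmod (of_real t * b) < 1" "cmod (u * (of_real t * b)) < 1"
    if "cmod u \<le> 1" "0 \<le> t" "t \<le> 1" for u t
  proof -
    have "cmod (of_real t * b) \<le> cmod b" using that by (simp add: norm_mult mult_left_le_one_le)
    then show 1: "cmod (of_real t * b) < 1" using ab by simp
    have "cmod (u * (of_real t * b)) \<le> cmod (of_real t * b)"
      unfolding norm_mult[of u] using that(1) by (intro mult_left_le_one_le) auto
    with 1 show "cmod (u * (of_real t * b)) < 1" by simp
  qed
  have cont_h: "continuous_on ?D h"
  proof -
    have "continuous_on ?D ((\<lambda>x. G (fst x) (snd x)) \<circ>
        (\<lambda>x. (fst x * (of_real (snd x) * b), of_real (snd x) * b)))"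
      by (rule continuous_on_compose)
        (auto intro!: continuous_intros continuous_on_subset[OF cont] simp: in_ball)
    then show ?thesis by (simp add: h_def o_def)
  qed
  define Z where "Z = {x \<in> ?D. h x = 0}"
  have compact_D: "compact ?D" by (intro compact_Times) auto
  have "closed Z"
    unfolding Z_def using continuous_closed_preimage_constant[OF cont_h] compact_D compact_imp_closed
    by blast
  have "compact Z"
  proof -
    have "compact (?D \<inter> Z)" using compact_D \<open>closed Z\<close> by (rule compact_Int_closed)
    also have "?D \<inter> Z = Z" by (auto simp: Z_def)
    finally show ?thesis .
  qed
  moreover have "(a / b, 1) \<in> Z"
    using ab b0 zero by (simp add: Z_def h_def norm_divide)
  ultimately have "\<exists>x\<in>Z. \<forall>y\<in>Z. snd x \<le> snd y"
    by (intro continuous_attains_inf continuous_on_snd continuous_on_id) auto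
  then obtain x0 where x0: "x0 \<in> Z" "\<And>x. x \<in> Z \<Longrightarrow> snd x0 \<le> snd x" by blast
  obtain u0 t0 where ut: "x0 = (u0, t0)" by (cases x0)
  have ut0: "cmod u0 \<le> 1" "0 \<le> t0" "t0 \<le> 1" "h (u0, t0) = 0"
    using x0(1) by (auto simp: Z_def ut)
  have "t0 \<noteq> 0" using ut0(4) origin by (auto simp: h_def)
  then have t0: "t0 > 0" using ut0(2) by simp
  let ?T = "sphere (0::complex) 1 \<times> {0..1::real}"
  have "continuous_on ?T (\<lambda>x. cmod (h x))"
    by (intro continuous_intros continuous_on_subset[OF cont_h]) auto
  moreover have "compact ?T" by (intro compact_Times) auto
  moreover have "?T \<noteq> {}" by (auto intro: exI[of _ 1])
  ultimately have "\<exists>x\<in>?T. \<forall>y\<in>?T. cmod (h x) \<le> cmod (h y)"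
    by (intro continuous_attains_inf)
  then obtain x1 where x1: "x1 \<in> ?T" "\<And>x. x \<in> ?T \<Longrightarrow> cmod (h x1) \<le> cmod (h x)" by blast
  define m where "m = cmod (h x1)"
  have m: "m > 0"
    using x1(1) torus[of "fst x1" "of_real (snd x1) * b"] in_ball(1)[of 0 "snd x1"]
    by (auto simp: m_def h_def)
  have ge: "m \<le> cmod (h (u0, t))" if t: "t \<in> {0..<t0}" for t
  proof -
    have nz: "h (u, t) \<noteq> 0" if "u \<in> cball 0 1" for u
      using x0(2)[of "(u, t)"] that t ut0 by (auto simp: Z_def ut)
    have "(\<lambda>u. h (u, t)) holomorphic_on cball 0 1"
      using hol[of "of_real t * b"] in_ball(1)[of 0 t] t ut0 by (simp add: h_def)
    then have H: "(\<lambda>u. 1 / h (u, t)) holomorphic_on cball 0 1"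
      using nz by (intro holomorphic_intros) auto
    have "cmod (1 / h (u0, t)) \<le> 1 / m"
    proof (rule maximum_modulus_frontier[where S = "cball 0 1" and f = "\<lambda>u. 1 / h (u, t)"])
      show "(\<lambda>u. 1 / h (u, t)) holomorphic_on interior (cball 0 1)"
        using H by (rule holomorphic_on_subset) (rule interior_subset)
      show "continuous_on (closure (cball 0 1)) (\<lambda>u. 1 / h (u, t))"
        using H by (simp add: holomorphic_on_imp_continuous_on)
      fix u :: complex assume "u \<in> frontier (cball 0 1)"
      then have "(u, t) \<in> ?T" using t ut0 by auto
      from x1(2)[OF this] show "cmod (1 / h (u, t)) \<le> 1 / m"
        using m by (simp add: norm_divide m_def frac_le)
    qed (use ut0 in auto)
    moreover have "h (u0, t) \<noteq> 0" using nz[of u0] ut0 by simp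
    ultimately show ?thesis using m by (simp add: norm_divide field_simps)
  qed
  have "m \<le> cmod (h (u0, t0))"
  proof (rule continuous_ge_on_closure[where S = "{0..<t0}" and f = "\<lambda>t. cmod (h (u0, t))"])
    have "continuous_on {0..t0} (h \<circ> (\<lambda>t. (u0, t)))"
      by (rule continuous_on_compose)
        (use ut0 in \<open>auto intro!: continuous_intros continuous_on_subset[OF cont_h]\<close>)
    then show "continuous_on (closure {0..<t0}) (\<lambda>t. cmod (h (u0, t)))"
      using t0 by (auto intro!: continuous_intros simp: o_def)
  qed (use t0 ge in auto)
  then show False using ut0(4) m by simp
qed

text \<open>Off \<open>E\<close>, the real-rootedness bound compares \<open>p(z, M g z)\<close> with
  the fixed nonzero value \<open>p(\<i>, \<i>)\<close>, with a constant \<open>k z\<close> free of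
  \<open>g\<close>. By density the bound holds for all rotations, and
  \<open>no_zero_from_torus\<close> carries nonvanishing to the bidisc.\<close>

lemma pencil_real_rooted_imp_stable:
  assumes p: "p \<in> bipolys n" and ii: "complex_eval2 p \<i> \<i> \<noteq> 0"
    and E: "finite E" "\<And>g. g \<notin> E \<Longrightarrow> real_rooted (pencil n p g)"
  shows "real_stable p"
proof -
  have dp: "degree p \<le> n" and dc: "\<And>j. degree (coeff p j) \<le> n"
    using p by (auto simp: bipolys_def)
  define k where "k z = (1 + cmod (\<i> - z) / Im z) ^ (n + n) * (1 + cmod z) ^ n" for z
  have est: "cmod (complex_eval2 p \<i> \<i>) \<le>
      k z * cmod (complex_eval2 p z ((z + of_real g) / (1 - of_real g * z)))"
    if z: "Im z > 0" and g: "g \<notin> E" for z g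
  proof -
    let ?q = "cpoly (pencil n p g)" and ?F = "complex_eval2 p"
    let ?w = "(z + of_real g) / (1 - of_real g * z)"
    have di: "1 - of_real g * \<i> \<noteq> 0" and dz: "1 - of_real g * z \<noteq> 0"
      using one_minus_real_mult_nonzero z by auto
    have "(\<i> + of_real g) / (1 - of_real g * \<i>) = \<i>"
      using di by (simp add: field_simps)
    then have qi: "poly ?q \<i> = (1 - of_real g * \<i>) ^ n * ?F \<i> \<i>"
      using poly_pencil[OF dp di] by simp
    have "cmod (poly ?q \<i>) \<le> (1 + cmod (\<i> - z) / Im z) ^ (n + n) * cmod (poly ?q z)"
      using E(2)[OF g] degree_pencil[OF dc] z by (rule real_rooted_bound)
    also have "cmod (poly ?q z) = cmod (1 - of_real g * z) ^ n * cmod (?F z ?w)"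
      by (simp add: poly_pencil[OF dp dz] norm_mult norm_power)
    \<comment> \<open>Both \<open>|1 - g z|\<close> and \<open>|1 - g \<i>|\<close> grow linearly in
      \<open>g\<close>; comparing them lets the power of \<open>1 - g \<i>\<close> cancel and leaves
      a constant without \<open>g\<close>.\<close>
    also have "cmod (1 - of_real g * z) ^ n \<le> ((1 + cmod z) * cmod (1 - of_real g * \<i>)) ^ n"
    proof (rule power_mono)
      have "1 \<le> cmod (1 - of_real g * \<i>)"
        using abs_Re_le_cmod[of "1 - of_real g * \<i>"] by simp
      moreover have "\<bar>g\<bar> \<le> cmod (1 - of_real g * \<i>)"
        using abs_Im_le_cmod[of "1 - of_real g * \<i>"] by simp
      then have "\<bar>g\<bar> * cmod z \<le> cmod (1 - of_real g * \<i>) * cmod z" by (simp add: mult_right_mono)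
      moreover have "cmod (1 - of_real g * z) \<le> 1 + \<bar>g\<bar> * cmod z"
        using norm_triangle_ineq4[of 1 "of_real g * z"] by (simp add: norm_mult)
      ultimately show "cmod (1 - of_real g * z) \<le> (1 + cmod z) * cmod (1 - of_real g * \<i>)"
        by (simp add: algebra_simps)
    qed auto
    finally have "cmod (1 - of_real g * \<i>) ^ n * cmod (?F \<i> \<i>) \<le>
        cmod (1 - of_real g * \<i>) ^ n * (k z * cmod (?F z ?w))"
      using z by (simp add: qi norm_mult norm_power k_def power_mult_distrib mult_ac
          mult_left_mono mult_right_mono)
    moreover have "cmod (1 - of_real g * \<i>) ^ n > 0" using di by simp
    ultimately show ?thesis by (simp only: mult_le_cancel_left_pos)
  qed
  define G where "G a b = complex_eval2 p (cayley a) (cayley b)" for a b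
  have G0: "G 0 0 \<noteq> 0" using ii by (simp add: G_def cayley_def)
  have contG: "continuous_on S (\<lambda>x. G (f x) (g x))"
    if "continuous_on S f" "continuous_on S g" "\<And>x. x \<in> S \<Longrightarrow> cmod (f x) < 1"
      "\<And>x. x \<in> S \<Longrightarrow> cmod (g x) < 1" for S f g
  proof -
    have "f x \<noteq> 1" "g x \<noteq> 1" if "x \<in> S" for x
      using \<open>x \<in> S \<Longrightarrow> cmod (f x) < 1\<close> \<open>x \<in> S \<Longrightarrow> cmod (g x) < 1\<close> that by auto
    then show ?thesis
      unfolding G_def cayley_def using that(1,2)
      by (intro poly_continuous_complex_eval2 continuous_intros) auto
  qed
  have holG: "(\<lambda>x. G (f x) (g x)) holomorphic_on S"
    if "f holomorphic_on S" "g holomorphic_on S" "\<And>x. x \<in> S \<Longrightarrow> cmod (f x) < 1"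
      "\<And>x. x \<in> S \<Longrightarrow> cmod (g x) < 1" for S f g
  proof -
    have "f x \<noteq> 1" "g x \<noteq> 1" if "x \<in> S" for x
      using \<open>x \<in> S \<Longrightarrow> cmod (f x) < 1\<close> \<open>x \<in> S \<Longrightarrow> cmod (g x) < 1\<close> that by auto
    then show ?thesis
      unfolding G_def cayley_def using that(1,2)
      by (intro poly_holomorphic_complex_eval2 holomorphic_intros) auto
  qed
  have torus: "G w (u * w) \<noteq> 0" if w: "cmod w < 1" and u: "cmod u = 1" for u w
  proof -
    \<comment> \<open>The excluded rotations are the images of \<open>E\<close> and the point
      \<open>-1\<close>, which no real \<open>g\<close> reaches. The circle has no isolated points,
      so every point of it is a limit of the remaining ones.\<close>
    define B where "B = insert (-1) ((\<lambda>g. (1 + \<i> * of_real g) / (1 - \<i> * of_real g)) ` E)"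
    have "finite B" using E(1) by (simp add: B_def)
    have "u islimpt sphere 0 1"
    proof (rule connected_imp_perfect)
      show "connected (sphere (0::complex) 1)" by (rule connected_sphere) simp
      show "sphere 0 1 \<noteq> {x}" for x :: complex
      proof
        assume "sphere 0 1 = {x}"
        then have "(1::complex) \<in> {x}" "(-1::complex) \<in> {x}" by (metis mem_sphere_0 norm_one norm_minus_cancel)+
        then show False by simp
      qed
    qed (use u in auto)
    then have "u islimpt (B \<inter> sphere 0 1) \<union> (sphere 0 1 - B)"
      by (metis Int_Diff_Un inf_commute)
    then have "u islimpt (sphere 0 1 - B)"
      using \<open>finite B\<close> by (simp add: islimpt_Un_finite)
    then have cl: "u \<in> closure (sphere 0 1 - B)" by (simp add: closure_def)
    have "cmod (complex_eval2 p \<i> \<i>) \<le> k (cayley w) * cmod (G w (u * w))"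
    proof (rule continuous_ge_on_closure[OF _ cl, where f = "\<lambda>u. k (cayley w) * cmod (G w (u * w))"])
      have "closure (sphere 0 1 - B) \<subseteq> sphere 0 1" by (rule closure_minimal) auto
      then have "cmod v = 1" if "v \<in> closure (sphere 0 1 - B)" for v using that by auto
      then show "continuous_on (closure (sphere 0 1 - B)) (\<lambda>u. k (cayley w) * cmod (G w (u * w)))"
        using w by (intro continuous_intros contG) (auto simp: norm_mult)
      fix v assume v: "v \<in> sphere 0 1 - B"
      define g where "g = Im v / (1 + Re v)"
      have v1: "cmod v = 1" "v \<noteq> -1" using v by (auto simp: B_def)
      have "v * (1 - \<i> * of_real g) = 1 + \<i> * of_real g"
        unfolding g_def using v1 by (rule unit_circle_tangent)
      moreover have "1 - \<i> * of_real g \<noteq> 0" by (auto simp: complex_eq_iff)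
      ultimately have "v = (1 + \<i> * of_real g) / (1 - \<i> * of_real g)" by (simp add: field_simps)
      then have "g \<notin> E" using v by (auto simp: B_def)
      then show "cmod (complex_eval2 p \<i> \<i>) \<le> k (cayley w) * cmod (G w (v * w))"
        using est[OF Im_cayley[OF w], of g] cayley_rotate[OF w v1] by (simp add: G_def g_def)
    qed
    then show ?thesis using ii by auto
  qed
  have "complex_eval2 p z1 z2 \<noteq> 0" if z: "Im z1 > 0" "Im z2 > 0" for z1 z2
  proof -
    obtain a where a: "cmod a < 1" "cayley a = z1" using cayley_surj[OF z(1)] .
    obtain b where b: "cmod b < 1" "cayley b = z2" using cayley_surj[OF z(2)] .
    have "G a b \<noteq> 0"
    \<comment> \<open>\<open>no_zero_from_torus\<close> covers the half of the bidisc where the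
      first argument is the smaller one; the other half follows with the arguments of
      \<open>G\<close> exchanged.\<close>
    proof (cases "cmod a \<le> cmod b")
      case True
      show ?thesis
      proof (rule no_zero_from_torus[where G = G, OF _ _ _ G0 True b(1)])
        show "continuous_on (ball 0 1 \<times> ball 0 1) (\<lambda>x. G (fst x) (snd x))"
          by (intro contG continuous_intros) auto
        show "(\<lambda>u. G (u * b) b) holomorphic_on cball 0 1" if "cmod b < 1" for b
        proof (intro holG holomorphic_intros)
          fix u :: complex assume "u \<in> cball 0 1"
          then have "cmod (u * b) \<le> cmod b" by (simp add: norm_mult mult_left_le_one_le)
          then show "cmod (u * b) < 1" using that by simp
        qed (use that in auto)
        fix u w :: complex assume uw: "cmod u = 1" "cmod w < 1"
        then have "G (u * w) (inverse u * (u * w)) \<noteq> 0"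
          by (intro torus) (auto simp: norm_mult norm_inverse)
        moreover have "u \<noteq> 0" using uw by auto
        ultimately show "G (u * w) w \<noteq> 0" by (simp flip: mult.assoc)
      qed
    next
      case False
      then have le: "cmod b \<le> cmod a" by simp
      show ?thesis
      proof (rule no_zero_from_torus[where G = "\<lambda>x y. G y x", OF _ _ _ G0 le a(1)])
        show "continuous_on (ball 0 1 \<times> ball 0 1) (\<lambda>x. G (snd x) (fst x))"
          by (intro contG continuous_intros) auto
        show "(\<lambda>u. G b (u * b)) holomorphic_on cball 0 1" if "cmod b < 1" for b
        proof (intro holG holomorphic_intros)
          fix u :: complex assume "u \<in> cball 0 1"
          then have "cmod (u * b) \<le> cmod b" by (simp add: norm_mult mult_left_le_one_le)
          then show "cmod (u * b) < 1" using that by simp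
        qed (use that in auto)
      qed (rule torus)
    qed
    then show ?thesis using a b by (simp add: G_def)
  qed
  then show ?thesis by (simp add: real_stable_def)
qed

section \<open>Leading minors and Schur complements\<close>

definition leading_minor :: "nat \<Rightarrow> (nat \<Rightarrow> nat \<Rightarrow> real) \<Rightarrow> real" where
  "leading_minor k M = Determinant.det (Matrix.mat k k (\<lambda>(i, j). M i j))"

text \<open>For \<open>M 0 0 = 0\<close> this just deletes the first row and column, since \<open>x / 0 = 0\<close>.\<close>

definition schur :: "(nat \<Rightarrow> nat \<Rightarrow> real) \<Rightarrow> nat \<Rightarrow> nat \<Rightarrow> real" where
  "schur M i j = M (Suc i) (Suc j) - M (Suc i) 0 * M 0 (Suc j) / M 0 0"

definition quad :: "nat \<Rightarrow> (nat \<Rightarrow> nat \<Rightarrow> real) \<Rightarrow> (nat \<Rightarrow> real) \<Rightarrow> real" where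
  "quad k M v = (\<Sum>i<k. \<Sum>j<k. v i * v j * M i j)"

definition psd :: "nat \<Rightarrow> (nat \<Rightarrow> nat \<Rightarrow> real) \<Rightarrow> bool" where
  "psd k M \<longleftrightarrow> (\<forall>v. quad k M v \<ge> 0)"

definition pos_def :: "nat \<Rightarrow> (nat \<Rightarrow> nat \<Rightarrow> real) \<Rightarrow> bool" where
  "pos_def k M \<longleftrightarrow> (\<forall>v. (\<exists>i<k. v i \<noteq> 0) \<longrightarrow> quad k M v > 0)"

definition symm :: "(nat \<Rightarrow> nat \<Rightarrow> real) \<Rightarrow> bool" where
  "symm M \<longleftrightarrow> (\<forall>i j. M i j = M j i)"

lemma symm_schur: "symm M \<Longrightarrow> symm (schur M)"
  unfolding symm_def schur_def by (metis mult.commute)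

lemma leading_minor_0 [simp]: "leading_minor 0 M = 1"
  by (simp add: leading_minor_def)

lemma leading_minor_eq_0_iff:
  "leading_minor k M = 0 \<longleftrightarrow> (\<exists>v. (\<exists>i<k. v i \<noteq> 0) \<and> (\<forall>i<k. (\<Sum>j<k. M i j * v j) = 0))"
proof -
  let ?A = "Matrix.mat k k (\<lambda>(i, j). M i j)"
  have "leading_minor k M = 0 \<longleftrightarrow>
      (\<exists>v. v \<in> carrier_vec k \<and> v \<noteq> 0\<^sub>v k \<and> ?A *\<^sub>v v = 0\<^sub>v k)"
    unfolding leading_minor_def by (rule det_0_iff_vec_prod_zero_field) auto
  also have "\<dots> \<longleftrightarrow> (\<exists>v. (\<exists>i<k. v i \<noteq> 0) \<and> (\<forall>i<k. (\<Sum>j<k. M i j * v j) = 0))"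
  proof
    assume "\<exists>v. v \<in> carrier_vec k \<and> v \<noteq> 0\<^sub>v k \<and> ?A *\<^sub>v v = 0\<^sub>v k"
    then obtain v where v: "v \<in> carrier_vec k" "v \<noteq> 0\<^sub>v k" "?A *\<^sub>v v = 0\<^sub>v k" by blast
    have "\<exists>i<k. vec_index v i \<noteq> 0"
    proof (rule ccontr)
      assume "\<not> ?thesis"
      then have "v = 0\<^sub>v k" using v(1) by (intro eq_vecI) auto
      with v(2) show False ..
    qed
    moreover have "(\<Sum>j<k. M i j * vec_index v j) = 0" if "i < k" for i
    proof -
      have "vec_index (?A *\<^sub>v v) i = 0" using v(3) that by simp
      then show ?thesis using that v(1)
        by (simp add: scalar_prod_def lessThan_atLeast0)
    qed
    ultimately show "\<exists>v. (\<exists>i<k. v i \<noteq> 0) \<and> (\<forall>i<k. (\<Sum>j<k. M i j * v j) = 0)" by blast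
  next
    assume "\<exists>v. (\<exists>i<k. v i \<noteq> 0) \<and> (\<forall>i<k. (\<Sum>j<k. M i j * v j) = 0)"
    then obtain v where v: "\<exists>i<k. v i \<noteq> 0" "\<And>i. i < k \<Longrightarrow> (\<Sum>j<k. M i j * v j) = 0" by blast
    let ?v = "Matrix.vec k v"
    have "?v \<noteq> 0\<^sub>v k"
    proof
      assume "?v = 0\<^sub>v k"
      then have "vec_index ?v i = 0" if "i < k" for i using that by simp
      with v(1) show False by auto
    qed
    moreover have "?A *\<^sub>v ?v = 0\<^sub>v k"
      using v(2) by (intro eq_vecI) (simp_all add: scalar_prod_def lessThan_atLeast0)
    ultimately show "\<exists>v. v \<in> carrier_vec k \<and> v \<noteq> 0\<^sub>v k \<and> ?A *\<^sub>v v = 0\<^sub>v k"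
      by (intro exI[of _ ?v]) simp
  qed
  finally show ?thesis .
qed

text \<open>Block LU factorisation: the first column below the pivot, divided by
  \<open>M 0 0\<close>, gives the unit lower factor \<open>?E\<close>, and the upper factor
  \<open>?U\<close> carries the Schur complement as its lower block.\<close>

lemma leading_minor_Suc:
  assumes "M 0 0 \<noteq> 0"
  shows "leading_minor (Suc k) M = M 0 0 * leading_minor k (schur M)"
proof -
  let ?A = "Matrix.mat (Suc k) (Suc k) (\<lambda>(i, j). M i j)"
  let ?c = "Matrix.mat k 1 (\<lambda>(i, j). M (Suc i) 0 / M 0 0)"
  let ?r = "Matrix.mat 1 k (\<lambda>(i, j). M 0 (Suc j))"
  let ?S = "Matrix.mat k k (\<lambda>(i, j). schur M i j)"
  let ?m = "Matrix.mat 1 1 (\<lambda>_. M 0 0)"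
  let ?E = "four_block_mat (1\<^sub>m 1) (0\<^sub>m 1 k) ?c (1\<^sub>m k)"
  let ?U = "four_block_mat ?m ?r (0\<^sub>m k 1) ?S"
  have "?E * ?U = four_block_mat (1\<^sub>m 1 * ?m + 0\<^sub>m 1 k * 0\<^sub>m k 1) (1\<^sub>m 1 * ?r + 0\<^sub>m 1 k * ?S)
      (?c * ?m + 1\<^sub>m k * 0\<^sub>m k 1) (?c * ?r + 1\<^sub>m k * ?S)"
    by (rule mult_four_block_mat) auto
  also have "\<dots> = ?A"
    using assms
    by (intro eq_matI)
      (auto simp: four_block_mat_def Let_def scalar_prod_def schur_def less_Suc_eq_0_disj)
  finally have "Determinant.det ?A = Determinant.det ?E * Determinant.det ?U"
    by (metis det_mult four_block_carrier_mat one_carrier_mat mat_carrier plus_1_eq_Suc)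
  moreover have "Determinant.det ?E = Determinant.det (1\<^sub>m 1 :: real mat) * Determinant.det (1\<^sub>m k :: real mat)"
    by (rule det_four_block_mat_upper_right_zero) auto
  moreover have "Determinant.det ?U = Determinant.det ?m * Determinant.det ?S"
    by (rule det_four_block_mat_lower_left_zero_col) auto
  moreover have "Determinant.det ?m = M 0 0" by (subst det_single) auto
  ultimately show ?thesis by (simp add: leading_minor_def)
qed

section \<open>Quadratic forms and symmetric elimination\<close>

lemma quad_Suc:
  "quad (Suc k) M v = v 0 * v 0 * M 0 0 + (\<Sum>j<k. v 0 * v (Suc j) * M 0 (Suc j)) +
    (\<Sum>i<k. v (Suc i) * v 0 * M (Suc i) 0) + (\<Sum>i<k. \<Sum>j<k. v (Suc i) * v (Suc j) * M (Suc i) (Suc j))"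
  by (simp add: quad_def sum.lessThan_Suc_shift sum.distrib del: sum.lessThan_Suc)

text \<open>Completing the square in the first coordinate.\<close>

lemma quad_schur:
  assumes "symm M" "M 0 0 \<noteq> 0"
  shows "quad (Suc k) M v = M 0 0 * (v 0 + (\<Sum>j<k. M 0 (Suc j) * v (Suc j)) / M 0 0)\<^sup>2 +
    quad k (schur M) (\<lambda>i. v (Suc i))"
proof -
  let ?s = "\<Sum>j<k. M 0 (Suc j) * v (Suc j)"
  have "(\<Sum>i<k. \<Sum>j<k. v (Suc i) * v (Suc j) * (M (Suc i) 0 * M 0 (Suc j) / M 0 0)) =
      ?s * ?s / M 0 0"
    using assms(1) unfolding sum_product symm_def
    by (simp add: sum_divide_distrib mult_ac)
  then have "quad k (schur M) (\<lambda>i. v (Suc i)) =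
      (\<Sum>i<k. \<Sum>j<k. v (Suc i) * v (Suc j) * M (Suc i) (Suc j)) - ?s * ?s / M 0 0"
    by (simp add: quad_def schur_def right_diff_distrib sum_subtractf)
  moreover have "(\<Sum>j<k. v 0 * v (Suc j) * M 0 (Suc j)) = v 0 * ?s"
    by (simp add: sum_distrib_left mult_ac)
  moreover have "(\<Sum>i<k. v (Suc i) * v 0 * M (Suc i) 0) = v 0 * ?s"
    using assms(1) by (simp add: sum_distrib_left mult_ac symm_def)
  moreover have "x * x * m + x * s + x * s + A = m * (x + s / m)\<^sup>2 + (A - s * s / m)"
    if "m \<noteq> 0" for x m s A :: real
    using that by (simp add: power2_eq_square field_simps)
  ultimately show ?thesis
    using assms(2) by (simp only: quad_Suc) blast
qed

primrec elimination_psd :: "nat \<Rightarrow> (nat \<Rightarrow> nat \<Rightarrow> real) \<Rightarrow> bool" where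
  "elimination_psd 0 M \<longleftrightarrow> True"
| "elimination_psd (Suc k) M \<longleftrightarrow>
    M 0 0 \<ge> 0 \<and> (M 0 0 = 0 \<longrightarrow> (\<forall>j\<le>k. M 0 j = 0)) \<and> elimination_psd k (schur M)"

lemma quad_zero_row:
  assumes "symm M" "\<And>j. j \<le> k \<Longrightarrow> M 0 j = 0"
  shows "quad (Suc k) M v = quad k (schur M) (\<lambda>i. v (Suc i))"
proof -
  have "M i 0 = 0" if "i \<le> k" for i using assms that by (metis symm_def)
  then show ?thesis
    using assms(2) unfolding quad_Suc by (simp add: quad_def schur_def)
qed

lemma quad_split_zero:
  assumes "symm M" "M 0 0 = 0" "0 < j" "j \<le> k" "v = (\<lambda>i. if i = 0 then x else if i = j then 1 else 0)"
  shows "quad (Suc k) M v = M j j + 2 * x * M 0 j"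
proof -
  obtain l where l: "j = Suc l" "l < k" using assms by (cases j) auto
  have "M (Suc l) 0 = M 0 (Suc l)" using assms by (simp add: symm_def)
  then show ?thesis
    using assms l by (simp add: quad_Suc if_distrib[of "\<lambda>x. x * _"] if_distrib[of "\<lambda>x. _ * x"]
        sum.delta cong: if_cong)
qed

text \<open>A nonzero pivot separates a square from the form of the Schur complement. With pivot
  zero and some \<open>M 0 j\<close> nonzero, the form is affine along a line in the direction of
  the first coordinate and becomes negative there.\<close>

lemma psd_iff_elimination_psd: "symm M \<Longrightarrow> psd k M \<longleftrightarrow> elimination_psd k M"
proof (induction k arbitrary: M)
  case 0
  then show ?case by (simp add: psd_def quad_def)
next
  case (Suc k)
  have IH: "psd k (schur M) \<longleftrightarrow> elimination_psd k (schur M)"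
    using Suc by (simp add: symm_schur)
  have unit: "quad (Suc k) M (\<lambda>i. if i = 0 then 1 else 0) = M 0 0"
    by (simp add: quad_Suc)
  show ?case
  proof (cases "M 0 0 = 0")
    case False
    have "psd (Suc k) M \<longleftrightarrow> M 0 0 > 0 \<and> psd k (schur M)"
    proof
      assume p: "psd (Suc k) M"
      then have "M 0 0 \<ge> 0" using unit by (metis psd_def)
      moreover have "quad k (schur M) w \<ge> 0" for w
      proof -
        \<comment> \<open>The first coordinate makes the completed square vanish.\<close>
        define v where "v i = (case i of 0 \<Rightarrow> - (\<Sum>j<k. M 0 (Suc j) * w j) / M 0 0 | Suc i \<Rightarrow> w i)" for i
        have "quad (Suc k) M v = quad k (schur M) w"
          by (subst quad_schur[OF Suc.prems False]) (simp add: v_def)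
        then show ?thesis using p by (metis psd_def)
      qed
      ultimately show "M 0 0 > 0 \<and> psd k (schur M)" using False by (auto simp: psd_def)
    next
      assume "M 0 0 > 0 \<and> psd k (schur M)"
      then show "psd (Suc k) M"
        using quad_schur[OF Suc.prems False] by (simp add: psd_def)
    qed
    then show ?thesis using IH False by auto
  next
    case True
    have "M 0 j = 0" if p: "psd (Suc k) M" and j: "j \<le> k" for j
    proof (rule ccontr)
      assume n: "M 0 j \<noteq> 0"
      then have "j > 0" using True by (cases j) auto
      \<comment> \<open>The solution of \<open>M j j + 2 x M 0 j = -1\<close>.\<close>
      let ?x = "- (M j j + 1) / (2 * M 0 j)"
      have "quad (Suc k) M (\<lambda>i. if i = 0 then ?x else if i = j then 1 else 0) = M j j + 2 * ?x * M 0 j"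
        by (rule quad_split_zero) (use Suc.prems True \<open>j > 0\<close> j in auto)
      also have "\<dots> = -1" using n by (simp add: field_simps)
      finally show False using p unfolding psd_def by (metis neg_0_le_iff_le not_one_le_zero)
    qed
    moreover have "psd (Suc k) M \<longleftrightarrow> psd k (schur M)" if z: "\<forall>j\<le>k. M 0 j = 0"
    proof -
      have q: "quad (Suc k) M v = quad k (schur M) (\<lambda>i. v (Suc i))" for v
        using Suc.prems z by (intro quad_zero_row) auto
      have "quad k (schur M) w = quad (Suc k) M (\<lambda>i. w (i - 1))" for w
        by (simp add: q)
      then show ?thesis using q by (metis psd_def)
    qed
    ultimately show ?thesis using IH True by auto
  qed
qed

lemma leading_minor_zero_row:
  assumes "symm M" "k > 0" "\<And>j. j < k \<Longrightarrow> M 0 j = 0"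
  shows "leading_minor k M = 0"
proof -
  have "M i 0 = 0" if "i < k" for i using assms that by (metis symm_def)
  then have "(\<Sum>j<k. M i j * (if j = 0 then 1 else 0)) = 0" if "i < k" for i
    using that by (intro sum.neutral) auto
  then show ?thesis
    unfolding leading_minor_eq_0_iff using assms(2)
    by (intro exI[of _ "\<lambda>j. if j = 0 then 1 else 0"]) auto
qed

text \<open>From a zero pivot on, both sides vanish: the product contains that pivot, and the zero
  row accompanying it makes the larger minors singular. So elimination can run on past zero pivots
  and still report every leading minor.\<close>

lemma leading_minor_eq_prod_pivots:
  assumes "symm M" "elimination_psd k M" "j \<le> k"
  shows "leading_minor j M = (\<Prod>c<j. (schur ^^ c) M 0 0)"
  using assms
proof (induction k arbitrary: M j)
  case (Suc k)
  show ?case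
  proof (cases j)
    case (Suc l)
    have shift: "(\<Prod>c<Suc l. (schur ^^ c) M 0 0) = M 0 0 * (\<Prod>c<l. (schur ^^ c) (schur M) 0 0)"
      by (simp only: prod.lessThan_Suc_shift) (simp add: funpow_swap1)
    show ?thesis
    proof (cases "M 0 0 = 0")
      case True
      then have "leading_minor j M = 0"
        using Suc.prems \<open>j = Suc l\<close> by (intro leading_minor_zero_row) auto
      then show ?thesis using True shift Suc by simp
    next
      case False
      have "leading_minor l (schur M) = (\<Prod>c<l. (schur ^^ c) (schur M) 0 0)"
        using Suc.prems Suc by (intro Suc.IH) (auto simp: symm_schur)
      then show ?thesis using shift Suc leading_minor_Suc[of M l] False by simp
    qed
  qed simp
qed simp

lemma elimination_psd_pivot_nonneg: "elimination_psd k M \<Longrightarrow> c < k \<Longrightarrow> (schur ^^ c) M 0 0 \<ge> 0"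
proof (induction k arbitrary: M c)
  case (Suc k)
  then show ?case by (cases c) (auto simp: funpow_swap1)
qed simp

text \<open>The minor of order \<open>r\<close> is a product of nonnegative pivots; if it is
  nonzero, all its factors, and so all shorter products, are positive. Applied at one sample, this
  shows that no minor of order up to \<open>r\<close> vanishes identically.\<close>

lemma leading_minors_pos_if_psd:
  assumes "symm M" "psd n M" "leading_minor r M \<noteq> 0" "j \<le> r" "r \<le> n"
  shows "leading_minor j M > 0"
proof -
  have e: "elimination_psd n M" using assms psd_iff_elimination_psd by blast
  have "(schur ^^ c) M 0 0 > 0" if "c < r" for c
  proof -
    have "(\<Prod>c<r. (schur ^^ c) M 0 0) \<noteq> 0"
      using leading_minor_eq_prod_pivots[OF assms(1) e assms(5)] assms(3) by simp
    then have "(schur ^^ c) M 0 0 \<noteq> 0" using that by auto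
    then show ?thesis using elimination_psd_pivot_nonneg[OF e, of c] that assms(5) by simp
  qed
  then show ?thesis
    using assms by (subst leading_minor_eq_prod_pivots[OF assms(1) e]) (auto intro!: prod_pos)
qed

lemma psd_leading_minor_nonneg:
  assumes "symm M" "psd n M" "j \<le> n"
  shows "leading_minor j M \<ge> 0"
  using leading_minors_pos_if_psd[OF assms(1,2), of j j] assms(3)
  by (cases "leading_minor j M = 0") auto

text \<open>Dividing by the first pivot turns the hypotheses into the same ones for the Schur
  complement; \<open>quad_schur\<close> reassembles the form.\<close>

lemma sylvester:
  assumes "symm M" "\<And>j. 0 < j \<Longrightarrow> j \<le> k \<Longrightarrow> leading_minor j M > 0"
  shows "pos_def k M"
  using assms
proof (induction k arbitrary: M)
  case (Suc k)
  have "leading_minor (Suc 0) M > 0" using Suc.prems by simp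
  then have M: "M 0 0 > 0"
    using leading_minor_zero_row[OF Suc.prems(1), of "Suc 0"] leading_minor_Suc[of M 0]
    by (cases "M 0 0 = 0") auto
  have "leading_minor j (schur M) > 0" if "0 < j" "j \<le> k" for j
    using Suc.prems(2)[of "Suc j"] that M by (simp add: leading_minor_Suc zero_less_mult_iff)
  then have IH: "pos_def k (schur M)"
    using Suc by (simp add: symm_schur)
  show ?case
    unfolding pos_def_def
  proof (intro allI impI)
    fix v :: "nat \<Rightarrow> real" assume v: "\<exists>i<Suc k. v i \<noteq> 0"
    let ?q = "quad k (schur M) (\<lambda>i. v (Suc i))"
    let ?l = "v 0 + (\<Sum>j<k. M 0 (Suc j) * v (Suc j)) / M 0 0"
    have eq: "quad (Suc k) M v = M 0 0 * ?l\<^sup>2 + ?q"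
      using Suc.prems(1) M by (intro quad_schur) auto
    show "quad (Suc k) M v > 0"
    proof (cases "\<exists>i<k. v (Suc i) \<noteq> 0")
      case True
      then have "?q > 0" using IH by (auto simp: pos_def_def)
      then show ?thesis unfolding eq using M by (simp add: add_nonneg_pos)
    next
      case False
      then have "v 0 \<noteq> 0" using v by (auto simp: less_Suc_eq_0_disj)
      moreover have "?l = v 0" "?q = 0" using False by (auto simp: quad_def)
      ultimately show ?thesis unfolding eq using M by simp
    qed
  qed
qed (simp add: pos_def_def)

text \<open>The unrolled form speaks of the \<open>c\<close>-th Schur complement, which is what the
  trailing block of the stored matrix holds in round \<open>c\<close> of the program.\<close>

lemma elimination_psd_iff:
  "elimination_psd k M \<longleftrightarrow> (\<forall>c<k. (schur ^^ c) M 0 0 \<ge> 0 \<and>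
     ((schur ^^ c) M 0 0 = 0 \<longrightarrow> (\<forall>j<k - c. (schur ^^ c) M 0 j = 0)))"
proof (induction k arbitrary: M)
  case (Suc k)
  have "(\<forall>c<Suc k. P c) \<longleftrightarrow> P 0 \<and> (\<forall>c<k. P (Suc c))" for P
    by (auto simp: less_Suc_eq_0_disj)
  then show ?case
    by (simp add: Suc funpow_swap1 less_Suc_eq_le del: funpow.simps(2)) (simp add: funpow_swap1)
qed simp

section \<open>The Bezoutian of a polynomial and its derivative\<close>

lemma pderiv_prod_roots:
  fixes A :: "complex multiset"
  shows "pderiv (\<Prod>t\<in>#A. [:- t, 1:]) = (\<Sum>t\<in>#A. \<Prod>s\<in>#A - {#t#}. [:- s, 1:])"
proof (induction A)
  case (add x A)
  have "(\<Sum>t\<in>#A. \<Prod>s\<in>#add_mset x A - {#t#}. [:- s, 1:]) =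
      (\<Sum>t\<in>#A. [:- x, 1:] * (\<Prod>s\<in>#A - {#t#}. [:- s, 1:]))"
    by (intro arg_cong[of _ _ sum_mset] image_mset_cong) (simp add: multiset_diff_union_assoc)
  also have "\<dots> = [:- x, 1:] * (\<Sum>t\<in>#A. \<Prod>s\<in>#A - {#t#}. [:- s, 1:])"
    by (simp only: sum_mset_distrib_left)
  finally show ?case
    by (simp add: pderiv_mult add.IH pderiv_pCons del: mult_pCons_left)
qed simp

text \<open>The Horner polynomials \<open>b 0 x^i + \<dots> + b i\<close> of the polynomial with descending
  coefficients \<open>b 0, b 1, \<dots>\<close>.\<close>

primrec horner :: "(nat \<Rightarrow> 'a::field) \<Rightarrow> nat \<Rightarrow> 'a poly" where
  "horner b 0 = [:b 0:]"
| "horner b (Suc i) = pCons (b (Suc i)) (horner b i)"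

lemma coeff_horner: "coeff (horner b i) k = (if k \<le> i then b (i - k) else 0)"
  by (induction i arbitrary: k) (auto simp: coeff_pCons split: nat.splits)

text \<open>\<open>horner b i\<close> has degree \<open>i\<close> and leading coefficient
  \<open>b 0\<close>, so the first \<open>k\<close> of them are a triangular basis of the
  polynomials of degree below \<open>k\<close>.\<close>

lemma horner_span:
  assumes "b 0 \<noteq> 0" "\<And>i. i \<ge> k \<Longrightarrow> coeff f i = 0"
  shows "\<exists>w. f = (\<Sum>i<k. Polynomial.smult (w i) (horner b i))"
  using assms(2)
proof (induction k arbitrary: f)
  case 0
  then have "f = 0" by (intro poly_eqI) simp
  then show ?case by simp
next
  case (Suc k)
  let ?c = "coeff f k / b 0"
  have "coeff (f - Polynomial.smult ?c (horner b k)) i = 0" if "i \<ge> k" for i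
    using that Suc.prems[of i] assms(1) by (cases "i = k") (auto simp: coeff_horner)
  from Suc.IH[OF this] obtain w where
    w: "f - Polynomial.smult ?c (horner b k) = (\<Sum>i<k. Polynomial.smult (w i) (horner b i))" by auto
  have "f = (\<Sum>i<Suc k. Polynomial.smult ((w(k := ?c)) i) (horner b i))"
    by (simp add: algebra_simps flip: w)
  then show ?case by blast
qed

lemma horner_independent:
  assumes "b 0 \<noteq> 0" "(\<Sum>i<k. Polynomial.smult (w i) (horner b i)) = 0" "i < k"
  shows "w i = 0"
  using assms(2,3)
proof (induction k arbitrary: i)
  case (Suc k)
  have "coeff (\<Sum>i<Suc k. Polynomial.smult (w i) (horner b i)) k = w k * b 0"
    by (simp add: coeff_sum coeff_horner)
  then have "w k = 0" using assms(1) unfolding Suc.prems(1) by simp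
  with Suc show ?case by (cases "i = k") auto
qed simp

text \<open>The entries are \<open>L (u i * u j)\<close>, where \<open>u i\<close> are the Horner polynomials and \<open>L f\<close> is the sum of \<open>f\<close>
  over the complex roots.  The recursion follows from \<open>u (i + 1) = x * u i + b (i + 1)\<close>; it needs no division
  by the leading coefficient, which keeps the entries polynomial in a parameter.\<close>

primrec bezoutian :: "(nat \<Rightarrow> real) \<Rightarrow> (nat \<Rightarrow> real) \<Rightarrow> nat \<Rightarrow> nat \<Rightarrow> real" where
  "bezoutian b e 0 = (\<lambda>j. b 0 * e j)"
| "bezoutian b e (Suc i) =
    (\<lambda>j. bezoutian b e i (Suc j) + b (Suc i) * e j - b (Suc j) * e i)"

text \<open>Induction in steps of two along an antidiagonal: the recursion links
  \<open>(i, i + d + 2)\<close> to \<open>(i + 1, i + d + 1)\<close> and likewise their mirror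
  images, with the same correction terms in both links.\<close>

lemma bezoutian_commute: "bezoutian b e i (i + d) = bezoutian b e (i + d) i"
proof (induction d arbitrary: i rule: induct_nat_012)
  case (ge2 d)
  show ?case
    using ge2.IH(1)[of "Suc i"] ge2.IH(2)[of i]
    by simp
qed simp_all

lemma symm_bezoutian: "symm (bezoutian b e)"
  unfolding symm_def by (metis bezoutian_commute le_Suc_ex nat_le_linear)

text \<open>The descending coefficients of \<open>q\<close>, regarded as a polynomial of degree \<open>N\<close>, and those of
  \<open>x q'\<close>.\<close>

definition desc_coeff :: "nat \<Rightarrow> real poly \<Rightarrow> nat \<Rightarrow> real" where
  "desc_coeff N q i = (if i \<le> N then coeff q (N - i) else 0)"

definition desc_deriv :: "nat \<Rightarrow> real poly \<Rightarrow> nat \<Rightarrow> real" where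
  "desc_deriv N q i = real (N - i) * desc_coeff N q i"

abbreviation bez :: "nat \<Rightarrow> real poly \<Rightarrow> nat \<Rightarrow> nat \<Rightarrow> real" where
  "bez N q \<equiv> bezoutian (desc_coeff N q) (desc_deriv N q)"

section \<open>The sum over the roots as a linear functional, and Hermite's theorem\<close>

locale root_functional =
  fixes q :: "real poly" and N :: nat and A :: "complex multiset"
  assumes deg: "degree q = N" and lead: "coeff q N \<noteq> 0"
    and size_A: "size A = N"
    and factor: "cpoly q = Polynomial.smult (of_real (coeff q N)) (\<Prod>t\<in>#A. [:- t, 1:])"
begin

definition c :: "nat \<Rightarrow> complex" where "c i = of_real (desc_coeff N q i)"

definition L :: "complex poly \<Rightarrow> complex" where "L f = (\<Sum>t\<in>#A. poly f t)"

lemma L_add: "L (f + g) = L f + L g"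
  by (simp add: L_def sum_mset.distrib)

lemma L_smult: "L (Polynomial.smult a f) = a * L f"
proof -
  have "(\<Sum>t\<in>#B. a * g t) = a * (\<Sum>t\<in>#B. g t)" for g :: "complex \<Rightarrow> complex" and B
    by (induction B) (simp_all add: distrib_left)
  then show ?thesis by (simp add: L_def)
qed

lemma L_sum: "finite I \<Longrightarrow> L (\<Sum>i\<in>I. f i) = (\<Sum>i\<in>I. L (f i))"
  by (induction I rule: finite_induct) (simp_all add: L_add, simp add: L_def)

lemma root_iff: "poly (cpoly q) t = 0 \<longleftrightarrow> t \<in># A"
proof -
  have "poly (\<Prod>t\<in>#B. [:- t, 1:]) t = 0 \<longleftrightarrow> t \<in># B" for B :: "complex multiset"
    by (induction B) (auto simp flip: left_diff_distrib)
  then show ?thesis unfolding factor using lead by simp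
qed

lemma c0: "c 0 \<noteq> 0"
  using lead by (simp add: c_def desc_coeff_def)

lemma horner_N: "horner c N = cpoly q"
proof (rule poly_eqI)
  fix k
  show "coeff (horner c N) k = coeff (cpoly q) k"
    using deg by (simp add: coeff_horner c_def desc_coeff_def coeff_map_poly coeff_eq_0)
qed

text \<open>Synthetic division: the coefficients of \<open>q / (x - t)\<close>, read from the top,
  are the Horner values of \<open>q\<close> at the root \<open>t\<close>.\<close>

lemma coeff_root_quotient:
  assumes "t \<in># A" "i < N"
  shows "coeff (Polynomial.smult (of_real (coeff q N)) (\<Prod>s\<in>#A - {#t#}. [:- s, 1:])) (N - 1 - i) =
    poly (horner c i) t"
proof -
  define r where "r = Polynomial.smult (of_real (coeff q N)) (\<Prod>s\<in>#A - {#t#}. [:- s, 1:])"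
  obtain B where B: "A = add_mset t B" using assms(1) by (rule multi_member_split[THEN exE])
  have q: "cpoly q = [:- t, 1:] * r"
    unfolding r_def factor by (simp add: B del: mult_pCons_left)
  have cq: "of_real (coeff q k) = coeff ([:- t, 1:] * r) k" for k
    unfolding q[symmetric] by (simp add: coeff_map_poly)
  have r0: "r \<noteq> 0"
    unfolding r_def using lead by (auto simp: prod_mset_zero_iff)
  have "degree (cpoly q) = Suc (degree r)" using r0 by (simp add: q degree_mult_eq del: mult_pCons_left)
  then have N: "N = Suc (degree r)" using deg by simp
  have "coeff r (N - 1 - i) = poly (horner c i) t" using assms(2)
  proof (induction i)
    case 0
    have "of_real (coeff q N) = coeff r (N - 1)"
      by (subst cq) (use N in \<open>auto simp: coeff_pCons coeff_eq_0 split: nat.splits\<close>)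
    then show ?case by (simp add: c_def desc_coeff_def)
  next
    case (Suc i)
    have "of_real (coeff q (N - Suc i)) = coeff r (N - 1 - Suc i) - t * coeff r (N - 1 - i)"
    proof -
      have "N - Suc i = Suc (N - 1 - Suc i)" "N - 1 - i = Suc (N - 1 - Suc i)" using Suc.prems by auto
      then show ?thesis by (subst cq) simp
    qed
    then show ?case using Suc by (simp add: c_def desc_coeff_def)
  qed
  then show ?thesis by (simp add: r_def)
qed

text \<open>Summing \<open>q / (x - t)\<close> over all roots gives \<open>q'\<close>, so the Horner
  values add up to a coefficient of \<open>q'\<close>. From index \<open>N\<close> on, the Horner
  polynomial is \<open>q\<close> times a power of \<open>x\<close> and vanishes at the
  roots.\<close>

lemma L_horner: "L (horner c i) = of_real (desc_deriv N q i)"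
proof (cases "i < N")
  case True
  \<comment> \<open>The summand refers to \<open>A\<close> itself, so the induction runs over
    submultisets \<open>B\<close> while \<open>A\<close> stays fixed.\<close>
  have "coeff (\<Sum>t\<in>#B. Polynomial.smult (of_real (coeff q N)) (\<Prod>s\<in>#A - {#t#}. [:- s, 1:])) (N - 1 - i) =
      (\<Sum>t\<in>#B. poly (horner c i) t)" if "B \<subseteq># A" for B
    using that
  proof (induction B)
    case (add t B)
    then have "t \<in># A" by (metis mset_subset_eqD union_single_eq_member)
    then have "coeff (Polynomial.smult (of_real (coeff q N)) (\<Prod>s\<in>#A - {#t#}. [:- s, 1:])) (N - 1 - i) =
        poly (horner c i) t" using True by (rule coeff_root_quotient)
    moreover have "B \<subseteq># A" using add.prems by (metis mset_subset_eq_insertD subset_mset.less_imp_le)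
    ultimately show ?case using add.IH by simp
  qed simp
  from this[OF subset_mset.order_refl]
  have "L (horner c i) = coeff (\<Sum>t\<in>#A. Polynomial.smult (of_real (coeff q N))
      (\<Prod>s\<in>#A - {#t#}. [:- s, 1:])) (N - 1 - i)"
    by (simp add: L_def)
  also have "(\<Sum>t\<in>#A. Polynomial.smult (of_real (coeff q N)) (\<Prod>s\<in>#A - {#t#}. [:- s, 1:])) =
      Polynomial.smult (of_real (coeff q N)) (\<Sum>t\<in>#A. \<Prod>s\<in>#A - {#t#}. [:- s, 1:])" 
  proof -
    have "(\<Sum>t\<in>#B. Polynomial.smult a (g t)) = Polynomial.smult a (\<Sum>t\<in>#B. g t)"
      for a :: complex and g and B :: "complex multiset"
      by (induction B) (simp_all add: smult_add_right)
    then show ?thesis .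
  qed
  also have "\<dots> = pderiv (cpoly q)"
    by (simp add: factor pderiv_smult pderiv_prod_roots)
  also have "coeff (pderiv (cpoly q)) (N - 1 - i) = of_real (desc_deriv N q i)"
    using True by (simp add: coeff_pderiv coeff_map_poly desc_deriv_def desc_coeff_def Suc_diff_Suc
        del: of_nat_Suc)
  finally show ?thesis .
next
  case False
  have "poly (horner c (N + d)) t = 0" if "t \<in># A" for t d
    using that
  proof (induction d)
    case 0
    then show ?case using root_iff by (simp add: horner_N)
  qed (simp add: c_def desc_coeff_def)
  from this[of _ "i - N"] have "poly (horner c i) t = 0" if "t \<in># A" for t
    using False that by simp
  then have "L (horner c i) = 0" unfolding L_def by (simp add: sum_mset.neutral)
  then show ?thesis using False by (simp add: desc_deriv_def)
qed

text \<open>\<open>horner c (Suc i) * horner c j\<close> and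
  \<open>horner c i * horner c (Suc j)\<close> both equal \<open>x * horner c i * horner c j\<close>
  up to a multiple of a single Horner polynomial; comparing them under \<open>L\<close> gives the
  recursion of \<open>bezoutian\<close>.\<close>

lemma L_horner_mult: "L (horner c i * horner c j) = of_real (bez N q i j)"
proof (induction i arbitrary: j)
  case 0
  show ?case by (simp add: L_smult L_horner) (simp add: c_def)
next
  case (Suc i)
  have s: "pCons a f * g = pCons 0 (f * g) + Polynomial.smult a g"
    "g * pCons a f = pCons 0 (f * g) + Polynomial.smult a g" for a :: complex and f g
    by (simp_all add: mult.commute add.commute)
  have "L (horner c (Suc i) * horner c j) =
      L (pCons 0 (horner c i * horner c j)) + c (Suc i) * of_real (desc_deriv N q j)"
    by (simp only: horner.simps s L_add L_smult L_horner)
  moreover have "L (horner c i * horner c (Suc j)) =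
      L (pCons 0 (horner c i * horner c j)) + c (Suc j) * of_real (desc_deriv N q i)"
    by (simp only: horner.simps s L_add L_smult L_horner mult.commute[of "horner c j"])
  ultimately have "L (horner c (Suc i) * horner c j) = L (horner c i * horner c (Suc j)) +
      c (Suc i) * of_real (desc_deriv N q j) - c (Suc j) * of_real (desc_deriv N q i)"
    by simp
  then show ?case unfolding Suc.IH by (simp add: c_def[of "Suc i"] c_def[of "Suc j"] del: horner.simps)
qed

definition comb :: "nat \<Rightarrow> (nat \<Rightarrow> complex) \<Rightarrow> complex poly" where
  "comb k v = (\<Sum>i<k. Polynomial.smult (v i) (horner c i))"

lemma L_comb: "L (comb k v * comb k w) = (\<Sum>i<k. \<Sum>j<k. v i * w j * of_real (bez N q i j))"
  unfolding comb_def sum_product by (simp add: L_sum L_smult L_horner_mult mult.assoc mult.left_commute)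

lemma quad_bez: "of_real (quad k (bez N q) v) = L ((comb k (\<lambda>i. of_real (v i)))\<^sup>2)"
  by (simp add: power2_eq_square L_comb quad_def)

lemma coeff_comb: "i \<ge> k \<Longrightarrow> coeff (comb k v) i = 0"
  by (simp add: comb_def coeff_sum coeff_horner)

text \<open>The form is a sum of squares of values of a real polynomial at real points.\<close>

lemma real_rooted_imp_psd:
  assumes "real_rooted q"
  shows "psd k (bez N q)"
  unfolding psd_def
proof
  fix v
  let ?f = "comb k (\<lambda>i. of_real (v i))"
  have cnj_f: "cnj (poly ?f t) = poly ?f (cnj t)" for t
    by (rule poly_cnj_real) (simp add: comb_def coeff_sum coeff_horner c_def)
  have "Re (\<Sum>t\<in>#B. (poly ?f t)\<^sup>2) \<ge> 0" if "\<And>t. t \<in># B \<Longrightarrow> Im t = 0" for B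
    using that
  proof (induction B)
    case (add t B)
    then have "cnj t = t" by (simp add: complex_eq_iff)
    then have "cnj (poly ?f t) = poly ?f t" by (simp add: cnj_f)
    then have "Im (poly ?f t) = 0" by (simp only: complex_eq_iff) simp
    then show ?case using add by (simp add: power2_eq_square)
  qed simp
  from this[of A] have "Re (of_real (quad k (bez N q) v)) \<ge> 0"
    unfolding quad_bez using assms root_iff by (simp add: L_def real_rooted_def)
  then show "quad k (bez N q) v \<ge> 0" by simp
qed

end

section \<open>Interpolation at the distinct roots and the converse of Hermite's theorem\<close>

lemma lagrange_interpolation:
  fixes y :: "'a::field \<Rightarrow> 'a"
  assumes "finite S"
  shows "\<exists>w. (\<forall>i\<ge>card S. coeff w i = 0) \<and> (\<forall>s\<in>S. poly w s = y s)"
  using assms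
proof (induction S rule: finite_induct)
  case empty
  then show ?case by (intro exI[of _ 0]) simp
next
  case (insert x S)
  then obtain w where w: "\<And>i. i \<ge> card S \<Longrightarrow> coeff w i = 0" "\<And>s. s \<in> S \<Longrightarrow> poly w s = y s" by blast
  define g where "g = (\<Prod>s\<in>S. [:- s, 1:])"
  have g: "poly g s = 0" if "s \<in> S" for s
    using that insert.hyps by (auto simp: g_def poly_prod)
  have gx: "poly g x \<noteq> 0" using insert.hyps by (auto simp: g_def poly_prod)
  have "degree g \<le> card S" unfolding g_def
    using degree_prod_sum_le[OF insert.hyps(1), of "\<lambda>s. [:- s, 1:]"] by simp
  then have "coeff g i = 0" if "i > card S" for i using that by (simp add: coeff_eq_0)
  then show ?case
    using w g gx insert.hyps
    by (intro exI[of _ "w + Polynomial.smult ((y x - poly w x) / poly g x) g"]) auto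
qed

lemma zero_poly_if_many_roots:
  fixes f :: "'a::field poly"
  assumes "finite S" "\<And>i. i \<ge> card S \<Longrightarrow> coeff f i = 0" "\<And>s. s \<in> S \<Longrightarrow> poly f s = 0"
  shows "f = 0"
proof (rule ccontr)
  assume f: "f \<noteq> 0"
  have "card S \<le> card {x. poly f x = 0}"
    using assms f by (intro card_mono poly_roots_finite) auto
  also have "\<dots> \<le> degree f" using f by (rule card_poly_roots_bound)
  finally show False using assms(2)[of "degree f"] f by simp
qed

context root_functional
begin

text \<open>This makes the leading minors sufficient: for a general matrix of low rank they could all vanish.\<close>

lemma leading_minor_distinct_roots: "leading_minor (card (set_mset A)) (bez N q) \<noteq> 0"
proof
  let ?S = "set_mset A"
  let ?r = "card ?S"
  assume "leading_minor ?r (bez N q) = 0"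
  then obtain v where v: "\<exists>i<?r. v i \<noteq> 0" "\<And>i. i < ?r \<Longrightarrow> (\<Sum>j<?r. bez N q i j * v j) = 0"
    unfolding leading_minor_eq_0_iff by blast
  define f where "f = comb ?r (\<lambda>i. of_real (v i))"
  \<comment> \<open>Interpolating the conjugate values turns \<open>L (g * f)\<close> into the sum
    of \<open>|f|^2\<close> over the roots. Since \<open>g\<close> is again a combination of the
    first \<open>?r\<close> Horner polynomials, the choice of \<open>v\<close> makes this sum
    zero.\<close>
  obtain g where g: "\<And>i. i \<ge> ?r \<Longrightarrow> coeff g i = 0" "\<And>s. s \<in> ?S \<Longrightarrow> poly g s = cnj (poly f s)"
    using lagrange_interpolation[of ?S "\<lambda>s. cnj (poly f s)"] by auto
  obtain w where w: "g = comb ?r w" using horner_span[where b = c and f = g, OF c0 g(1)] by (auto simp: comb_def)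
  have "L (g * f) = (\<Sum>i<?r. w i * of_real (\<Sum>j<?r. bez N q i j * v j))"
    unfolding w f_def L_comb by (simp add: sum_distrib_left mult_ac)
  also have "\<dots> = 0" using v(2) by simp
  finally have 0: "L (g * f) = 0" .
  have "(\<Sum>t\<in>#B. poly (g * f) t) = of_real (\<Sum>t\<in>#B. (cmod (poly f t))\<^sup>2)" if "set_mset B \<subseteq> ?S" for B
    using that
    by (induction B) (auto simp: g(2) complex_norm_square mult.commute simp del: of_real_power)
  from this[OF order_refl] 0 have "complex_of_real (\<Sum>t\<in>#A. (cmod (poly f t))\<^sup>2) = 0"
    unfolding L_def by (simp only:)
  then have sum0: "(\<Sum>t\<in>#A. (cmod (poly f t))\<^sup>2) = 0" by (simp only: of_real_eq_0_iff)
  have "poly f t = 0" if "t \<in># A" for t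
  proof -
    have "(\<Sum>t\<in>#B. (cmod (poly f t))\<^sup>2) \<ge> 0" for B by (induction B) auto
    then have "(\<Sum>t\<in>#A - {#t#}. (cmod (poly f t))\<^sup>2) \<ge> 0" .
    moreover have "A = add_mset t (A - {#t#})" using that by simp
    ultimately have "(cmod (poly f t))\<^sup>2 \<le> 0"
      using sum0 by (metis (no_types, lifting) add_le_same_cancel1 add_left_mono add.right_neutral
          image_mset_add_mset sum_mset.add_mset)
    then show ?thesis by simp
  qed
  then have "f = 0" by (intro zero_poly_if_many_roots[of ?S]) (auto simp: f_def coeff_comb)
  then show False
    using v(1) horner_independent[where b = c, OF c0, where w = "\<lambda>i. of_real (v i)" and k = ?r]
    by (auto simp: f_def comb_def)
qed

text \<open>A pair of nonreal conjugate roots admits a real polynomial with values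
  \<open>\<i>\<close> and \<open>-\<i>\<close> on the pair and \<open>0\<close> at the other roots.
  Its coordinate vector is nonzero, but the sum of its squares over the roots is not
  positive.\<close>

lemma pos_def_imp_real_rooted:
  assumes "pos_def r (bez N q)" "card (set_mset A) \<le> r"
  shows "real_rooted q"
proof (rule ccontr)
  let ?S = "set_mset A"
  let ?k = "card ?S"
  assume "\<not> real_rooted q"
  then obtain t0 where t0: "t0 \<in> ?S" "Im t0 \<noteq> 0" by (auto simp: real_rooted_def root_iff)
  have cnj_S: "cnj t \<in> ?S" if "t \<in> ?S" for t
  proof -
    have "poly (cpoly q) (cnj t) = cnj (poly (cpoly q) t)"
      by (rule poly_cnj_real[symmetric]) (simp add: coeff_map_poly)
    then show ?thesis using that by (simp flip: root_iff)
  qed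
  have ne: "cnj t0 \<noteq> t0" using t0(2) by (simp add: complex_eq_iff)
  define y where "y s = (if s = t0 then \<i> else if s = cnj t0 then - \<i> else 0)" for s
  obtain w where w: "\<And>i. i \<ge> ?k \<Longrightarrow> coeff w i = 0" "\<And>s. s \<in> ?S \<Longrightarrow> poly w s = y s"
    using lagrange_interpolation[of ?S y] by auto
  \<comment> \<open>Taking real parts averages \<open>w\<close> with its conjugate; the prescribed
    values survive because \<open>y\<close> takes conjugate values at conjugate roots.\<close>
  define f where "f = map_poly Re w"
  have cf: "cpoly f = Polynomial.smult (1 / 2) (w + map_poly cnj w)"
    by (rule poly_eqI) (simp add: f_def coeff_map_poly complex_add_cnj)
  have pf: "poly (cpoly f) s = (poly w s + cnj (poly w (cnj s))) / 2" for s
  proof -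
    have "poly (map_poly cnj w) s = cnj (poly w (cnj s))" using poly_cnj[of w "cnj s"] by simp
    then show ?thesis by (simp add: cf)
  qed
  have vals: "poly (cpoly f) s = y s" if "s \<in> ?S" for s
  proof -
    have "cnj s = cnj t0 \<longleftrightarrow> s = t0" "cnj s = t0 \<longleftrightarrow> s = cnj t0"
      by (simp, metis complex_cnj_cnj)
    then show ?thesis
      unfolding pf w(2)[OF that] w(2)[OF cnj_S[OF that]] y_def using ne by simp
  qed
  have "\<And>i. i \<ge> ?k \<Longrightarrow> coeff f i = 0" by (simp add: f_def coeff_map_poly w(1))
  moreover have "desc_coeff N q 0 \<noteq> 0" using lead by (simp add: desc_coeff_def)
  ultimately obtain v where v: "f = (\<Sum>i<?k. Polynomial.smult (v i) (horner (desc_coeff N q) i))"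
    using horner_span[of "desc_coeff N q" ?k f] by blast
  \<comment> \<open>Zero padding from the number of distinct roots up to \<open>r\<close>.\<close>
  define v' where "v' i = (if i < ?k then v i else 0)" for i
  have "cpoly f = comb ?k (\<lambda>i. of_real (v i))"
    unfolding comb_def v by (rule poly_eqI) (simp add: coeff_map_poly coeff_sum coeff_horner c_def
        if_distrib[of of_real] cong: if_cong)
  also have "\<dots> = comb r (\<lambda>i. of_real (v' i))"
    unfolding comb_def using assms(2) by (intro sum.mono_neutral_cong_left) (auto simp: v'_def)
  finally have f: "cpoly f = comb r (\<lambda>i. of_real (v' i))" .
  have "\<exists>i<r. v' i \<noteq> 0"
  proof (rule ccontr)
    assume "\<not> ?thesis"
    then have "cpoly f = 0" by (simp add: f comb_def)
    then show False using vals[OF t0(1)] by (simp add: y_def)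
  qed
  then have "quad r (bez N q) v' > 0" using assms(1) by (auto simp: pos_def_def)
  moreover have "Re (\<Sum>t\<in>#B. (poly (cpoly f) t)\<^sup>2) \<le> 0" if "set_mset B \<subseteq> ?S" for B
    using that by (induction B) (auto simp: vals y_def)
  from this[of A] have "Re (of_real (quad r (bez N q) v')) \<le> 0"
    unfolding quad_bez f[symmetric] by (simp add: L_def)
  ultimately show False by simp
qed

end

lemma root_functional_exists:
  assumes "degree q = N" "coeff q N \<noteq> 0"
  shows "\<exists>A. root_functional q N A"
proof -
  have "cpoly q \<noteq> 0" using assms by (metis coeff_0 coeff_map_poly of_real_0 of_real_eq_0_iff)
  then obtain A where "size A = degree (cpoly q)"
    "cpoly q = Polynomial.smult (lead_coeff (cpoly q)) (\<Prod>x\<in>#A. [:- x, 1:])"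
    using alg_closed_imp_factorization by blast
  then have "root_functional q N A"
    using assms by unfold_locales (simp_all add: coeff_map_poly)
  then show ?thesis ..
qed

lemma bezoutian_psd_if_real_rooted:
  assumes "degree q \<le> N" "coeff q N \<noteq> 0" "real_rooted q"
  shows "psd k (bez N q)"
proof -
  have "degree q = N" using assms(1) le_degree[OF assms(2)] by simp
  then obtain A where "root_functional q N A" using root_functional_exists assms(2) by blast
  then show ?thesis using assms(3) by (rule root_functional.real_rooted_imp_psd)
qed

text \<open>The minor whose order is the number of distinct roots is nonzero, so the vanishing
  minors leave at most \<open>r\<close> distinct roots; positivity up to order \<open>r\<close> then
  makes a block definite that is large enough to detect any nonreal pair.\<close>

lemma real_rooted_if_leading_minors:
  assumes "degree q \<le> N" "coeff q N \<noteq> 0"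
    and pos: "\<And>k. 0 < k \<Longrightarrow> k \<le> r \<Longrightarrow> leading_minor k (bez N q) > 0"
    and zero: "\<And>k. r < k \<Longrightarrow> k \<le> N \<Longrightarrow> leading_minor k (bez N q) = 0"
  shows "real_rooted q"
proof -
  have d: "degree q = N" using assms(1) le_degree[OF assms(2)] by simp
  then obtain A where A: "root_functional q N A" using root_functional_exists assms(2) by blast
  then interpret root_functional q N A .
  have "card (set_mset A) \<le> N" 
  proof -
    have "card (set_mset B) \<le> size B" for B :: "complex multiset"
      by (induction B) (auto simp: card_insert_if)
    then show ?thesis using size_A by metis
  qed
  then have "card (set_mset A) \<le> r"
    using zero leading_minor_distinct_roots not_le by blast
  then show ?thesis
    using pos_def_imp_real_rooted sylvester[OF symm_bezoutian pos] by blast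
qed

section \<open>A criterion with finitely many samples\<close>

text \<open>Polynomial dependence is asserted for real functions of the parameter, so that
  coefficients, forms and minors remain ordinary real objects for each \<open>g\<close>. The bound
  \<open>d\<close> is tracked because it fixes the number of samples.\<close>

definition poly_fun :: "nat \<Rightarrow> (real \<Rightarrow> real) \<Rightarrow> bool" where
  "poly_fun d f \<longleftrightarrow> (\<exists>P. degree P \<le> d \<and> (\<forall>x. f x = poly P x))"

lemma poly_fun_const [intro]: "poly_fun d (\<lambda>_. c)"
  unfolding poly_fun_def by (intro exI[of _ "[:c:]"]) simp

lemma poly_fun_add: "poly_fun d f \<Longrightarrow> poly_fun d g \<Longrightarrow> poly_fun d (\<lambda>x. f x + g x)"
proof -
  assume "poly_fun d f" "poly_fun d g"
  then obtain P Q where "degree P \<le> d" "\<And>x. f x = poly P x" "degree Q \<le> d" "\<And>x. g x = poly Q x"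
    by (auto simp: poly_fun_def)
  then show ?thesis
    unfolding poly_fun_def by (intro exI[of _ "P + Q"]) (simp add: degree_add_le)
qed

lemma poly_fun_mult: "poly_fun a f \<Longrightarrow> poly_fun b g \<Longrightarrow> poly_fun (a + b) (\<lambda>x. f x * g x)"
proof -
  assume "poly_fun a f" "poly_fun b g"
  then obtain P Q where PQ: "degree P \<le> a" "\<And>x. f x = poly P x" "degree Q \<le> b" "\<And>x. g x = poly Q x"
    by (auto simp: poly_fun_def)
  have "degree (P * Q) \<le> a + b" using degree_mult_le[of P Q] PQ by linarith
  then show ?thesis
    unfolding poly_fun_def by (intro exI[of _ "P * Q"]) (simp add: PQ)
qed

lemma poly_fun_cmult: "poly_fun d f \<Longrightarrow> poly_fun d (\<lambda>x. c * f x)"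
  using poly_fun_mult[OF poly_fun_const[of 0 c]] by simp

lemma poly_fun_diff: "poly_fun d f \<Longrightarrow> poly_fun d g \<Longrightarrow> poly_fun d (\<lambda>x. f x - g x)"
  using poly_fun_add[of d f "\<lambda>x. -1 * g x"] poly_fun_cmult[of d g "-1"] by simp

lemma poly_fun_sum: "(\<And>i. i \<in> I \<Longrightarrow> poly_fun d (f i)) \<Longrightarrow> poly_fun d (\<lambda>x. \<Sum>i\<in>I. f i x)"
  by (induction I rule: infinite_finite_induct) (auto intro: poly_fun_add)

lemma poly_fun_prod:
  "finite I \<Longrightarrow> (\<And>i. i \<in> I \<Longrightarrow> poly_fun d (f i)) \<Longrightarrow> poly_fun (d * card I) (\<lambda>x. \<Prod>i\<in>I. f i x)"
proof (induction I rule: finite_induct)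
  case (insert i I)
  then have "poly_fun (d + d * card I) (\<lambda>x. f i x * (\<Prod>i\<in>I. f i x))" by (intro poly_fun_mult) auto
  then show ?case using insert.hyps by simp
qed (simp add: poly_fun_const)

text \<open>Leibniz formula: each product takes one entry from each of the \<open>k\<close>
  rows.\<close>

lemma poly_fun_leading_minor:
  assumes "\<And>i j. i < k \<Longrightarrow> j < k \<Longrightarrow> poly_fun d (\<lambda>x. M x i j)"
  shows "poly_fun (d * k) (\<lambda>x. leading_minor k (M x))"
proof -
  have "leading_minor k (M x) =
      (\<Sum>p | p permutes {0..<k}. signof p * (\<Prod>i = 0..<k. M x i (p i)))" for x
  proof -
    have "(\<Prod>i = 0..<k. Matrix.mat k k (\<lambda>(i, j). M x i j) $$ (i, p i)) = (\<Prod>i = 0..<k. M x i (p i))"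
      if "p permutes {0..<k}" for p
      using permutes_in_image[OF that] by (intro prod.cong) auto
    then show ?thesis
      unfolding leading_minor_def Determinant.det_def by simp
  qed
  moreover have "poly_fun (d * card {0..<k}) (\<lambda>x. \<Prod>i = 0..<k. M x i (p i))"
    if "p permutes {0..<k}" for p
    using that permutes_in_image[OF that] by (intro poly_fun_prod assms) auto
  ultimately show ?thesis
    by (auto intro!: poly_fun_sum poly_fun_cmult)
qed

lemma poly_fun_zero_if_many_zeros:
  assumes "poly_fun d f" "finite S" "d < card S" "\<And>x. x \<in> S \<Longrightarrow> f x = 0"
  shows "f x = 0"
proof -
  obtain P where P: "degree P \<le> d" "\<And>x. f x = poly P x" using assms(1) by (auto simp: poly_fun_def)
  have "P = 0"
    by (rule zero_poly_if_many_roots[of S]) (use assms P in \<open>auto simp: coeff_eq_0\<close>)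
  then show ?thesis using P by simp
qed

lemma poly_fun_finite_zeros:
  assumes "poly_fun d f" "f x0 \<noteq> 0"
  shows "finite {x. f x = 0}"
proof -
  obtain P where P: "\<And>x. f x = poly P x" using assms(1) by (auto simp: poly_fun_def)
  then have "P \<noteq> 0" using assms(2) by auto
  then show ?thesis using poly_roots_finite[of P] P by simp
qed

lemma poly_fun_nonneg_if_cofinite:
  assumes "poly_fun d f" "finite E" "\<And>x. x \<notin> E \<Longrightarrow> f x \<ge> 0"
  shows "f x \<ge> 0"
proof -
  obtain P where P: "\<And>x. f x = poly P x" using assms(1) by (auto simp: poly_fun_def)
  have "closure (- E) = UNIV" using assms(2) by (simp add: closure_complement empty_interior_finite)
  then show ?thesis
    using continuous_ge_on_closure[of "- E" f x 0] assms(3)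
    unfolding P by (simp add: continuous_intros)
qed

definition poly_coeffs_fun :: "nat \<Rightarrow> (real \<Rightarrow> real poly) \<Rightarrow> bool" where
  "poly_coeffs_fun d F \<longleftrightarrow> (\<forall>i. poly_fun d (\<lambda>x. coeff (F x) i))"

lemma poly_coeffs_fun_mult:
  "poly_coeffs_fun a F \<Longrightarrow> poly_coeffs_fun b G \<Longrightarrow> poly_coeffs_fun (a + b) (\<lambda>x. F x * G x)"
  unfolding poly_coeffs_fun_def coeff_mult by (intro allI poly_fun_sum poly_fun_mult) auto

lemma poly_coeffs_fun_power: "poly_coeffs_fun 1 F \<Longrightarrow> poly_coeffs_fun k (\<lambda>x. F x ^ k)"
proof (induction k)
  case 0
  show ?case by (simp add: poly_coeffs_fun_def poly_fun_const)
next
  case (Suc k)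
  then show ?case using poly_coeffs_fun_mult[of 1 F k "\<lambda>x. F x ^ k"] by simp
qed

lemma poly_fun_id: "poly_fun (Suc 0) (\<lambda>x. x)" "poly_fun (Suc 0) (\<lambda>x. - x)"
  unfolding poly_fun_def by (rule exI[of _ "[:0, 1:]"], simp, rule exI[of _ "[:0, -1:]"], simp)

lemma poly_coeffs_fun_pencil: "poly_coeffs_fun n (pencil n p)"
proof -
  have lin: "poly_coeffs_fun 1 (\<lambda>g. [:g, 1:])" "poly_coeffs_fun 1 (\<lambda>g. [:1, - g:])"
  proof -
    have "poly_fun 1 (\<lambda>x. coeff [:x, 1:] i)" "poly_fun 1 (\<lambda>x. coeff [:1, - x:] i)" for i
    proof -
      show "poly_fun 1 (\<lambda>x. coeff [:x, 1:] i)"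
        by (cases i) (use poly_fun_id in auto)
      have "poly_fun 1 (\<lambda>x. coeff [:- x:] j)" for j
        by (cases j) (use poly_fun_id in auto)
      then show "poly_fun 1 (\<lambda>x. coeff [:1, - x:] i)"
        by (cases i) auto
    qed
    then show "poly_coeffs_fun 1 (\<lambda>g. [:g, 1:])" "poly_coeffs_fun 1 (\<lambda>g. [:1, - g:])"
      by (auto simp: poly_coeffs_fun_def)
  qed
  have "poly_coeffs_fun n (\<lambda>g. coeff p j * [:g, 1:] ^ j * [:1, - g:] ^ (n - j))" if "j \<le> n" for j
  proof -
    have "poly_coeffs_fun 0 (\<lambda>_. coeff p j)" by (auto simp: poly_coeffs_fun_def)
    from poly_coeffs_fun_mult[OF poly_coeffs_fun_mult[OF this poly_coeffs_fun_power[OF lin(1), of j]]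
        poly_coeffs_fun_power[OF lin(2), of "n - j"]]
    show ?thesis using that by simp
  qed
  then show ?thesis
    unfolding poly_coeffs_fun_def pencil_def[abs_def] coeff_sum
    by (intro allI poly_fun_sum) auto
qed

text \<open>Every entry is a sum of products of one \<open>b\<close> and one \<open>e\<close>, both
  of degree at most \<open>d\<close> in the parameter.\<close>

lemma poly_fun_bez:
  assumes "poly_coeffs_fun d F"
  shows "poly_fun (2 * d) (\<lambda>x. bez N (F x) i j)"
proof (induction i arbitrary: j)
  have b: "poly_fun d (\<lambda>x. desc_coeff N (F x) i)" for i
    using assms by (cases "i \<le> N") (auto simp: desc_coeff_def poly_coeffs_fun_def)
  have e: "poly_fun d (\<lambda>x. desc_deriv N (F x) i)" for i
    unfolding desc_deriv_def by (intro poly_fun_cmult b)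
  have be: "poly_fun (2 * d) (\<lambda>x. desc_coeff N (F x) i * desc_deriv N (F x) j)" for i j
    using poly_fun_mult[OF b e] by (simp add: mult_2)
  {
    case 0
    show ?case using be[of 0 j] by simp
  next
    case (Suc i)
    show ?case unfolding bezoutian.simps by (intro poly_fun_add poly_fun_diff Suc be)
  }
qed

text \<open>The exact degree in \<open>x\<close> replaces the bound \<open>n\<close> here: only then
  is the coefficient of order \<open>x_degree p + n\<close> of the pencil not identically zero in
  \<open>g\<close>, so that the pencil has this degree for almost every \<open>g\<close>.\<close>

definition x_degree :: "real poly poly \<Rightarrow> nat" where
  "x_degree p = Max ((\<lambda>j. degree (coeff p j)) ` {..degree p})"

lemma degree_coeff_le_x_degree: "degree (coeff p j) \<le> x_degree p"
proof (cases "j \<le> degree p")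
  case True
  then show ?thesis unfolding x_degree_def by (intro Max_ge) auto
qed (simp add: coeff_eq_0)

lemma x_degree_attained:
  assumes "p \<noteq> 0"
  obtains j where "j \<le> degree p" "coeff (coeff p j) (x_degree p) \<noteq> 0"
proof (cases "x_degree p = 0")
  case True
  have "degree (lead_coeff p) = 0" using degree_coeff_le_x_degree[of p "degree p"] True by simp
  then have "coeff (lead_coeff p) 0 \<noteq> 0"
    using assms by (metis leading_coeff_0_iff)
  then show ?thesis using that[of "degree p"] True by simp
next
  case False
  have "x_degree p \<in> (\<lambda>j. degree (coeff p j)) ` {..degree p}"
    unfolding x_degree_def by (intro Max_in) auto
  then obtain j where j: "j \<le> degree p" "degree (coeff p j) = x_degree p" by auto
  then have "coeff p j \<noteq> 0" using False by auto
  then show ?thesis using that[OF j(1)] j(2) by (metis leading_coeff_0_iff)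
qed

lemma coeff_mult_top:
  assumes "degree f \<le> a" "degree g \<le> b"
  shows "coeff (f * g) (a + b) = coeff f a * coeff g b"
proof (cases "degree f = a \<and> degree g = b")
  case True
  then show ?thesis using coeff_mult_degree_sum by blast
next
  case False
  then have "degree f + degree g < a + b" using assms by auto
  then have "coeff (f * g) (a + b) = 0"
    using degree_mult_le[of f g] by (intro coeff_eq_0) linarith
  moreover have "coeff f a = 0 \<or> coeff g b = 0" using False assms by (auto intro: coeff_eq_0)
  ultimately show ?thesis by auto
qed

lemma coeff_pencil_top:
  assumes "\<And>j. degree (coeff p j) \<le> m"
  shows "coeff (pencil n p g) (m + n) = (\<Sum>j\<le>n. coeff (coeff p j) m * (- g) ^ (n - j))"
proof -
  have pw: "degree (f ^ k) \<le> k" "coeff (f ^ k) k = coeff f 1 ^ k" if "degree f \<le> 1"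
    for f :: "real poly" and k
  proof -
    show d: "degree (f ^ k) \<le> k" for k
      by (rule order_trans[OF degree_power_le]) (use mult_le_mono1[OF that, of k] in \<open>simp only: mult_1\<close>)
    show "coeff (f ^ k) k = coeff f 1 ^ k"
    proof (induction k)
      case (Suc k)
      then show ?case using coeff_mult_top[OF that d[of k]] by simp
    qed simp
  qed
  have lin: "degree [:g, 1:] \<le> 1" "degree [:1, - g:] \<le> 1" by simp_all
  have "coeff (coeff p j * [:g, 1:] ^ j * [:1, - g:] ^ (n - j)) (m + n) =
      coeff (coeff p j) m * (- g) ^ (n - j)" if "j \<le> n" for j
  proof -
    have "degree (coeff p j * [:g, 1:] ^ j) \<le> m + j"
      using degree_mult_le[of "coeff p j" "[:g, 1:] ^ j"] pw(1)[OF lin(1), of j] assms[of j] by linarith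
    from coeff_mult_top[OF this pw(1)[OF lin(2), of "n - j"]]
    have "coeff (coeff p j * [:g, 1:] ^ j * [:1, - g:] ^ (n - j)) (m + n) =
        coeff (coeff p j * [:g, 1:] ^ j) (m + j) * coeff ([:1, - g:] ^ (n - j)) (n - j)"
      using that by simp
    also have "\<dots> = coeff (coeff p j) m * (- g) ^ (n - j)"
      using coeff_mult_top[OF assms[of j] pw(1)[OF lin(1), of j]] pw(2)[OF lin(1), of j]
        pw(2)[OF lin(2), of "n - j"] by simp
    finally show ?thesis .
  qed
  then show ?thesis unfolding pencil_def coeff_sum by (intro sum.cong) auto
qed

text \<open>The top coefficient is a polynomial in \<open>- g\<close> whose coefficients are those
  of \<open>p\<close> at the highest power of \<open>x\<close>, and one of these is nonzero.\<close>

lemma pencil_top_nonzero: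
  assumes "p \<noteq> 0" "degree p \<le> n"
  shows "\<exists>g. coeff (pencil n p g) (x_degree p + n) \<noteq> 0"
proof (rule ccontr)
  let ?m = "x_degree p"
  assume "\<not> ?thesis"
  then have 0: "(\<Sum>j\<le>n. coeff (coeff p j) ?m * (- g) ^ (n - j)) = 0" for g
    using coeff_pencil_top[OF degree_coeff_le_x_degree, of n p g] by auto
  define P where "P = (\<Sum>j\<le>n. monom (coeff (coeff p j) ?m) (n - j))"
  have "poly P x = 0" for x
    using 0[of "- x"] by (simp add: P_def poly_sum poly_monom)
  then have "P = 0" using poly_all_0_iff_0 by blast
  obtain j where j: "j \<le> degree p" "coeff (coeff p j) ?m \<noteq> 0" using x_degree_attained[OF assms(1)] .
  have "coeff P (n - j) = (\<Sum>i\<le>n. if i = j then coeff (coeff p i) ?m else 0)"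
    unfolding P_def coeff_sum using j assms(2) by (intro sum.cong) auto
  also have "\<dots> = coeff (coeff p j) ?m" using j assms(2) by simp
  finally show False using j \<open>P = 0\<close> by simp
qed

section \<open>The minors as polynomials in the parameter\<close>

definition pencil_minor :: "nat \<Rightarrow> real poly poly \<Rightarrow> nat \<Rightarrow> real \<Rightarrow> real" where
  "pencil_minor n p k g = leading_minor k (bez (x_degree p + n) (pencil n p g))"

lemma poly_fun_pencil_minor: "poly_fun (2 * n * k) (pencil_minor n p k)"
  unfolding pencil_minor_def[abs_def]
  by (intro poly_fun_leading_minor poly_fun_bez poly_coeffs_fun_pencil)

text \<open>From left to right, semidefiniteness holds off the finite set \<open>E\<close> and
  extends to all \<open>g\<close>. From right to left, the order \<open>r\<close> of the last minor
  that is not identically zero acts as the generic rank: positivity up to \<open>r\<close> and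
  vanishing beyond is what \<open>real_rooted_if_leading_minors\<close> asks for.\<close>

theorem stable_iff_minors:
  assumes p: "p \<in> bipolys n" "p \<noteq> 0" and K: "2 * n * (x_degree p + n) < K"
  shows "real_stable p \<longleftrightarrow> complex_eval2 p \<i> \<i> \<noteq> 0 \<and>
    (\<forall>g<K. psd (x_degree p + n) (bez (x_degree p + n) (pencil n p (real g)))) \<and>
    (\<forall>k\<le>x_degree p + n. \<forall>g. pencil_minor n p k g \<ge> 0)"
proof
  let ?N = "x_degree p + n"
  have dp: "degree p \<le> n" using p by (auto simp: bipolys_def)
  have deg: "degree (pencil n p g) \<le> ?N" for g by (intro degree_pencil degree_coeff_le_x_degree)
  have top: "poly_fun n (\<lambda>g. coeff (pencil n p g) ?N)"
    using poly_coeffs_fun_pencil by (auto simp: poly_coeffs_fun_def)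
  obtain g0 where g0: "coeff (pencil n p g0) ?N \<noteq> 0"
    using pencil_top_nonzero[OF p(2) dp] by blast
  define E where "E = {g. coeff (pencil n p g) ?N = 0}"
  have E: "finite E" unfolding E_def using top g0 by (rule poly_fun_finite_zeros)
  {
    assume st: "real_stable p"
    have psd: "psd ?N (bez ?N (pencil n p g))" for g
      unfolding psd_def
    proof
      fix v
      \<comment> \<open>For a fixed vector the form is polynomial in \<open>g\<close>, so
        nonnegativity off \<open>E\<close> extends to \<open>E\<close>, where the pencil drops in
        degree and \<open>bezoutian_psd_if_real_rooted\<close> does not apply.\<close>
      have pf: "poly_fun (2 * n) (\<lambda>g. quad ?N (bez ?N (pencil n p g)) v)"
        unfolding quad_def
        by (intro poly_fun_sum poly_fun_cmult poly_fun_bez poly_coeffs_fun_pencil)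
      show "quad ?N (bez ?N (pencil n p g)) v \<ge> 0"
      proof (rule poly_fun_nonneg_if_cofinite[OF pf E])
        fix x assume "x \<notin> E"
        then have "psd ?N (bez ?N (pencil n p x))"
          using stable_imp_pencil_real_rooted(2)[OF st p(2) dp] deg
          by (intro bezoutian_psd_if_real_rooted) (auto simp: E_def)
        then show "quad ?N (bez ?N (pencil n p x)) v \<ge> 0" by (simp add: psd_def)
      qed
    qed
    show "complex_eval2 p \<i> \<i> \<noteq> 0 \<and>
      (\<forall>g<K. psd ?N (bez ?N (pencil n p (real g)))) \<and>
      (\<forall>k\<le>?N. \<forall>g. pencil_minor n p k g \<ge> 0)"
    proof (intro conjI allI impI)
      show "complex_eval2 p \<i> \<i> \<noteq> 0" using st p(2) dp by (rule stable_imp_pencil_real_rooted(1))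
      fix k g assume "k \<le> ?N"
      then show "pencil_minor n p k g \<ge> 0"
        unfolding pencil_minor_def using psd_leading_minor_nonneg[OF symm_bezoutian psd[of g]] by simp
    qed (rule psd)
  }
  assume A: "complex_eval2 p \<i> \<i> \<noteq> 0 \<and>
      (\<forall>g<K. psd ?N (bez ?N (pencil n p (real g)))) \<and>
      (\<forall>k\<le>?N. \<forall>g. pencil_minor n p k g \<ge> 0)"
  define R where "R = {k. k \<le> ?N \<and> (\<exists>g. pencil_minor n p k g \<noteq> 0)}"
  have "0 \<in> R" by (simp add: R_def pencil_minor_def)
  moreover have "finite R" by (simp add: R_def)
  ultimately have r: "Max R \<in> R" "\<And>k. k \<in> R \<Longrightarrow> k \<le> Max R"
    using Max_in[of R] Max_ge[of R] by blast+
  define r where "r = Max R"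
  have rN: "r \<le> ?N" using r(1) by (simp add: R_def r_def)
  \<comment> \<open>The minor of order \<open>r\<close> is nonzero as a polynomial and has at most
    \<open>2 n r < K\<close> zeros, so some sample avoids them.\<close>
  obtain s where s: "s < K" "pencil_minor n p r (real s) \<noteq> 0"
  proof -
    have "\<exists>s<K. pencil_minor n p r (real s) \<noteq> 0"
    proof (rule ccontr)
      assume "\<not> ?thesis"
      then have z: "pencil_minor n p r x = 0" if "x \<in> real ` {..<K}" for x using that by auto
      have "card (real ` {..<K}) = K" by (simp add: card_image)
      moreover have "2 * n * r < K" using rN K by (meson le_less_trans mult_le_mono2)
      ultimately have "pencil_minor n p r x = 0" for x
        using z poly_fun_zero_if_many_zeros[OF poly_fun_pencil_minor[of n r p], of "real ` {..<K}" x]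
        by simp
      then show False using r(1) by (simp add: R_def r_def)
    qed
    then show ?thesis using that by blast
  qed
  have spos: "pencil_minor n p k (real s) > 0" if "k \<le> r" for k
  proof -
    have "psd ?N (bez ?N (pencil n p (real s)))" using A s(1) by blast
    from leading_minors_pos_if_psd[OF symm_bezoutian this, of r k] show ?thesis
      using s(2) that rN by (simp add: pencil_minor_def)
  qed
  \<comment> \<open>At the sample \<open>s\<close> each minor up to order \<open>r\<close> is
    positive, hence each has finitely many zeros; outside these, nonnegative means positive.\<close>
  define F where "F = E \<union> (\<Union>k\<le>r. {g. pencil_minor n p k g = 0})"
  have "finite F"
  proof -
    have "finite {g. pencil_minor n p k g = 0}" if "k \<le> r" for k
      using poly_fun_finite_zeros[OF poly_fun_pencil_minor[of n k p], of "real s"] spos[OF that] by simp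
    then show ?thesis using E by (auto simp: F_def)
  qed
  moreover have "real_rooted (pencil n p g)" if g: "g \<notin> F" for g
  proof (rule real_rooted_if_leading_minors[of _ ?N r])
    fix k assume k: "0 < k" "k \<le> r"
    have "pencil_minor n p k g \<ge> 0" using A k rN by simp
    moreover have "pencil_minor n p k g \<noteq> 0" using g k by (auto simp: F_def)
    ultimately show "leading_minor k (bez ?N (pencil n p g)) > 0"
      by (simp add: pencil_minor_def)
  next
    fix k assume k: "r < k" "k \<le> ?N"
    then have "k \<notin> R" using r(2)[of k] by (auto simp: r_def)
    then show "leading_minor k (bez ?N (pencil n p g)) = 0"
      using k by (auto simp: R_def pencil_minor_def)
  qed (use g deg in \<open>auto simp: F_def E_def\<close>)
  ultimately show "real_stable p"
    by (intro pencil_real_rooted_imp_stable[OF p(1), of F]) (use A in simp_all)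
qed

section \<open>Cauchy indices and nonnegative polynomials\<close>

abbreviation rpow :: "real \<Rightarrow> nat \<Rightarrow> real poly" where
  "rpow c k \<equiv> [:- c, 1:] ^ k"

text \<open>Dividing out the full power of \<open>x - c\<close> leaves a cofactor whose value at
  \<open>c\<close> has the sign of \<open>F\<close> just to the right of \<open>c\<close>.\<close>

definition right_sgn :: "real \<Rightarrow> real poly \<Rightarrow> real" where
  "right_sgn c F = sgn (poly (F div rpow c (Polynomial.order c F)) c)"

text \<open>Half the difference of the signs just to the right and just to the left of
  \<open>c\<close>: at a zero of even order the two agree, at one of odd order they are
  opposite.\<close>

definition jump :: "real \<Rightarrow> real poly \<Rightarrow> real" where
  "jump c F = (if odd (Polynomial.order c F) then right_sgn c F else 0)"

text \<open>The Cauchy index of \<open>A / B\<close> on the real line, denominator first.  The divisibility condition says that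
  \<open>A\<close> vanishes at \<open>c\<close> to lower order than \<open>B\<close>, and excludes \<open>A = 0\<close>.\<close>

definition cauchy_index :: "real poly \<Rightarrow> real poly \<Rightarrow> real" where
  "cauchy_index B A = (\<Sum>c | poly B c = 0 \<and> \<not> rpow c (Polynomial.order c B) dvd A. jump c (A * B))"

text \<open>Half the difference of the signs at plus and minus infinity.\<close>

definition sgn_change :: "real poly \<Rightarrow> real" where
  "sgn_change F = (if odd (degree F) then sgn (lead_coeff F) else 0)"

lemma rpow_nonzero [simp]: "rpow c k \<noteq> 0"
  by simp

lemma order_rpow_mult:
  assumes "poly G c \<noteq> 0"
  shows "Polynomial.order c (rpow c k * G) = k"
proof -
  have "G \<noteq> 0" "Polynomial.order c G = 0" using assms by (auto simp: order_root)
  then show ?thesis by (simp add: order_mult order_power_n_n)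
qed

lemma right_sgn_rpow_mult:
  assumes "poly G c \<noteq> 0"
  shows "right_sgn c (rpow c k * G) = sgn (poly G c)"
  unfolding right_sgn_def order_rpow_mult[OF assms] by simp

lemma order_cofactor:
  assumes "F \<noteq> 0"
  obtains k G where "F = rpow c k * G" "poly G c \<noteq> 0" "Polynomial.order c F = k" "right_sgn c F = sgn (poly G c)"
proof -
  obtain G where G: "F = rpow c (Polynomial.order c F) * G" "poly G c \<noteq> 0"
    using order_decomp[OF assms, of c] by (auto simp: poly_eq_0_iff_dvd)
  have "right_sgn c F = sgn (poly G c)"
    using right_sgn_rpow_mult[OF G(2), of "Polynomial.order c F"] unfolding G(1)[symmetric] .
  with G that show ?thesis by blast
qed

lemma right_sgn_mult:
  assumes "F \<noteq> 0" "G \<noteq> 0"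
  shows "right_sgn c (F * G) = right_sgn c F * right_sgn c G"
proof -
  obtain k F' where F: "F = rpow c k * F'" "poly F' c \<noteq> 0" "right_sgn c F = sgn (poly F' c)"
    using order_cofactor[OF assms(1)] by metis
  obtain l G' where G: "G = rpow c l * G'" "poly G' c \<noteq> 0" "right_sgn c G = sgn (poly G' c)"
    using order_cofactor[OF assms(2)] by metis
  have "F * G = rpow c (k + l) * (F' * G')"
    unfolding F(1) G(1) by (simp add: power_add mult_ac)
  then have "right_sgn c (F * G) = sgn (poly (F' * G') c)"
    using F(2) G(2) right_sgn_rpow_mult[of "F' * G'" c] by simp
  then show ?thesis by (simp add: sgn_mult F(3) G(3))
qed

lemma right_sgn_nonroot: "poly F c \<noteq> 0 \<Longrightarrow> right_sgn c F = sgn (poly F c)"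
  using right_sgn_rpow_mult[of F c 0] by simp

lemma right_sgn_square: "F \<noteq> 0 \<Longrightarrow> right_sgn c F * right_sgn c F = 1"
proof -
  assume "F \<noteq> 0"
  then obtain G where "poly G c \<noteq> 0" "right_sgn c F = sgn (poly G c)"
    using order_cofactor by metis
  then show ?thesis by (simp add: sgn_if)
qed

section \<open>Jumps, inversion and logarithmic derivatives\<close>

lemma sgn_poly_right:
  fixes F :: "real poly"
  assumes "F \<noteq> 0" "\<And>x. x \<ge> c \<Longrightarrow> poly F x \<noteq> 0"
  shows "sgn (poly F c) = sgn (lead_coeff F)"
proof -
  have pos: "poly G c > 0" if lead: "lead_coeff G > 0" and nz: "\<And>x::real. x \<ge> c \<Longrightarrow> poly G x \<noteq> 0" for G :: "real poly"
  proof (rule ccontr)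
    assume "\<not> poly G c > 0"
    then have neg: "poly G c < 0" using nz[of c] by simp
    obtain n where n: "\<And>x. x \<ge> n \<Longrightarrow> poly G x \<ge> lead_coeff G" using poly_pinfty_gt_lc[OF lead] by blast
    define d where "d = max n (c + 1)"
    have "poly G d > 0" using n[of d] lead by (simp add: d_def)
    moreover have "c < d" by (simp add: d_def)
    ultimately obtain x where "c < x" "poly G x = 0" using poly_IVT_pos[of c d G] neg by blast
    then show False using nz[of x] by simp
  qed
  show ?thesis
  proof (cases "lead_coeff F > 0")
    case True
    then show ?thesis using pos[of F] assms by simp
  next
    case False
    then have "lead_coeff F < 0" using assms(1) by (meson leading_coeff_0_iff linorder_neqE_linordered_idom)
    then show ?thesis using pos[of "- F"] assms by (simp add: sgn_if)
  qed
qed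

lemma sgn_poly_left:
  fixes F :: "real poly"
  assumes "F \<noteq> 0" "\<And>x. x \<le> c \<Longrightarrow> poly F x \<noteq> 0"
  shows "sgn (poly F c) = (-1) ^ degree F * sgn (lead_coeff F)"
proof -
  let ?G = "F \<circ>\<^sub>p [:0, -1:]"
  have "?G \<noteq> 0" using assms(1) pcompose_eq_0[of F "[:0, -1:]"] by auto
  then have "sgn (poly ?G (- c)) = sgn (lead_coeff ?G)"
    using assms(2) by (intro sgn_poly_right) (auto simp: poly_pcompose)
  then show ?thesis by (simp add: poly_pcompose lead_coeff_comp sgn_mult power_sgn[symmetric])
qed

text \<open>The signs telescope along the line. The induction on the number of roots splits off the
  largest root \<open>c\<close> with its full multiplicity.\<close>

lemma sum_jump:
  assumes "F \<noteq> 0"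
  shows "(\<Sum>c | poly F c = 0. jump c F) = sgn_change F"
  using assms
proof (induction "card {c. poly F c = 0}" arbitrary: F rule: less_induct)
  case less
  have fin: "finite {c. poly F c = 0}" using less.prems by (rule poly_roots_finite)
  show ?case
  proof (cases "{c. poly F c = 0} = {}")
    case True
    then have "sgn (poly F 0) = sgn (lead_coeff F)"
      "sgn (poly F 0) = (-1) ^ degree F * sgn (lead_coeff F)"
      using less.prems by (auto intro: sgn_poly_right sgn_poly_left)
    then have "even (degree F)"
      using less.prems by (cases "even (degree F)") (auto simp: sgn_if split: if_splits)
    then show ?thesis unfolding True by (simp add: sgn_change_def)
  next
    case False
    define c where "c = Max {c. poly F c = 0}"
    have c: "poly F c = 0" "\<And>x. poly F x = 0 \<Longrightarrow> x \<le> c"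
      using Max_in[OF fin False] Max_ge[OF fin] by (auto simp: c_def)
    obtain k G where G: "F = rpow c k * G" "poly G c \<noteq> 0"
      and k: "Polynomial.order c F = k" "right_sgn c F = sgn (poly G c)"
      using order_cofactor[OF less.prems, of c] by metis
    have G0: "G \<noteq> 0" using G(2) by auto
    have k0: "k \<noteq> 0" using c(1) less.prems k(1) by (auto simp: order_root)
    have roots: "{x. poly F x = 0} = insert c {x. poly G x = 0}"
      using k0 by (auto simp: G(1))
    have "card {x. poly G x = 0} < card {x. poly F x = 0}"
      unfolding roots using G(2) poly_roots_finite[OF G0] by simp
    from less.hyps[OF this G0] have IH: "(\<Sum>x | poly G x = 0. jump x G) = sgn_change G" .
    have lc: "lead_coeff F = lead_coeff G" "degree F = k + degree G"
      unfolding G(1)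
      by (simp only: lead_coeff_mult lead_coeff_power, simp)
        (use G0 in \<open>simp add: degree_mult_eq degree_power_eq\<close>)
    have par: "odd (degree F) \<longleftrightarrow> odd k \<noteq> odd (degree G)" using lc(2) by simp
    have "poly G x \<noteq> 0" if "x \<ge> c" for x
      using that c(2)[of x] G(2) by (cases "x = c") (auto simp: G(1))
    then have "sgn (poly G c) = sgn (lead_coeff G)" using G0 by (intro sgn_poly_right)
    then have jc: "jump c F = (if odd k then sgn (lead_coeff F) else 0)"
      unfolding jump_def lc(1) using k by simp
    \<comment> \<open>To the left of \<open>c\<close> the factor \<open>(x - c)^k\<close> has the
      constant sign \<open>(-1)^k\<close>.\<close>
    have jd: "jump d F = (-1) ^ k * jump d G" if "poly G d = 0" for d
    proof -
      have "poly F d = 0" using that by (simp add: G(1))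
      then have "d < c" using c(2)[of d] that G(2) by (cases "d = c") auto
      then have nz: "poly (rpow c k) d \<noteq> 0" "sgn (poly (rpow c k) d) = (-1) ^ k"
        by (simp_all add: power_sgn[symmetric])
      have "Polynomial.order d (rpow c k) = 0" using nz(1) by (rule order_0I)
      then have "Polynomial.order d F = Polynomial.order d G"
        using G0 by (simp add: G(1) order_mult)
      moreover have "right_sgn d F = (-1) ^ k * right_sgn d G"
        unfolding G(1) using nz by (subst right_sgn_mult) (auto simp: G0 right_sgn_nonroot)
      ultimately show ?thesis by (simp add: jump_def)
    qed
    have "(\<Sum>x | poly F x = 0. jump x F) = jump c F + (\<Sum>x | poly G x = 0. jump x F)"
      unfolding roots using G(2) poly_roots_finite[OF G0] by simp
    also have "(\<Sum>x | poly G x = 0. jump x F) = (-1) ^ k * sgn_change G"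
      by (simp add: jd sum_distrib_left flip: IH)
    finally show ?thesis
      unfolding jc sgn_change_def lc(1) par by auto
  qed
qed

text \<open>\<open>A / B\<close> changes by a polynomial, which leaves its poles alone: where
  \<open>A\<close> has lower order than \<open>B\<close>, subtracting a multiple of \<open>B\<close>
  changes neither the order of \<open>A\<close> nor the value of its cofactor.\<close>

lemma cauchy_index_diff_mult:
  assumes "B \<noteq> 0"
  shows "cauchy_index B (A - Q * B) = cauchy_index B A"
proof -
  have set_eq: "rpow c (Polynomial.order c B) dvd A - Q * B \<longleftrightarrow> rpow c (Polynomial.order c B) dvd A" for c
  proof -
    have "rpow c (Polynomial.order c B) dvd Q * B" by (simp add: order_1 dvd_mult)
    then show ?thesis by (metis dvd_diff_left_iff)
  qed
  have "jump c ((A - Q * B) * B) = jump c (A * B)" if n: "\<not> rpow c (Polynomial.order c B) dvd A" for c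
  proof -
    have A0: "A \<noteq> 0" using n by auto
    obtain k G where G: "A = rpow c k * G" "poly G c \<noteq> 0" "Polynomial.order c A = k" "right_sgn c A = sgn (poly G c)"
      using order_cofactor[OF A0, of c] by metis
    have kB: "k < Polynomial.order c B" using n A0 G(3) by (simp add: order_divides)
    have "rpow c (Suc k) dvd Q * B"
      using kB by (meson Suc_leI dvd_mult le_imp_power_dvd dvd_trans order_1)
    then obtain R where R: "Q * B = rpow c (Suc k) * R" by (elim dvdE)
    have eq: "A - Q * B = rpow c k * (G - [:- c, 1:] * R)"
      unfolding R G(1) by (simp add: algebra_simps)
    have nz: "poly (G - [:- c, 1:] * R) c \<noteq> 0" using G(2) by simp
    have "A - Q * B \<noteq> 0" using set_eq n by (metis dvd_0_right)
    moreover have "right_sgn c (A - Q * B) = right_sgn c A"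
      unfolding eq right_sgn_rpow_mult[OF nz] G(4) by simp
    moreover have "Polynomial.order c (A - Q * B) = Polynomial.order c A"
      unfolding eq order_rpow_mult[OF nz] G(3) by simp
    ultimately show ?thesis
      using A0 assms by (simp add: jump_def right_sgn_mult order_mult)
  qed
  then show ?thesis
    unfolding cauchy_index_def set_eq by (intro sum.cong) auto
qed

text \<open>Each index collects the zeros of \<open>A * B\<close> at which its own denominator has
  the higher order. Where the orders agree, the product has even order and no jump, so together they
  give the total of \<open>sum_jump\<close>.\<close>

lemma cauchy_index_swap:
  assumes "A \<noteq> 0" "B \<noteq> 0"
  shows "cauchy_index B A + cauchy_index A B = sgn_change (A * B)"
proof -
  let ?F = "A * B"
  have F: "?F \<noteq> 0" using assms by simp
  let ?S1 = "{c. poly B c = 0 \<and> \<not> rpow c (Polynomial.order c B) dvd A}"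
  let ?S2 = "{c. poly A c = 0 \<and> \<not> rpow c (Polynomial.order c A) dvd B}"
  have fin: "finite {c. poly ?F c = 0}" using F by (rule poly_roots_finite)
  have sub: "?S1 \<union> ?S2 \<subseteq> {c. poly ?F c = 0}" by auto
  have disj: "?S1 \<inter> ?S2 = {}" using assms by (auto simp: order_divides)
  have "jump c ?F = 0" if "c \<in> {c. poly ?F c = 0} - (?S1 \<union> ?S2)" for c
  proof -
    have "poly B c = 0 \<longrightarrow> Polynomial.order c B \<le> Polynomial.order c A" "poly A c = 0 \<longrightarrow> Polynomial.order c A \<le> Polynomial.order c B"
      using that assms by (auto simp: order_divides)
    moreover have "poly A c \<noteq> 0 \<longrightarrow> Polynomial.order c A = 0" "poly B c \<noteq> 0 \<longrightarrow> Polynomial.order c B = 0"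
      by (simp_all add: order_0I)
    ultimately have "Polynomial.order c A = Polynomial.order c B" by force
    then show ?thesis using F by (simp add: jump_def order_mult)
  qed
  then have "(\<Sum>c | poly ?F c = 0. jump c ?F) = (\<Sum>c\<in>?S1 \<union> ?S2. jump c ?F)"
    using fin sub by (intro sum.mono_neutral_right) auto
  also have "\<dots> = (\<Sum>c\<in>?S1. jump c ?F) + (\<Sum>c\<in>?S2. jump c ?F)"
    using disj sub fin by (intro sum.union_disjoint) (auto intro: finite_subset)
  also have "\<dots> = cauchy_index B A + cauchy_index A B"
    by (simp add: cauchy_index_def mult.commute)
  finally show ?thesis using sum_jump[OF F] by simp
qed

lemma cauchy_index_0 [simp]: "cauchy_index B 0 = 0"
  by (simp add: cauchy_index_def)

text \<open>The logarithmic derivative \<open>D' / D\<close> has a simple pole at each root, with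
  the multiplicity as positive residue, so \<open>D' G / D\<close> jumps there by the sign of
  \<open>G\<close>. Multiple roots are thus counted once.\<close>

lemma cauchy_index_pderiv:
  assumes "D \<noteq> 0"
  shows "cauchy_index D (pderiv D * G) = (\<Sum>c | poly D c = 0 \<and> poly G c \<noteq> 0. sgn (poly G c))"
proof -
  have *: "(\<not> rpow c (Polynomial.order c D) dvd pderiv D * G) = (poly G c \<noteq> 0) \<and>
      (poly G c \<noteq> 0 \<longrightarrow> jump c (pderiv D * G * D) = sgn (poly G c))" if c: "poly D c = 0" for c
  proof -
    have D': "pderiv D \<noteq> 0" 
    proof
      assume "pderiv D = 0"
      then obtain a where "D = [:a:]" by (auto simp: pderiv_eq_0_iff elim: degree_eq_zeroE)
      with c assms show False by simp
    qed
    define k where "k = Polynomial.order c (pderiv D)"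
    have k: "Polynomial.order c D = Suc k"
      using order_pderiv[OF assms] assms c by (simp add: k_def order_root)
    obtain E where E: "D = rpow c (Suc k) * E" "poly E c \<noteq> 0" "right_sgn c D = sgn (poly E c)"
      using order_cofactor[OF assms, of c] k by metis
    have "pderiv D = rpow c k * (Polynomial.smult (real (Suc k)) E + [:- c, 1:] * pderiv E)"
      unfolding E(1) by (simp add: pderiv_mult pderiv_power_Suc pderiv_pCons algebra_simps
          del: power_Suc of_nat_Suc, simp add: algebra_simps)
    moreover have nz: "poly (Polynomial.smult (real (Suc k)) E + [:- c, 1:] * pderiv E) c \<noteq> 0"
      using E(2) by simp
    ultimately have "right_sgn c (pderiv D) =
        sgn (poly (Polynomial.smult (real (Suc k)) E + [:- c, 1:] * pderiv E) c)"
      using right_sgn_rpow_mult[of _ c k] by (simp only:)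
    also have "\<dots> = sgn (poly E c)" by (simp add: sgn_mult del: of_nat_Suc)
    also have "\<dots> = right_sgn c D" using E(3) by simp
    finally have rs: "right_sgn c (pderiv D) = right_sgn c D" .
    show ?thesis
    proof (cases "poly G c = 0")
      case True
      then have "[:- c, 1:] dvd G" by (simp add: poly_eq_0_iff_dvd)
      then have "rpow c k * [:- c, 1:] dvd pderiv D * G"
        using order_1[of c "pderiv D"] by (intro mult_dvd_mono) (simp_all add: k_def)
      then have "rpow c (Polynomial.order c D) dvd pderiv D * G" by (simp add: k mult.commute)
      then show ?thesis using True by simp
    next
      case False
      then have G0: "G \<noteq> 0" "Polynomial.order c G = 0" by (auto simp: order_0I)
      have oDG: "Polynomial.order c (pderiv D * G) = k" using G0 D' by (simp add: order_mult k_def)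
      have "\<not> rpow c (Polynomial.order c D) dvd pderiv D * G"
        unfolding order_divides k oDG using G0 D' by simp
      moreover have "Polynomial.order c (pderiv D * G * D) = Suc (2 * k)"
        using oDG k G0 D' assms by (subst order_mult) auto
      moreover have "right_sgn c (pderiv D * G * D) = sgn (poly G c)"
        using G0 D' assms False right_sgn_square[OF assms, of c]
        by (simp add: right_sgn_mult rs right_sgn_nonroot)
      ultimately show ?thesis using False by (simp add: jump_def)
    qed
  qed
  have "{c. poly D c = 0 \<and> \<not> rpow c (Polynomial.order c D) dvd pderiv D * G} = {c. poly D c = 0 \<and> poly G c \<noteq> 0}"
    using * by auto
  then show ?thesis unfolding cauchy_index_def using * by (intro sum.cong) auto
qed

section \<open>Nonnegativity and critical values\<close>

lemma nonneg_imp_lead: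
  fixes F :: "real poly"
  assumes "F \<noteq> 0" "\<And>x. poly F x \<ge> 0"
  shows "lead_coeff F > 0" "even (degree F)"
proof -
  have fin: "finite {x. poly F x = 0}" using assms(1) by (rule poly_roots_finite)
  \<comment> \<open>Larger than the absolute value of every root, so the signs at \<open>b\<close>
    and \<open>- b\<close> are those at infinity.\<close>
  define b where "b = (\<Sum>x | poly F x = 0. \<bar>x\<bar>) + 1"
  have b: "\<bar>x\<bar> < b" if "poly F x = 0" for x
    using member_le_sum[of x "{x. poly F x = 0}" abs] fin that by (simp add: b_def)
  have nz: "poly F x \<noteq> 0" if "\<bar>x\<bar> \<ge> b" for x using b[of x] that by auto
  have b0: "b > 0" by (simp add: b_def sum_nonneg add_nonneg_pos)
  have r: "sgn (poly F b) = sgn (lead_coeff F)"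
    using assms(1) b0 by (intro sgn_poly_right nz) auto
  have l: "sgn (poly F (- b)) = (-1) ^ degree F * sgn (lead_coeff F)"
    using assms(1) b0 by (intro sgn_poly_left nz) auto
  have "poly F b > 0" "poly F (- b) > 0"
    using assms(2)[of b] assms(2)[of "- b"] nz[of b] nz[of "- b"] b0 by auto
  then show 1: "lead_coeff F > 0" using r by (simp add: sgn_if split: if_splits)
  show "even (degree F)"
    using l 1 \<open>poly F (- b) > 0\<close> by (cases "even (degree F)") auto
qed

text \<open>Positive leading coefficient and even degree make \<open>F\<close> positive outside a
  compact interval, so a negative value forces a negative minimum in its interior.\<close>

lemma poly_attains_negative_min:
  fixes F :: "real poly"
  assumes "lead_coeff F > 0" "even (degree F)" "poly F x0 < 0"
  obtains c where "poly (pderiv F) c = 0" "poly F c < 0"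
proof -
  obtain n where n: "\<And>x. x \<ge> n \<Longrightarrow> poly F x \<ge> lead_coeff F" using poly_pinfty_gt_lc[OF assms(1)] by blast
  let ?G = "F \<circ>\<^sub>p [:0, -1:]"
  have lG: "lead_coeff ?G = lead_coeff F" using assms(2) by (simp add: lead_coeff_comp)
  obtain m where m: "\<And>x. x \<ge> m \<Longrightarrow> poly ?G x \<ge> lead_coeff F"
    using poly_pinfty_gt_lc[of ?G] assms(1) unfolding lG by blast
  define M where "M = Max {n, m, \<bar>x0\<bar>}"
  have M: "n \<le> M" "m \<le> M" "\<bar>x0\<bar> \<le> M" by (auto simp: M_def)
  have pos: "poly F x > 0" if "\<bar>x\<bar> \<ge> M" for x
  proof (cases "x \<ge> 0")
    case True
    then show ?thesis using n[of x] that M assms(1) by simp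
  next
    case False
    then show ?thesis using m[of "- x"] that M assms(1) by (simp add: poly_pcompose)
  qed
  obtain c where c: "- M \<le> c" "c \<le> M" "\<And>x. - M \<le> x \<Longrightarrow> x \<le> M \<Longrightarrow> poly F c \<le> poly F x"
  proof -
    have "- M \<le> M" using M(3) by simp
    from isCont_eq_Lb[OF this, of "poly F"] show ?thesis using that by auto
  qed
  have neg: "poly F c < 0" using c(3)[of x0] M(3) assms(3) by (simp add: abs_le_iff)
  have inner: "\<bar>c\<bar> < M" using pos[of c] neg by (meson less_asym not_le)
  have "poly (pderiv F) c = 0"
  proof (rule DERIV_local_min[of "poly F" _ c "M - \<bar>c\<bar>"])
    show "DERIV (poly F) c :> poly (pderiv F) c" by (rule poly_DERIV)
    show "\<forall>y. \<bar>c - y\<bar> < M - \<bar>c\<bar> \<longrightarrow> poly F c \<le> poly F y" using c(3) by (auto simp: abs_if split: if_splits)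
  qed (use inner in simp)
  then show ?thesis using that neg by blast
qed

text \<open>The two indices are the sums of \<open>sgn F\<close> and \<open>sgn (F\<^sup>2)\<close> over the critical points, so they agree iff no
  critical value is negative.\<close>

theorem poly_nonneg_iff:
  fixes F :: "real poly"
  assumes "F \<noteq> 0"
  shows "(\<forall>x. poly F x \<ge> 0) \<longleftrightarrow> lead_coeff F > 0 \<and> even (degree F) \<and>
    (pderiv F \<noteq> 0 \<longrightarrow> cauchy_index (pderiv F) (pderiv (pderiv F) * F) =
      cauchy_index (pderiv F) (pderiv (pderiv F) * (F * F)))"
proof (cases "pderiv F = 0")
  case True
  then obtain a where "F = [:a:]" by (auto simp: pderiv_eq_0_iff elim: degree_eq_zeroE)
  then show ?thesis using True assms by auto
next
  case False
  let ?S = "{c. poly (pderiv F) c = 0 \<and> poly F c \<noteq> 0}"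
  have fin: "finite ?S" using poly_roots_finite[OF False] by (rule rev_finite_subset) auto
  have i1: "cauchy_index (pderiv F) (pderiv (pderiv F) * F) = (\<Sum>c\<in>?S. sgn (poly F c))"
    using cauchy_index_pderiv[OF False] .
  have i2: "cauchy_index (pderiv F) (pderiv (pderiv F) * (F * F)) = (\<Sum>c\<in>?S. 1)"
    unfolding cauchy_index_pderiv[OF False] by (intro sum.cong) (auto simp: sgn_mult)
  show ?thesis
  proof (intro iffI conjI impI)
    assume nn: "\<forall>x. poly F x \<ge> 0"
    then show "lead_coeff F > 0" "even (degree F)" using nonneg_imp_lead[OF assms] by auto
    have "sgn (poly F c) = 1" if "c \<in> ?S" for c
      using that nn by (metis (mono_tags, lifting) mem_Collect_eq sgn_pos order_le_less)
    then show "cauchy_index (pderiv F) (pderiv (pderiv F) * F) =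
        cauchy_index (pderiv F) (pderiv (pderiv F) * (F * F))"
      unfolding i1 i2 by simp
  next
    assume A: "lead_coeff F > 0 \<and> even (degree F) \<and>
      (pderiv F \<noteq> 0 \<longrightarrow> cauchy_index (pderiv F) (pderiv (pderiv F) * F) =
        cauchy_index (pderiv F) (pderiv (pderiv F) * (F * F)))"
    show "\<forall>x. poly F x \<ge> 0"
    proof (rule ccontr)
      assume "\<not> ?thesis"
      then obtain x0 where "poly F x0 < 0" by (auto simp: not_le)
      then obtain c where c: "poly (pderiv F) c = 0" "poly F c < 0"
        using poly_attains_negative_min A by blast
      have "(\<Sum>c\<in>?S. sgn (poly F c)) < (\<Sum>c\<in>?S. 1)"
        using fin c by (intro sum_strict_mono_ex1) (auto simp: sgn_if intro!: exI[of _ c])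
      then show False using A False i1 i2 by simp
    qed
  qed
qed

section \<open>Cost-bounded specifications of programs\<close>

text \<open>Total correctness with a cost bound. \<open>run\<close> is deterministic, so the run
  asserted to exist is the only one.\<close>

definition spec :: "com \<Rightarrow> state \<Rightarrow> nat \<Rightarrow> (state \<Rightarrow> bool) \<Rightarrow> bool" where
  "spec c s B Q \<longleftrightarrow> (\<exists>k t. run c s k t \<and> k \<le> B \<and> Q t)"

fun iwrites :: "com \<Rightarrow> string set" where
  "iwrites Skip = {}"
| "iwrites (IAssign v a) = {v}"
| "iwrites (RAssign v a e) = {}"
| "iwrites (Seq c d) = iwrites c \<union> iwrites d"
| "iwrites (If b c d) = iwrites c \<union> iwrites d"
| "iwrites (While b c) = iwrites c"

fun awrites :: "com \<Rightarrow> string set" where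
  "awrites Skip = {}"
| "awrites (IAssign v a) = {}"
| "awrites (RAssign v a e) = {v}"
| "awrites (Seq c d) = awrites c \<union> awrites d"
| "awrites (If b c d) = awrites c \<union> awrites d"
| "awrites (While b c) = awrites c"

text \<open>The frame relation, with \<open>I\<close> and \<open>A\<close> the variables and arrays
  that may change. Together with the syntactic write sets it lets a specification mention only what
  its program computes.\<close>

definition same :: "string set \<Rightarrow> string set \<Rightarrow> state \<Rightarrow> state \<Rightarrow> bool" where
  "same I A s t \<longleftrightarrow>
    (\<forall>v. v \<notin> I \<longrightarrow> ivars t v = ivars s v) \<and> (\<forall>v. v \<notin> A \<longrightarrow> arrays t v = arrays s v)"

lemma same_refl [simp]: "same I A s s"
  by (simp add: same_def)

lemma same_trans: "same I A s t \<Longrightarrow> same I A t u \<Longrightarrow> same I A s u"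
  by (simp add: same_def)

lemma same_mono: "same I A s t \<Longrightarrow> I \<subseteq> I' \<Longrightarrow> A \<subseteq> A' \<Longrightarrow> same I' A' s t"
  by (auto simp: same_def)

lemma same_ivars: "same I A s t \<Longrightarrow> v \<notin> I \<Longrightarrow> ivars t v = ivars s v"
  by (simp add: same_def)

lemma same_arrays: "same I A s t \<Longrightarrow> v \<notin> A \<Longrightarrow> arrays t v = arrays s v"
  by (simp add: same_def)

lemma run_same: "run c s k t \<Longrightarrow> same (iwrites c) (awrites c) s t"
  by (induction rule: run.induct) (auto simp: same_def)

lemma specI: "run c s k t \<Longrightarrow> k \<le> B \<Longrightarrow> Q t \<Longrightarrow> spec c s B Q"
  unfolding spec_def by blast

lemma specE:
  assumes "spec c s B Q"
  obtains k t where "run c s k t" "k \<le> B" "Q t" "same (iwrites c) (awrites c) s t"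
  using assms run_same unfolding spec_def by blast

lemma spec_mono:
  assumes "spec c s B Q" "B \<le> B'" "\<And>t. Q t \<Longrightarrow> same (iwrites c) (awrites c) s t \<Longrightarrow> Q' t"
  shows "spec c s B' Q'"
  using assms(1)
proof (rule specE)
  fix k t assume "run c s k t" "k \<le> B" "Q t" "same (iwrites c) (awrites c) s t"
  then show ?thesis using assms(2,3) by (intro specI[of c s k t]) auto
qed

lemma spec_Seq:
  assumes "spec c s B1 R"
    and "\<And>t. R t \<Longrightarrow> same (iwrites c) (awrites c) s t \<Longrightarrow> spec d t B2 Q"
    and "B1 + B2 \<le> B"
  shows "spec (Seq c d) s B Q"
proof -
  obtain k t where 1: "run c s k t" "k \<le> B1" "R t" "same (iwrites c) (awrites c) s t"
    using assms(1) by (rule specE)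
  obtain l u where 2: "run d t l u" "l \<le> B2" "Q u"
    using assms(2)[OF 1(3,4)] by (rule specE)
  have "run (Seq c d) s (k + l) u" using 1(1) 2(1) by (rule run.Seq)
  then show ?thesis using 1 2 assms(3) by (intro specI[of _ _ "k + l" u]) auto
qed

lemma run_Skip_iff: "run Skip s k t \<longleftrightarrow> k = 0 \<and> t = s"
  by (auto intro: run.Skip elim: run_SkipE)

lemma run_IAssign_iff:
  "run (IAssign v a) s k t \<longleftrightarrow> k = 0 \<and> t = s\<lparr>ivars := (ivars s)(v := ival a s)\<rparr>"
  by (auto intro: run.IAssign elim: run_IAssignE)

lemma run_RAssign_iff:
  "run (RAssign v a e) s k t \<longleftrightarrow> rdefined e s \<and> k = rcost e \<and>
     t = s\<lparr>arrays := (arrays s)(v := (arrays s v)(ival a s := rval e s))\<rparr>"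
  by (auto intro: run.RAssign elim: run_RAssignE)

lemma run_Seq_iff: "run (Seq c d) s k u \<longleftrightarrow> (\<exists>k1 k2 t. k = k1 + k2 \<and> run c s k1 t \<and> run d t k2 u)"
  by (blast intro: run.Seq elim: run_SeqE)

lemma run_If_iff:
  "run (If b c d) s k t \<longleftrightarrow>
     (\<exists>l. k = tcost b + l \<and> tdefined b s \<and> run (if tval b s then c else d) s l t)"
proof
  assume "run (If b c d) s k t"
  then show "\<exists>l. k = tcost b + l \<and> tdefined b s \<and> run (if tval b s then c else d) s l t"
    by (rule run_IfE) simp_all
next
  assume "\<exists>l. k = tcost b + l \<and> tdefined b s \<and> run (if tval b s then c else d) s l t"
  then obtain l where "k = tcost b + l" "tdefined b s" "run (if tval b s then c else d) s l t" by blast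
  then show "run (If b c d) s k t"
    using run.IfTrue[of b s c l t d] run.IfFalse[of b s d l t c] by (cases "tval b s") simp_all
qed

lemma spec_Skip [simp]: "spec Skip s B Q \<longleftrightarrow> Q s"
  unfolding spec_def run_Skip_iff by auto

lemma spec_IAssign [simp]:
  "spec (IAssign v a) s B Q \<longleftrightarrow> Q (s\<lparr>ivars := (ivars s)(v := ival a s)\<rparr>)"
  unfolding spec_def run_IAssign_iff by auto

lemma spec_RAssign [simp]:
  "spec (RAssign v a e) s B Q \<longleftrightarrow> rdefined e s \<and> rcost e \<le> B \<and>
     Q (s\<lparr>arrays := (arrays s)(v := (arrays s v)(ival a s := rval e s))\<rparr>)"
  unfolding spec_def run_RAssign_iff by auto

lemma spec_add_cost:
  "(\<exists>k t. (\<exists>l. k = m + l \<and> P \<and> run c s l t) \<and> k \<le> B \<and> Q t) \<longleftrightarrow> P \<and> m \<le> B \<and> spec c s (B - m) Q"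
proof
  assume "P \<and> m \<le> B \<and> spec c s (B - m) Q"
  then obtain l t where "P" "m \<le> B" "run c s l t" "l \<le> B - m" "Q t" by (auto simp: spec_def)
  then show "\<exists>k t. (\<exists>l. k = m + l \<and> P \<and> run c s l t) \<and> k \<le> B \<and> Q t"
    by (intro exI[of _ "m + l"] exI[of _ t]) auto
qed (fastforce simp: spec_def)

lemma spec_If [simp]:
  "spec (If b c d) s B Q \<longleftrightarrow> tdefined b s \<and> tcost b \<le> B \<and>
     (if tval b s then spec c s (B - tcost b) Q else spec d s (B - tcost b) Q)"
  unfolding spec_def[of "If b c d"] run_If_iff spec_add_cost by simp

lemma spec_cong_run: "(\<And>k t. run c s k t \<longleftrightarrow> run d s' k t) \<Longrightarrow> spec c s B Q \<longleftrightarrow> spec d s' B Q"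
  by (simp add: spec_def)

text \<open>Associating to the right brings the first assignment or test into head position, so that
  the simplifier executes straight-line code.\<close>

lemma spec_Seq_assoc [simp]: "spec (Seq (Seq a b) c) s B Q \<longleftrightarrow> spec (Seq a (Seq b c)) s B Q"
proof (rule spec_cong_run, rule iffI)
  fix k t
  assume "run (Seq (Seq a b) c) s k t"
  then obtain k1 k2 k3 u v where "k = (k1 + k2) + k3" "run a s k1 u" "run b u k2 v" "run c v k3 t"
    unfolding run_Seq_iff by blast
  then show "run (Seq a (Seq b c)) s k t" by (simp add: add.assoc run.Seq)
next
  fix k t
  assume "run (Seq a (Seq b c)) s k t"
  then obtain k1 k2 k3 u v where r: "k = k1 + (k2 + k3)" "run a s k1 u" "run b u k2 v" "run c v k3 t"
    unfolding run_Seq_iff by blast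
  from run.Seq[OF run.Seq[OF r(2,3)] r(4)] show "run (Seq (Seq a b) c) s k t"
    using r(1) by (simp add: add.assoc)
qed

lemma spec_Seq_Skip [simp]: "spec (Seq Skip c) s B Q \<longleftrightarrow> spec c s B Q"
  by (rule spec_cong_run) (simp add: run_Seq_iff run_Skip_iff)

lemma spec_Seq_IAssign [simp]:
  "spec (Seq (IAssign v a) c) s B Q \<longleftrightarrow> spec c (s\<lparr>ivars := (ivars s)(v := ival a s)\<rparr>) B Q"
  by (rule spec_cong_run) (simp add: run_Seq_iff run_IAssign_iff)

lemma spec_Seq_RAssign [simp]:
  "spec (Seq (RAssign v a e) c) s B Q \<longleftrightarrow> rdefined e s \<and> rcost e \<le> B \<and>
     spec c (s\<lparr>arrays := (arrays s)(v := (arrays s v)(ival a s := rval e s))\<rparr>) (B - rcost e) Q"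
proof -
  let ?s = "s\<lparr>arrays := (arrays s)(v := (arrays s v)(ival a s := rval e s))\<rparr>"
  have "run (Seq (RAssign v a e) c) s k t \<longleftrightarrow> (\<exists>l. k = rcost e + l \<and> rdefined e s \<and> run c ?s l t)"
    for k t
    unfolding run_Seq_iff run_RAssign_iff by blast
  then show ?thesis
    unfolding spec_def[of "Seq (RAssign v a e) c"] by (simp only: spec_add_cost)
qed

lemma spec_Seq_If [simp]:
  "spec (Seq (If b c d) c') s B Q \<longleftrightarrow> tdefined b s \<and> tcost b \<le> B \<and>
     (if tval b s then spec (Seq c c') s (B - tcost b) Q else spec (Seq d c') s (B - tcost b) Q)"
proof -
  have "run (Seq (If b c d) c') s k t \<longleftrightarrow>
      (\<exists>l. k = tcost b + l \<and> tdefined b s \<and> run (Seq (if tval b s then c else d) c') s l t)" for k t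
  proof
    assume "run (Seq (If b c d) c') s k t"
    then obtain l k2 u where "k = tcost b + l + k2" "tdefined b s"
      "run (if tval b s then c else d) s l u" "run c' u k2 t"
      unfolding run_Seq_iff run_If_iff by blast
    then show "\<exists>l. k = tcost b + l \<and> tdefined b s \<and> run (Seq (if tval b s then c else d) c') s l t"
      by (intro exI[of _ "l + k2"]) (simp add: run.Seq)
  next
    assume "\<exists>l. k = tcost b + l \<and> tdefined b s \<and> run (Seq (if tval b s then c else d) c') s l t"
    then obtain l k2 u where r: "k = tcost b + (l + k2)" "tdefined b s"
      "run (if tval b s then c else d) s l u" "run c' u k2 t"
      unfolding run_Seq_iff by blast
    have "run (If b c d) s (tcost b + l) u" unfolding run_If_iff using r by blast
    from run.Seq[OF this r(4)] show "run (Seq (If b c d) c') s k t" using r(1) by (simp add: add.assoc)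
  qed
  then show ?thesis
    unfolding spec_def[of "Seq (If b c d) c'"] by (simp only: spec_add_cost) simp
qed

text \<open>The bound \<open>h\<close> is evaluated anew in every round, so the loop rule demands
  that its value stays constant. Counter and loop test are index operations and cost
  nothing.\<close>

definition For :: "string \<Rightarrow> iexp \<Rightarrow> com \<Rightarrow> com" where
  "For v h c = Seq (IAssign v (INum 0))
     (While (ILess (IVar v) h) (Seq c (IAssign v (IAdd (IVar v) (INum 1)))))"

lemma writes_For [simp]:
  "iwrites (For v h c) = insert v (iwrites c)" "awrites (For v h c) = awrites c"
  by (auto simp: For_def)

text \<open>The invariant \<open>I i\<close> is required at the loop head, where the loop variable has value \<open>i\<close>.\<close>

lemma spec_For:
  assumes v: "v \<notin> iwrites c"
    and bound: "\<And>t. same (insert v (iwrites c)) (awrites c) s t \<Longrightarrow> ival h t = H"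
    and init: "I 0 (s\<lparr>ivars := (ivars s)(v := 0)\<rparr>)"
    and step: "\<And>i t. i < H \<Longrightarrow> same (insert v (iwrites c)) (awrites c) s t \<Longrightarrow> ivars t v = i \<Longrightarrow> I i t \<Longrightarrow>
      spec c t B (\<lambda>u. I (Suc i) (u\<lparr>ivars := (ivars u)(v := Suc i)\<rparr>))"
    and post: "\<And>t. same (insert v (iwrites c)) (awrites c) s t \<Longrightarrow> ivars t v = H \<Longrightarrow> I H t \<Longrightarrow> Q t"
    and cost: "H * B \<le> C"
  shows "spec (For v h c) s C Q"
proof -
  let ?same = "same (insert v (iwrites c)) (awrites c)"
  let ?w = "While (ILess (IVar v) h) (Seq c (IAssign v (IAdd (IVar v) (INum 1))))"
  have loop: "spec ?w t ((H - i) * B) Q"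
    if "i \<le> H" "?same s t" "ivars t v = i" "I i t" for i t
    using that
  proof (induction i arbitrary: t rule: inc_induct)
    case base
    have "run ?w t (tcost (ILess (IVar v) h)) t"
      using base bound by (intro run.WhileFalse) auto
    then have "run ?w t 0 t" by simp
    then show ?case using post base by (auto simp: spec_def)
  next
    case (step i)
    then have lt: "tval (ILess (IVar v) h) t" using bound by auto
    obtain k u where u: "run c t k u" "k \<le> B" "I (Suc i) (u\<lparr>ivars := (ivars u)(v := Suc i)\<rparr>)"
      using assms(4)[of i t] step.hyps step.prems by (auto simp: spec_def)
    let ?u = "u\<lparr>ivars := (ivars u)(v := Suc i)\<rparr>"
    have tu: "same (iwrites c) (awrites c) t u" using u(1) by (rule run_same)
    then have "ivars u v = i" using v step.prems by (simp add: same_def)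
    then have "run (IAssign v (IAdd (IVar v) (INum 1))) u 0 ?u"
      using run.IAssign[of v "IAdd (IVar v) (INum 1)" u] by simp
    with u(1) have r: "run (Seq c (IAssign v (IAdd (IVar v) (INum 1)))) t (k + 0) ?u" by (rule run.Seq)
    have "?same s ?u" using tu step.prems by (auto simp: same_def)
    from step.IH[OF this] u(3) obtain l x where x: "run ?w ?u l x" "l \<le> (H - Suc i) * B" "Q x"
      by (auto simp: spec_def)
    from run.WhileTrue[OF _ lt r x(1)] have "run ?w t (k + l) x" by simp
    moreover have "k + l \<le> (H - i) * B"
    proof -
      have "H - i = Suc (H - Suc i)" using step.hyps by simp
      then show ?thesis using u(2) x(2) by simp
    qed
    ultimately show ?case using x(3) by (auto simp: spec_def)
  qed
  have "spec ?w (s\<lparr>ivars := (ivars s)(v := 0)\<rparr>) (H * B) Q"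
    using loop[of 0 "s\<lparr>ivars := (ivars s)(v := 0)\<rparr>"] init by (simp add: same_def)
  then show ?thesis
    unfolding For_def spec_Seq_IAssign ival.simps by (rule spec_mono[OF _ cost])
qed

section \<open>Polynomials stored as ascending coefficient arrays\<close>

definition coeffs_poly :: "(nat \<Rightarrow> real) \<Rightarrow> nat \<Rightarrow> real poly" where
  "coeffs_poly a l = (\<Sum>i<l. monom (a i) i)"

lemma coeff_coeffs_poly [simp]: "coeff (coeffs_poly a l) i = (if i < l then a i else 0)"
  by (simp add: coeffs_poly_def coeff_sum)

lemma coeffs_poly_0 [simp]: "coeffs_poly a 0 = 0"
  by (simp add: coeffs_poly_def)

lemma coeffs_poly_Suc: "coeffs_poly a (Suc l) = coeffs_poly a l + monom (a l) l"
  by (simp add: coeffs_poly_def)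

lemma coeffs_poly_eqI:
  assumes "\<And>i. i < l \<Longrightarrow> a i = coeff P i" "\<And>i. i \<ge> l \<Longrightarrow> coeff P i = 0"
  shows "coeffs_poly a l = P"
  using assms by (intro poly_eqI) auto

lemma degree_coeffs_poly: "degree (coeffs_poly a l) < l \<or> coeffs_poly a l = 0"
  by (metis coeff_coeffs_poly leading_coeff_0_iff)

definition rzero :: "string \<Rightarrow> iexp \<Rightarrow> com" where
  "rzero t l = For ''zi'' l (RAssign t (IVar ''zi'') (RNum 0))"

lemma writes_rzero [simp]: "iwrites (rzero t l) = {''zi''}" "awrites (rzero t l) = {t}"
  by (simp_all add: rzero_def)

lemma spec_rzero:
  assumes "\<And>u. same {''zi''} {t} s u \<Longrightarrow> ival l u = n"
  shows "spec (rzero t l) s 0 (\<lambda>u. \<forall>i<n. arrays u t i = 0)"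
  unfolding rzero_def
  by (rule spec_For[where I = "\<lambda>k u. \<forall>i<k. arrays u t i = 0" and B = 0 and H = n])
    (use assms in \<open>auto simp: less_Suc_eq\<close>)

definition rcopy :: "string \<Rightarrow> string \<Rightarrow> iexp \<Rightarrow> com" where
  "rcopy t x l = For ''zi'' l (RAssign t (IVar ''zi'') (RCell x (IVar ''zi'')))"

lemma writes_rcopy [simp]: "iwrites (rcopy t x l) = {''zi''}" "awrites (rcopy t x l) = {t}"
  by (simp_all add: rcopy_def)

lemma spec_rcopy:
  assumes "\<And>u. same {''zi''} {t} s u \<Longrightarrow> ival l u = n" "t \<noteq> x"
  shows "spec (rcopy t x l) s 0 (\<lambda>u. \<forall>i<n. arrays u t i = arrays s x i)"
  unfolding rcopy_def
  by (rule spec_For[where I = "\<lambda>k u. \<forall>i<k. arrays u t i = arrays s x i" and B = 0 and H = n])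
    (use assms in \<open>auto simp: less_Suc_eq same_def\<close>)

definition pmul :: "string \<Rightarrow> iexp \<Rightarrow> string \<Rightarrow> iexp \<Rightarrow> string \<Rightarrow> iexp \<Rightarrow> com" where
  "pmul t l x lx y ly = Seq (rzero t l)
     (For ''ma'' lx (For ''mb'' ly (RAssign t (IAdd (IVar ''ma'') (IVar ''mb''))
       (RAdd (RCell t (IAdd (IVar ''ma'') (IVar ''mb'')))
         (RMul (RCell x (IVar ''ma'')) (RCell y (IVar ''mb'')))))))"

lemma writes_pmul [simp]:
  "iwrites (pmul t l x lx y ly) = {''zi'', ''ma'', ''mb''}" "awrites (pmul t l x lx y ly) = {t}"
  by (auto simp: pmul_def)

text \<open>A product of \<open>n1\<close> by \<open>n2\<close> coefficients has
  \<open>n1 + n2 - 1\<close> of them, whence the \<open>Suc\<close> in the length condition; one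
  multiplication and one addition per pair give the factor 2.\<close>

lemma spec_pmul:
  assumes "t \<noteq> x" "t \<noteq> y" "n1 + n2 \<le> Suc n" "2 * n1 * n2 \<le> B"
    and l: "\<And>u. same {''zi'', ''ma'', ''mb''} {t} s u \<Longrightarrow> ival l u = n \<and> ival lx u = n1 \<and> ival ly u = n2"
  shows "spec (pmul t l x lx y ly) s B
    (\<lambda>u. coeffs_poly (arrays u t) n = coeffs_poly (arrays s x) n1 * coeffs_poly (arrays s y) n2)"
  unfolding pmul_def
proof (rule spec_Seq[where R = "\<lambda>u. \<forall>i<n. arrays u t i = 0" and ?B1.0 = 0 and ?B2.0 = "n1 * (n2 * 2)"],
    goal_cases)
  case 1
  show ?case
  proof (rule spec_rzero)
    fix u assume "same {''zi''} {t} s u"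
    then have "same {''zi'', ''ma'', ''mb''} {t} s u" by (rule same_mono) auto
    then show "ival l u = n" using l by blast
  qed
next
  case (2 s1)
  let ?P = "coeffs_poly (arrays s x)" and ?R = "coeffs_poly (arrays s y)"
  have s1: "same {''zi'', ''ma'', ''mb''} {t} s s1" using 2(2) by (rule same_mono) auto
  have lu: "ival l u = n \<and> ival lx u = n1 \<and> ival ly u = n2" if "same {''ma'', ''mb''} {t} s1 u" for u
  proof (rule l, rule same_trans[OF s1])
    show "same {''zi'', ''ma'', ''mb''} {t} s1 u" using that by (rule same_mono) auto
  qed
  note outer = 2
  show ?case
  proof (rule spec_For[where I = "\<lambda>i u. \<forall>k<n. arrays u t k = coeff (?P i * ?R n2) k"
        and B = "n2 * 2" and H = n1], goal_cases)
    case (2 u)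
    then show ?case using lu by simp
  next
    case 3
    show ?case using outer(1) by simp
  next
    case (4 i u)
    have u': "same {''ma'', ''mb''} {t} s1 u" using 4(2) by simp
    let ?M = "monom (arrays s x i) i"
    show ?case
    proof (rule spec_For[where I = "\<lambda>j v. \<forall>k<n. arrays v t k = coeff (?P i * ?R n2 + ?M * ?R j) k"
          and B = 2 and H = n2], goal_cases)
      case (2 v)
      then have "same {''ma'', ''mb''} {t} u v" by (rule same_mono) auto
      then show ?case using lu same_trans[OF u'] by blast
    next
      case 3
      show ?case using 4(4) by simp
    next
      case (4 j v)
      have a: "arrays v x = arrays s x" "arrays v y = arrays s y" "ivars v ''ma'' = i"
        using s1 u' 4(2) assms(1,2) \<open>ivars u ''ma'' = i\<close> by (simp_all add: same_def)
      have ij: "i + j < n" using \<open>i < n1\<close> \<open>j < n2\<close> assms(3) by simp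
      have "coeff (?M * ?R (Suc j)) k =
          coeff (?M * ?R j) k + (if k = i + j then arrays s x i * arrays s y j else 0)" for k
        by (simp add: coeffs_poly_Suc distrib_left mult_monom)
      then show ?case using 4(3,4) a ij by simp
    next
      case (5 v)
      then show ?case by (simp add: coeffs_poly_Suc distrib_right)
    qed auto
  next
    case (5 u)
    show ?case
    proof (rule coeffs_poly_eqI)
      fix k assume k: "k \<ge> n"
      show "coeff (?P n1 * ?R n2) k = 0"
        unfolding coeff_mult using k assms(3) by (intro sum.neutral) auto
    qed (use 5 in auto)
  qed auto
qed (use assms in auto)

section \<open>Deciding nonnegativity\<close>

text \<open>Cell 0 accumulates the value and cell 1 holds the current power of the argument.\<close>

definition reval :: "string \<Rightarrow> string \<Rightarrow> iexp \<Rightarrow> rexp \<Rightarrow> com" where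
  "reval r x l z = Seq (RAssign r (INum 0) (RNum 0)) (Seq (RAssign r (INum 1) (RNum 1))
     (For ''ei'' l (Seq
       (RAssign r (INum 0) (RAdd (RCell r (INum 0)) (RMul (RCell x (IVar ''ei'')) (RCell r (INum 1)))))
       (RAssign r (INum 1) (RMul (RCell r (INum 1)) z)))))"

lemma writes_reval [simp]: "iwrites (reval r x l z) = {''ei''}" "awrites (reval r x l z) = {r}"
  by (simp_all add: reval_def)

lemma spec_reval:
  assumes "r \<noteq> x" "rcost z = 0" "3 * n \<le> B"
    and l: "\<And>u. same {''ei''} {r} s u \<Longrightarrow> ival l u = n \<and> rdefined z u \<and> rval z u = a"
  shows "spec (reval r x l z) s B (\<lambda>u. arrays u r 0 = poly (coeffs_poly (arrays s x) n) a)"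
proof -
  define s0 where "s0 = s\<lparr>arrays := (arrays s)(r := (arrays s r)(0 := 0, 1 := 1))\<rparr>"
  have s0: "same {} {r} s s0" by (simp add: s0_def same_def)
  have l': "ival l u = n \<and> rdefined z u \<and> rval z u = a" if "same {''ei''} {r} s0 u" for u
    by (rule l, rule same_trans[OF same_mono[OF s0] that]) auto
  have "spec (For ''ei'' l (Seq
       (RAssign r (INum 0) (RAdd (RCell r (INum 0)) (RMul (RCell x (IVar ''ei'')) (RCell r (INum 1)))))
       (RAssign r (INum 1) (RMul (RCell r (INum 1)) z)))) s0 B
     (\<lambda>u. arrays u r 0 = poly (coeffs_poly (arrays s x) n) a)"
  proof (rule spec_For[where I = "\<lambda>i u. arrays u r 0 = poly (coeffs_poly (arrays s x) i) a \<and>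
        arrays u r 1 = a ^ i" and B = 3 and H = n], goal_cases)
    case (4 i t)
    have t: "same {''ei''} {r} s0 t" using 4(2) by simp
    let ?t = "t\<lparr>arrays := (arrays t)(r := (arrays t r)(0 := rval (RAdd (RCell r (INum 0)) (RMul (RCell x (IVar ''ei'')) (RCell r (INum 1)))) t))\<rparr>"
    have "same {''ei''} {r} s0 ?t" using t by (simp add: same_def)
    note lt = l'[OF this]
    have "arrays t x = arrays s x" using t s0 assms(1) by (simp add: same_def)
    then show ?case using 4(3,4) lt assms(1,2) by (simp add: coeffs_poly_Suc poly_monom)
  next
    case (5 t)
    then show ?case by simp
  qed (use l' assms in \<open>auto simp: s0_def\<close>)
  then show ?thesis
    unfolding reval_def by (simp add: s0_def)
qed

text \<open>Separates the zero polynomial from the nonzero constants, which \<open>degree\<close>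
  does not.\<close>

definition poly_len :: "real poly \<Rightarrow> nat" where
  "poly_len P = (if P = 0 then 0 else Suc (degree P))"

lemma poly_len_0 [simp]: "poly_len 0 = 0"
  by (simp add: poly_len_def)

lemma poly_len_coeffs_poly_Suc:
  "poly_len (coeffs_poly a (Suc i)) = (if a i = 0 then poly_len (coeffs_poly a i) else Suc i)"
proof (cases "a i = 0")
  case True
  then show ?thesis by (simp add: coeffs_poly_Suc)
next
  case False
  have "degree (coeffs_poly a (Suc i)) = i"
    by (rule antisym[OF degree_le le_degree]) (use False in auto)
  moreover have "coeffs_poly a (Suc i) \<noteq> 0" using False by (metis coeff_0 coeff_coeffs_poly lessI)
  ultimately show ?thesis using False by (simp add: poly_len_def)
qed

lemma poly_len_coeffs_poly_le: "poly_len (coeffs_poly a l) \<le> l"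
  by (induction l) (auto simp: poly_len_coeffs_poly_Suc)

lemma coeffs_poly_poly_len:
  assumes "poly_len (coeffs_poly a l) \<le> k" "k \<le> l"
  shows "coeffs_poly a k = coeffs_poly a l"
proof (rule poly_eqI)
  fix i
  have "coeff (coeffs_poly a l) i = 0" if "i \<ge> k"
  proof (cases "coeffs_poly a l = 0")
    case False
    then show ?thesis using that assms(1) by (intro coeff_eq_0) (simp add: poly_len_def)
  qed (simp only: coeff_0)
  then show "coeff (coeffs_poly a k) i = coeff (coeffs_poly a l) i"
    using assms(2) by (auto split: if_splits)
qed

definition rlen :: "string \<Rightarrow> string \<Rightarrow> iexp \<Rightarrow> com" where
  "rlen v x l = Seq (IAssign v (INum 0))
     (For ''pi'' l (If (REq (RCell x (IVar ''pi'')) (RNum 0)) Skip (IAssign v (IAdd (IVar ''pi'') (INum 1)))))"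

lemma writes_rlen [simp]: "iwrites (rlen v x l) = {v, ''pi''}" "awrites (rlen v x l) = {}"
  by (auto simp: rlen_def)

lemma spec_rlen:
  assumes "v \<noteq> ''pi''" "n \<le> B" "\<And>u. same {v, ''pi''} {} s u \<Longrightarrow> ival l u = n"
  shows "spec (rlen v x l) s B (\<lambda>u. ivars u v = poly_len (coeffs_poly (arrays s x) n))"
proof -
  define s0 where "s0 = s\<lparr>ivars := (ivars s)(v := 0)\<rparr>"
  have s0: "same {v} {} s s0" by (simp add: s0_def same_def)
  have "spec (For ''pi'' l (If (REq (RCell x (IVar ''pi'')) (RNum 0)) Skip
      (IAssign v (IAdd (IVar ''pi'') (INum 1))))) s0 B (\<lambda>u. ivars u v = poly_len (coeffs_poly (arrays s x) n))"
  proof (rule spec_For[where I = "\<lambda>i u. ivars u v = poly_len (coeffs_poly (arrays s x) i)" and B = 1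
        and H = n], goal_cases)
    case (2 t)
    then have "same {v, ''pi''} {} s t" using s0 by (auto simp: same_def)
    then show ?case by (rule assms(3))
  next
    case (4 i t)
    have "arrays t x = arrays s x" using 4(2) s0 by (simp add: same_def)
    then show ?case using 4(3,4) assms(1) by (simp add: poly_len_coeffs_poly_Suc)
  qed (use assms in \<open>auto simp: s0_def poly_len_def\<close>)
  then show ?thesis
    unfolding rlen_def by (simp add: s0_def)
qed

text \<open>The language has no conversion from indices to reals, so the exponents are read from the
  table \<open>c\<close> of the natural numbers.\<close>

definition rderiv :: "string \<Rightarrow> string \<Rightarrow> iexp \<Rightarrow> com" where
  "rderiv y x l = For ''di'' l (RAssign y (IVar ''di'')
     (RMul (RCell ''c'' (IAdd (IVar ''di'') (INum 1))) (RCell x (IAdd (IVar ''di'') (INum 1)))))"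

lemma writes_rderiv [simp]: "iwrites (rderiv y x l) = {''di''}" "awrites (rderiv y x l) = {y}"
  by (simp_all add: rderiv_def)

lemma spec_rderiv:
  assumes "y \<noteq> x" "y \<noteq> ''c''" "n \<le> B" "\<And>i. i \<le> n \<Longrightarrow> arrays s ''c'' i = real i"
    and "\<And>u. same {''di''} {y} s u \<Longrightarrow> ival l u = n"
  shows "spec (rderiv y x l) s B
    (\<lambda>u. coeffs_poly (arrays u y) n = pderiv (coeffs_poly (arrays s x) (Suc n)))"
  unfolding rderiv_def
proof (rule spec_For[where I = "\<lambda>i u. \<forall>k<i. arrays u y k = real (Suc k) * arrays s x (Suc k)" and B = 1
      and H = n], goal_cases)
  case (4 i t)
  have "arrays t x = arrays s x" "arrays t ''c'' = arrays s ''c''" using 4(2) assms(1,2) by (simp_all add: same_def)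
  then show ?case using 4 assms(4)[of "Suc i"] by (simp add: less_Suc_eq)
next
  case (5 t)
  then show ?case by (intro coeffs_poly_eqI) (simp_all add: coeff_pderiv)
qed (use assms in auto)

section \<open>Euclid's algorithm for Cauchy indices\<close>

definition swap_step :: com where
  "swap_step =
    Seq (RAssign ''y'' (INum 0) (RMul (RCell ''A'' (ISub (IVar ''la'') (INum 1))) (RCell ''B'' (ISub (IVar ''lb'') (INum 1)))))
    (Seq (If (RLess (RCell ''sg'' (IAdd (ISub (IVar ''la'') (INum 1)) (ISub (IVar ''lb'') (INum 1)))) (RNum 0))
       (If (RLess (RNum 0) (RCell ''y'' (INum 0)))
         (RAssign ''u'' (INum 0) (RAdd (RCell ''u'' (INum 0)) (RCell ''u'' (INum 1))))
         (RAssign ''u'' (INum 0) (RSub (RCell ''u'' (INum 0)) (RCell ''u'' (INum 1)))))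
       Skip)
    (Seq (RAssign ''u'' (INum 1) (RSub (RNum 0) (RCell ''u'' (INum 1))))
    (Seq (rcopy ''T'' ''A'' (IVar ''la''))
    (Seq (rcopy ''A'' ''B'' (IVar ''lb''))
    (Seq (rcopy ''B'' ''T'' (IVar ''la''))
    (Seq (IAssign ''lc'' (IVar ''la'')) (Seq (IAssign ''la'' (IVar ''lb'')) (IAssign ''lb'' (IVar ''lc'')))))))))"

text \<open>A single cancellation of the leading term of \<open>A\<close> instead of a full
  division: each round has linear cost and shortens \<open>A\<close>, so the quadratic total follows
  from the number of rounds alone.\<close>

definition reduce_step :: com where
  "reduce_step =
    Seq (RAssign ''y'' (INum 0) (RDiv (RCell ''A'' (ISub (IVar ''la'') (INum 1))) (RCell ''B'' (ISub (IVar ''lb'') (INum 1)))))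
    (Seq (For ''ri'' (IVar ''lb'') (RAssign ''A'' (IAdd (ISub (IVar ''la'') (IVar ''lb'')) (IVar ''ri''))
       (RSub (RCell ''A'' (IAdd (ISub (IVar ''la'') (IVar ''lb'')) (IVar ''ri'')))
         (RMul (RCell ''y'' (INum 0)) (RCell ''B'' (IVar ''ri''))))))
    (Seq (rlen ''lc'' ''A'' (IVar ''la'')) (IAssign ''la'' (IVar ''lc''))))"

definition euclid_step :: com where
  "euclid_step = If (ILess (INum 0) (IVar ''la''))
     (If (ILess (IVar ''la'') (IVar ''lb'')) swap_step reduce_step) Skip"

text \<open>The number of rounds is fixed in advance and exceeds the largest possible initial
  \<open>euclid_measure\<close>, \<open>2 (lA + lB) + 1\<close>. Once \<open>A\<close> has become
  zero, the surplus rounds do nothing.\<close>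

definition euclid :: "iexp \<Rightarrow> iexp \<Rightarrow> com" where
  "euclid lA lB = Seq (rlen ''la'' ''A'' lA) (Seq (rlen ''lb'' ''B'' lB)
     (Seq (RAssign ''u'' (INum 0) (RNum 0)) (Seq (RAssign ''u'' (INum 1) (RNum 1))
     (For ''it'' (IAdd (IMul (INum 2) (IAdd lA lB)) (INum 2)) euclid_step))))"

lemma writes_swap_step [simp]:
  "iwrites swap_step = {''la'', ''lb'', ''lc'', ''zi''}" "awrites swap_step = {''A'', ''B'', ''T'', ''u'', ''y''}"
  by (auto simp: swap_step_def)

lemma writes_reduce_step [simp]:
  "iwrites reduce_step = {''la'', ''lc'', ''ri'', ''pi''}" "awrites reduce_step = {''A'', ''y''}"
  by (auto simp: reduce_step_def)

lemma writes_euclid_step [simp]: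
  "iwrites euclid_step = {''la'', ''lb'', ''lc'', ''zi'', ''ri'', ''pi''}"
  "awrites euclid_step = {''A'', ''B'', ''T'', ''u'', ''y''}"
  by (auto simp: euclid_step_def)

lemma writes_euclid [simp]:
  "iwrites (euclid lA lB) = {''la'', ''lb'', ''lc'', ''zi'', ''ri'', ''pi'', ''it''}"
  "awrites (euclid lA lB) = {''A'', ''B'', ''T'', ''u'', ''y''}"
  by (auto simp: euclid_def)

abbreviation "polyA s \<equiv> coeffs_poly (arrays s ''A'') (ivars s ''la'')"
abbreviation "polyB s \<equiv> coeffs_poly (arrays s ''B'') (ivars s ''lb'')"

text \<open>The array cells \<open>u 0\<close> and \<open>u 1\<close> hold the index accumulated so far and the sign of the remaining one.\<close>

definition euclid_inv :: "nat \<Rightarrow> real \<Rightarrow> state \<Rightarrow> bool" where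
  "euclid_inv M I0 s \<longleftrightarrow> ivars s ''la'' = poly_len (polyA s) \<and> ivars s ''lb'' = poly_len (polyB s) \<and>
     (ivars s ''la'' = 0 \<or> ivars s ''lb'' > 0) \<and> ivars s ''la'' + ivars s ''lb'' \<le> M \<and>
     arrays s ''u'' 0 + arrays s ''u'' 1 * cauchy_index (polyB s) (polyA s) = I0"

text \<open>A swap does not shorten the polynomials, but is always followed by a reduction.\<close>

definition euclid_measure :: "state \<Rightarrow> nat" where
  "euclid_measure s = 2 * (ivars s ''la'' + ivars s ''lb'') + (if ivars s ''la'' < ivars s ''lb'' then 1 else 0)"

lemma lead_coeff_coeffs_poly:
  assumes "l = poly_len (coeffs_poly a l)" "l > 0"
  shows "lead_coeff (coeffs_poly a l) = a (l - 1)" "degree (coeffs_poly a l) = l - 1" "a (l - 1) \<noteq> 0"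
    "coeffs_poly a l \<noteq> 0"
proof -
  have nz: "coeffs_poly a l \<noteq> 0" "l = Suc (degree (coeffs_poly a l))"
    using assms by (auto simp: poly_len_def split: if_splits)
  then show "degree (coeffs_poly a l) = l - 1" "coeffs_poly a l \<noteq> 0" by auto
  then show 1: "lead_coeff (coeffs_poly a l) = a (l - 1)" using assms(2) by simp
  then show "a (l - 1) \<noteq> 0" using nz(1) by (metis leading_coeff_0_iff)
qed

lemma coeffs_poly_cong: "(\<And>i. i < l \<Longrightarrow> a i = b i) \<Longrightarrow> coeffs_poly a l = coeffs_poly b l"
  by (simp add: coeffs_poly_def)

text \<open>\<open>cauchy_index_swap\<close> replaces the index by \<open>sgn_change (A * B)\<close>
  minus the index with the roles exchanged: the first term, times \<open>u 1\<close>, is added to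
  \<open>u 0\<close>, and \<open>u 1\<close> is negated. The parity of the degree comes from the
  table \<open>sg\<close>, as index expressions have no parity test.\<close>

lemma spec_swap_step:
  assumes inv: "euclid_inv M I0 s" and la: "0 < ivars s ''la''" "ivars s ''la'' < ivars s ''lb''"
    and sg: "\<And>i. i < M \<Longrightarrow> arrays s ''sg'' i = (-1) ^ i"
  shows "spec swap_step s 5 (\<lambda>t. euclid_inv M I0 t \<and> euclid_measure t < euclid_measure s)"
proof -
  let ?la = "ivars s ''la''" and ?lb = "ivars s ''lb''"
  let ?P = "polyA s" and ?R = "polyB s"
  have lb: "0 < ?lb" using la by simp
  have lens: "?la = poly_len ?P" "?lb = poly_len ?R" and M: "?la + ?lb \<le> M"
    and I0: "arrays s ''u'' 0 + arrays s ''u'' 1 * cauchy_index ?R ?P = I0"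
    using inv by (auto simp: euclid_inv_def)
  note P = lead_coeff_coeffs_poly[OF lens(1) la(1)] and R = lead_coeff_coeffs_poly[OF lens(2) lb]
  let ?y = "arrays s ''A'' (?la - 1) * arrays s ''B'' (?lb - 1)"
  have chg: "sgn_change (?P * ?R) = (if odd (?la - 1 + (?lb - 1)) then sgn ?y else 0)"
  proof -
    have "lead_coeff (?P * ?R) = ?y" by (simp only: lead_coeff_mult P(1) R(1))
    moreover have "degree (?P * ?R) = ?la - 1 + (?lb - 1)" by (simp only: degree_mult_eq[OF P(4) R(4)] P(2) R(2))
    ultimately show ?thesis unfolding sgn_change_def by (simp only:)
  qed
  define u0 where "u0 = arrays s ''u'' 0 + arrays s ''u'' 1 * sgn_change (?P * ?R)"
  have u0: "u0 - arrays s ''u'' 1 * cauchy_index ?P ?R = I0"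
    unfolding u0_def cauchy_index_swap[OF P(4) R(4), symmetric] I0[symmetric] by (simp add: algebra_simps)
  define s1 where "s1 = s\<lparr>arrays := (arrays s)(''y'' := (arrays s ''y'')(0 := ?y),
      ''u'' := (arrays s ''u'')(0 := u0, 1 := - arrays s ''u'' 1))\<rparr>"
  let ?Q = "\<lambda>t. euclid_inv M I0 t \<and> euclid_measure t < euclid_measure s"
  let ?c3 = "Seq (IAssign ''lc'' (IVar ''la'')) (Seq (IAssign ''la'' (IVar ''lb'')) (IAssign ''lb'' (IVar ''lc'')))"
  let ?c2 = "Seq (rcopy ''B'' ''T'' (IVar ''la'')) ?c3"
  let ?c1 = "Seq (rcopy ''A'' ''B'' (IVar ''lb'')) ?c2"
  let ?c0 = "Seq (rcopy ''T'' ''A'' (IVar ''la'')) ?c1"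
  \<comment> \<open>Exchanging \<open>A\<close> and \<open>B\<close> by way of \<open>T\<close> is
    mere copying and costs nothing.\<close>
  have copies: "spec ?c0 s1 0 ?Q"
  proof (rule spec_Seq[where ?B1.0 = 0 and ?B2.0 = 0])
    show "spec (rcopy ''T'' ''A'' (IVar ''la'')) s1 0 (\<lambda>u. \<forall>i<?la. arrays u ''T'' i = arrays s1 ''A'' i)"
      by (rule spec_rcopy) (auto simp: same_def s1_def)
  next
    fix s2 assume 2: "\<forall>i<?la. arrays s2 ''T'' i = arrays s1 ''A'' i"
      "same (iwrites (rcopy ''T'' ''A'' (IVar ''la''))) (awrites (rcopy ''T'' ''A'' (IVar ''la''))) s1 s2"
    show "spec ?c1 s2 0 ?Q"
    proof (rule spec_Seq[where ?B1.0 = 0 and ?B2.0 = 0])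
      show "spec (rcopy ''A'' ''B'' (IVar ''lb'')) s2 0 (\<lambda>u. \<forall>i<?lb. arrays u ''A'' i = arrays s2 ''B'' i)"
        by (rule spec_rcopy) (use 2 in \<open>auto simp: same_def s1_def\<close>)
    next
      fix s3 assume 3: "\<forall>i<?lb. arrays s3 ''A'' i = arrays s2 ''B'' i"
        "same (iwrites (rcopy ''A'' ''B'' (IVar ''lb''))) (awrites (rcopy ''A'' ''B'' (IVar ''lb''))) s2 s3"
      show "spec ?c2 s3 0 ?Q"
      proof (rule spec_Seq[where ?B1.0 = 0 and ?B2.0 = 0])
        show "spec (rcopy ''B'' ''T'' (IVar ''la'')) s3 0 (\<lambda>u. \<forall>i<?la. arrays u ''B'' i = arrays s3 ''T'' i)"
          by (rule spec_rcopy) (use 2 3 in \<open>auto simp: same_def s1_def\<close>)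
      next
        fix s4 assume 4: "\<forall>i<?la. arrays s4 ''B'' i = arrays s3 ''T'' i"
          "same (iwrites (rcopy ''B'' ''T'' (IVar ''la''))) (awrites (rcopy ''B'' ''T'' (IVar ''la''))) s3 s4"
        have B: "coeffs_poly (arrays s4 ''B'') ?la = ?P"
          using 2 3 4 by (intro coeffs_poly_cong) (simp add: same_def s1_def)
        have A: "coeffs_poly (arrays s4 ''A'') ?lb = ?R"
          using 2 3 4 by (intro coeffs_poly_cong) (simp add: same_def s1_def)
        have iv: "ivars s4 ''la'' = ?la" "ivars s4 ''lb'' = ?lb"
          "arrays s4 ''u'' 0 = u0" "arrays s4 ''u'' 1 = - arrays s ''u'' 1"
          using 2 3 4 by (simp_all add: same_def s1_def)
        show "spec ?c3 s4 0 ?Q"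
          using A B iv lens M la u0 by (simp add: euclid_inv_def euclid_measure_def)
      qed simp
    qed simp
  qed simp
  have y0: "?y \<noteq> 0" using P(3) R(3) by simp
  have sgM: "arrays s ''sg'' (?la - 1 + (?lb - 1)) = (-1) ^ (?la - 1 + (?lb - 1))"
    using M la by (intro sg) simp
  define par where "par \<longleftrightarrow> odd (?la - 1 + (?lb - 1))"
  have neg: "arrays s ''sg'' (?la - Suc 0 + (?lb - Suc 0)) < 0 \<longleftrightarrow> par"
    using sgM unfolding par_def by (cases "odd (?la - 1 + (?lb - 1))") simp_all
  note chg' = chg[folded par_def]
  have final: "spec ?c0 s1 b ?Q" for b
    by (rule spec_mono[OF copies]) auto
  show ?thesis
  proof (cases "par")
    case False
    then have "u0 = arrays s ''u'' 0" by (simp add: u0_def chg')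
    note * = final[unfolded s1_def this]
    show ?thesis unfolding swap_step_def using * neg False by simp
  next
    case True
    show ?thesis
    proof (cases "?y > 0")
      case True
      then have "u0 = arrays s ''u'' 0 + arrays s ''u'' 1"
        unfolding u0_def chg' using \<open>par\<close> by simp
      note * = final[unfolded s1_def this]
      show ?thesis unfolding swap_step_def using * neg \<open>par\<close> True by simp
    next
      case False
      then have "?y < 0" using y0 by linarith
      then have "u0 = arrays s ''u'' 0 - arrays s ''u'' 1"
        unfolding u0_def chg' using \<open>par\<close> by simp
      note * = final[unfolded s1_def this]
      show ?thesis unfolding swap_step_def using * neg \<open>par\<close> False by simp
    qed
  qed
qed

text \<open>Subtracting a monomial multiple of \<open>B\<close> keeps the index by
  \<open>cauchy_index_diff_mult\<close>; with the quotient of the leading coefficients as factor,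
  the top coefficient of \<open>A\<close> vanishes.\<close>

lemma spec_reduce_step:
  assumes inv: "euclid_inv M I0 s" and la: "0 < ivars s ''la''" "\<not> ivars s ''la'' < ivars s ''lb''"
  shows "spec reduce_step s (3 * M + 1) (\<lambda>t. euclid_inv M I0 t \<and> euclid_measure t < euclid_measure s)"
proof -
  let ?la = "ivars s ''la''" and ?lb = "ivars s ''lb''"
  let ?P = "polyA s" and ?R = "polyB s"
  have lens: "?la = poly_len ?P" "?lb = poly_len ?R" and M: "?la + ?lb \<le> M" and lb: "0 < ?lb"
    and I0: "arrays s ''u'' 0 + arrays s ''u'' 1 * cauchy_index ?R ?P = I0"
    using inv la by (auto simp: euclid_inv_def)
  note P = lead_coeff_coeffs_poly[OF lens(1) la(1)] and R = lead_coeff_coeffs_poly[OF lens(2) lb]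
  define d where "d = arrays s ''A'' (?la - 1) / arrays s ''B'' (?lb - 1)"
  define s1 where "s1 = s\<lparr>arrays := (arrays s)(''y'' := (arrays s ''y'')(0 := d))\<rparr>"
  define a' where "a' k = arrays s ''A'' k - (if ?la - ?lb \<le> k \<and> k < ?la then d * arrays s ''B'' (k - (?la - ?lb)) else 0)" for k
  have P': "coeffs_poly a' ?la = ?P - monom d (?la - ?lb) * ?R"
    using la(2) by (intro poly_eqI) (auto simp: a'_def coeff_monom_mult)
  have top: "a' (?la - 1) = 0"
  proof -
    have "?la - 1 - (?la - ?lb) = ?lb - 1" using la lb by simp
    then show ?thesis using R(3) la lb by (simp add: a'_def d_def)
  qed
  have "poly_len (coeffs_poly a' ?la) = poly_len (coeffs_poly a' (?la - 1))"
    using poly_len_coeffs_poly_Suc[of a' "?la - 1"] top la(1) by simp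
  then have less: "poly_len (coeffs_poly a' ?la) < ?la"
    using poly_len_coeffs_poly_le[of a' "?la - 1"] la(1) by linarith
  let ?Q = "\<lambda>t. euclid_inv M I0 t \<and> euclid_measure t < euclid_measure s"
  let ?f = "For ''ri'' (IVar ''lb'') (RAssign ''A'' (IAdd (ISub (IVar ''la'') (IVar ''lb'')) (IVar ''ri''))
       (RSub (RCell ''A'' (IAdd (ISub (IVar ''la'') (IVar ''lb'')) (IVar ''ri'')))
         (RMul (RCell ''y'' (INum 0)) (RCell ''B'' (IVar ''ri'')))))"
  let ?g = "Seq (rlen ''lc'' ''A'' (IVar ''la'')) (IAssign ''la'' (IVar ''lc''))"
  have "spec (Seq ?f ?g) s1 (3 * M) ?Q"
  proof (rule spec_Seq[where ?B1.0 = "?lb * 2" and ?B2.0 = ?la and R = "\<lambda>t. \<forall>k<?la. arrays t ''A'' k = a' k"],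
      goal_cases)
    case 1
    show ?case
    proof (rule spec_For[where I = "\<lambda>i t. \<forall>k<?la. arrays t ''A'' k = arrays s ''A'' k -
        (if ?la - ?lb \<le> k \<and> k < ?la - ?lb + i then d * arrays s ''B'' (k - (?la - ?lb)) else 0)"
        and B = 2 and H = ?lb], goal_cases)
      case (4 i t)
      have "ivars t ''la'' = ?la" "ivars t ''lb'' = ?lb" "arrays t ''y'' 0 = d" "arrays t ''B'' = arrays s ''B''"
        using 4(2) by (simp_all add: same_def s1_def)
      then show ?case using 4 la by (auto simp: less_Suc_eq)
    next
      case (5 t)
      then show ?case using la by (auto simp: a'_def)
    qed (auto simp: same_def s1_def)
  next
    case (2 t)
    have t: "ivars t ''la'' = ?la" "ivars t ''lb'' = ?lb" "arrays t ''B'' = arrays s ''B''" "arrays t ''u'' = arrays s ''u''"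
      using 2(2) by (simp_all add: same_def s1_def)
    have At: "coeffs_poly (arrays t ''A'') ?la = coeffs_poly a' ?la"
      using 2(1) by (intro coeffs_poly_cong) simp
    show ?case
    proof (rule spec_Seq[where ?B1.0 = ?la and ?B2.0 = 0
          and R = "\<lambda>u. ivars u ''lc'' = poly_len (coeffs_poly (arrays t ''A'') ?la)"], goal_cases)
      case 1
      show ?case by (rule spec_rlen) (use t in \<open>auto simp: same_def\<close>)
    next
      case (2 u)
      have u: "ivars u ''la'' = ?la" "ivars u ''lb'' = ?lb" "arrays u = arrays t"
        using 2(2) t by (auto simp: same_def)
      let ?l = "poly_len (coeffs_poly a' ?la)"
      have "coeffs_poly (arrays t ''A'') ?l = coeffs_poly a' ?la"
        using coeffs_poly_poly_len[of "arrays t ''A''" ?la ?l] At less by simp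
      moreover have "cauchy_index ?R (coeffs_poly a' ?la) = cauchy_index ?R ?P"
        unfolding P' by (rule cauchy_index_diff_mult[OF R(4)])
      ultimately show ?case
        using 2(1) u t At lens lb I0 less M la
        by (simp add: euclid_inv_def euclid_measure_def)
    qed simp
  qed (use M in simp)
  then show ?thesis
    unfolding reduce_step_def using R(3) by (simp add: s1_def d_def)
qed

text \<open>At the end \<open>A\<close> is zero, so the remaining index is zero and
  \<open>u 0\<close> holds all of it. The hypothesis \<open>ne\<close> excludes a zero
  \<open>B\<close> with nonzero \<open>A\<close>, for which there is no leading coefficient to
  divide by.\<close>

lemma spec_euclid:
  assumes lens: "\<And>u. same {''la'', ''lb'', ''lc'', ''zi'', ''ri'', ''pi'', ''it''} {''A'', ''B'', ''T'', ''u'', ''y''} s u \<Longrightarrow>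
      ival lA u = nA \<and> ival lB u = nB"
    and ne: "coeffs_poly (arrays s ''A'') nA = 0 \<or> coeffs_poly (arrays s ''B'') nB \<noteq> 0"
    and sg: "\<And>i. i < nA + nB \<Longrightarrow> arrays s ''sg'' i = (-1) ^ i"
    and B: "(nA + nB) + (2 * (nA + nB) + 2) * (3 * (nA + nB) + 5) \<le> B"
  shows "spec (euclid lA lB) s B (\<lambda>u. arrays u ''u'' 0 =
    cauchy_index (coeffs_poly (arrays s ''B'') nB) (coeffs_poly (arrays s ''A'') nA))"
proof -
  let ?P = "coeffs_poly (arrays s ''A'') nA" and ?R = "coeffs_poly (arrays s ''B'') nB"
  let ?M = "nA + nB"
  let ?S = "same {''la'', ''lb'', ''lc'', ''zi'', ''ri'', ''pi'', ''it''} {''A'', ''B'', ''T'', ''u'', ''y''}"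
  let ?Q = "\<lambda>u. arrays u ''u'' 0 = cauchy_index ?R ?P"
  define I0 where "I0 = cauchy_index ?R ?P"
  show ?thesis
    unfolding euclid_def
  proof (rule spec_Seq[where ?B1.0 = nA and ?B2.0 = "nB + (2 * ?M + 2) * (3 * ?M + 5)"
        and R = "\<lambda>u. ivars u ''la'' = poly_len ?P"], goal_cases)
    case 1
    show ?case
      by (rule spec_rlen) (use lens in \<open>auto intro: same_mono\<close>)
  next
    case (2 s1)
    have s1: "?S s s1" by (rule same_mono[OF 2(2)]) auto
    have ar1: "arrays s1 = arrays s" using 2(2) by (auto simp: same_def)
    show ?case
    proof (rule spec_Seq[where ?B1.0 = nB and ?B2.0 = "(2 * ?M + 2) * (3 * ?M + 5)"
        and R = "\<lambda>u. ivars u ''lb'' = poly_len ?R"], goal_cases)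
      case 1
      have "ival lB u = nB" if "same {''lb'', ''pi''} {} s1 u" for u
      proof -
        have "?S s1 u" by (rule same_mono[OF that]) auto
        then show ?thesis using lens same_trans[OF s1] by blast
      qed
      then show ?case
        unfolding ar1[symmetric] by (intro spec_rlen) auto
    next
      case (2 s2)
      have s2: "?S s s2" by (rule same_trans[OF s1 same_mono[OF 2(2)]]) auto
      have ar2: "arrays s2 = arrays s" using 2(2) ar1 by (auto simp: same_def)
      have la2: "ivars s2 ''la'' = poly_len ?P" using 2(2) \<open>ivars s1 ''la'' = poly_len ?P\<close> by (simp add: same_def)
      note lb2 = 2(1)
      define s3 where "s3 = s2\<lparr>arrays := (arrays s2)(''u'' := (arrays s2 ''u'')(0 := 0, 1 := 1))\<rparr>"
      have s23: "?S s2 s3" by (auto simp: s3_def same_def)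
      have polys: "polyA s3 = ?P" "polyB s3 = ?R"
        using coeffs_poly_poly_len[of "arrays s ''A''" nA "poly_len ?P"]
          coeffs_poly_poly_len[of "arrays s ''B''" nB "poly_len ?R"] la2 lb2 poly_len_coeffs_poly_le
        by (simp_all add: s3_def ar2)
      have inv3: "euclid_inv ?M I0 s3"
        using polys la2 lb2 ne poly_len_coeffs_poly_le[of "arrays s ''A''" nA]
          poly_len_coeffs_poly_le[of "arrays s ''B''" nB]
        by (auto simp: euclid_inv_def s3_def I0_def poly_len_def)
      have "spec (For ''it'' (IAdd (IMul (INum 2) (IAdd lA lB)) (INum 2)) euclid_step) s3
          ((2 * ?M + 2) * (3 * ?M + 5)) ?Q"
      \<comment> \<open>Each round lowers the measure until \<open>A\<close> is zero, so after
        \<open>2 * ?M + 2\<close> rounds the second alternative is impossible.\<close>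
      proof (rule spec_For[where I = "\<lambda>i t. euclid_inv ?M I0 t \<and> (ivars t ''la'' = 0 \<or> i + euclid_measure t \<le> 2 * ?M + 1)"
          and B = "3 * ?M + 5" and H = "2 * ?M + 2"], goal_cases)
        case (2 t)
        have "?S s3 t" by (rule same_mono[OF 2]) auto
        then have "?S s t" using same_trans[OF s2 same_trans[OF s23]] by blast
        then show ?case using lens by simp
      next
        case 3
        show ?case using inv3 by (auto simp: euclid_inv_def euclid_measure_def)
      next
        case (4 i t)
        have sgt: "arrays t ''sg'' i = (-1) ^ i" if "i < ?M" for i
          using 4(2) sg[OF that] by (simp add: same_def s3_def ar2)
        let ?post = "\<lambda>u. euclid_inv ?M I0 (u\<lparr>ivars := (ivars u)(''it'' := Suc i)\<rparr>) \<and>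
          (ivars (u\<lparr>ivars := (ivars u)(''it'' := Suc i)\<rparr>) ''la'' = 0 \<or>
           Suc i + euclid_measure (u\<lparr>ivars := (ivars u)(''it'' := Suc i)\<rparr>) \<le> 2 * ?M + 1)"
        have eqs: "euclid_inv ?M I0 (u\<lparr>ivars := (ivars u)(''it'' := x)\<rparr>) = euclid_inv ?M I0 u"
          "euclid_measure (u\<lparr>ivars := (ivars u)(''it'' := x)\<rparr>) = euclid_measure u" for u x
          by (simp_all add: euclid_inv_def euclid_measure_def)
        show ?case
        proof (cases "ivars t ''la'' = 0")
          case True
          then show ?thesis unfolding euclid_step_def using 4(4) by (simp add: eqs)
        next
          case False
          then have le: "i + euclid_measure t \<le> 2 * ?M + 1" using 4(4) by simp
          have "spec swap_step t (3 * ?M + 5) ?post" if "ivars t ''la'' < ivars t ''lb''"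
            by (rule spec_mono[OF spec_swap_step[of ?M I0 t]]) (use 4(4) that False sgt le in \<open>auto simp: eqs\<close>)
          moreover have "spec reduce_step t (3 * ?M + 5) ?post" if "\<not> ivars t ''la'' < ivars t ''lb''"
            by (rule spec_mono[OF spec_reduce_step[of ?M I0 t]]) (use 4(4) that False le in \<open>auto simp: eqs\<close>)
          ultimately show ?thesis unfolding euclid_step_def using False by simp
        qed
      next
        case (5 t)
        then have "ivars t ''la'' = 0" by auto
        then show ?case using 5(3) by (simp add: euclid_inv_def I0_def)
      qed auto
      then show ?case by (simp add: s3_def)
    qed (simp add: algebra_simps)
  qed (use B in simp)
qed

section \<open>The nonnegativity test\<close>

definition fail :: com where
  "fail = IAssign ''ok'' (INum 0)"

lemma writes_fail [simp]: "iwrites fail = {''ok''}" "awrites fail = {}"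
  by (simp_all add: fail_def)

text \<open>\<open>D\<close>, \<open>E\<close>, \<open>F\<close> and \<open>G\<close> receive the
  coefficients of \<open>f'\<close>, \<open>f''\<close>, \<open>f'' f\<close> and
  \<open>f'' f^2\<close>; the two runs of \<open>euclid\<close> compute the indices compared in
  \<open>poly_nonneg_iff\<close>. All lengths are at most \<open>3 K\<close>, which keeps the cost
  quadratic.\<close>

definition critical_value_test :: com where
  "critical_value_test =
    Seq (rderiv ''D'' ''f'' (ISub (IVar ''K'') (INum 1)))
    (Seq (rderiv ''E'' ''D'' (ISub (IVar ''K'') (INum 2)))
    (Seq (pmul ''F'' (IMul (INum 2) (IVar ''K'')) ''E'' (ISub (IVar ''K'') (INum 2)) ''f'' (IVar ''K''))
    (Seq (pmul ''G'' (IMul (INum 3) (IVar ''K'')) ''F'' (IMul (INum 2) (IVar ''K'')) ''f'' (IVar ''K''))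
    (Seq (rcopy ''A'' ''F'' (IMul (INum 2) (IVar ''K'')))
    (Seq (rcopy ''B'' ''D'' (ISub (IVar ''K'') (INum 1)))
    (Seq (euclid (IMul (INum 2) (IVar ''K'')) (ISub (IVar ''K'') (INum 1)))
    (Seq (RAssign ''v'' (INum 0) (RCell ''u'' (INum 0)))
    (Seq (rcopy ''A'' ''G'' (IMul (INum 3) (IVar ''K'')))
    (Seq (rcopy ''B'' ''D'' (ISub (IVar ''K'') (INum 1)))
    (Seq (euclid (IMul (INum 3) (IVar ''K'')) (ISub (IVar ''K'') (INum 1)))
    (If (REq (RCell ''v'' (INum 0)) (RCell ''u'' (INum 0))) Skip fail)))))))))))"

text \<open>The zero polynomial has no leading coefficient and passes untested. A failed sign test
  only clears the flag; the remaining tests are still run.\<close>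

definition nonneg_test :: com where
  "nonneg_test =
    Seq (rlen ''lf'' ''f'' (IVar ''K''))
    (If (ILess (INum 0) (IVar ''lf''))
      (Seq (If (RLess (RNum 0) (RCell ''f'' (ISub (IVar ''lf'') (INum 1)))) Skip fail)
      (Seq (If (RLess (RCell ''sg'' (ISub (IVar ''lf'') (INum 1))) (RNum 0)) fail Skip)
      critical_value_test))
      Skip)"

definition nonneg_ivars :: "string set" where
  "nonneg_ivars = {''lf'', ''ok'', ''di'', ''zi'', ''ma'', ''mb'', ''la'', ''lb'', ''lc'', ''ri'', ''pi'', ''it''}"

definition nonneg_arrays :: "string set" where
  "nonneg_arrays = {''D'', ''E'', ''F'', ''G'', ''A'', ''B'', ''T'', ''u'', ''y'', ''v''}"

lemma writes_nonneg_test [simp]: "iwrites nonneg_test = nonneg_ivars" "awrites nonneg_test = nonneg_arrays"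
  by (auto simp: nonneg_test_def critical_value_test_def nonneg_ivars_def nonneg_arrays_def)

lemma spec_chain:
  assumes "spec c s B1 R" "\<And>t. R t \<Longrightarrow> spec d t B2 Q"
  shows "spec (Seq c d) s (B1 + B2) Q"
  using assms(1) by (rule spec_Seq) (use assms(2) in auto)

text \<open>\<open>M\<close> is the total length of the two polynomials, at most
  \<open>3 K + (K - 1)\<close>; the constant is \<open>10 * 17 + 4\<close>.\<close>

lemma euclid_cost:
  assumes "M \<le> 4 * (K::nat)" "1 \<le> K"
  shows "M + (2 * M + 2) * (3 * M + 5) \<le> 174 * K * K"
proof -
  have "(2 * M + 2) * (3 * M + 5) \<le> (10 * K) * (17 * K)" using assms by (intro mult_mono) auto
  moreover have "M \<le> 4 * K * K" using assms by (metis le_trans mult.right_neutral mult_le_mono2)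
  ultimately show ?thesis by simp
qed

lemma spec_critical_value_test:
  assumes K: "ivars s ''K'' = K" "2 \<le> K"
    and c: "\<And>i. i \<le> K \<Longrightarrow> arrays s ''c'' i = real i"
    and sg: "\<And>i. i < 4 * K \<Longrightarrow> arrays s ''sg'' i = (-1) ^ i"
  defines "F \<equiv> coeffs_poly (arrays s ''f'') K"
  shows "spec critical_value_test s (360 * K * K) (\<lambda>u. ivars u ''ok'' =
    (if cauchy_index (pderiv F) (pderiv (pderiv F) * F) = cauchy_index (pderiv F) (pderiv (pderiv F) * (F * F))
     then ivars s ''ok'' else 0))"
proof -
  let ?D = "pderiv F" and ?E = "pderiv (pderiv F)"
  define J where "J u \<longleftrightarrow> ivars u ''K'' = K \<and> arrays u ''f'' = arrays s ''f'' \<and>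
    arrays u ''c'' = arrays s ''c'' \<and> arrays u ''sg'' = arrays s ''sg'' \<and> ivars u ''ok'' = ivars s ''ok''" for u :: state
  have J: "J u" if "J t" "same X Y t u" "''K'' \<notin> X" "''ok'' \<notin> X" "''f'' \<notin> Y" "''c'' \<notin> Y" "''sg'' \<notin> Y" for t u X Y
    using that by (simp add: J_def same_def)
  \<comment> \<open>These predicates record what has been computed at each stage, and
    \<open>J\<close> records the data that no stage touches.\<close>
  define RD where "RD u \<longleftrightarrow> J u \<and> coeffs_poly (arrays u ''D'') (K - 1) = ?D" for u :: state
  define RE where "RE u \<longleftrightarrow> RD u \<and> coeffs_poly (arrays u ''E'') (K - 2) = ?E" for u :: state
  define RF where "RF u \<longleftrightarrow> RD u \<and> coeffs_poly (arrays u ''F'') (2 * K) = ?E * F" for u :: state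
  define RG where "RG u \<longleftrightarrow> RF u \<and> coeffs_poly (arrays u ''G'') (3 * K) = ?E * (F * F)" for u :: state
  define RA where "RA u \<longleftrightarrow> RG u \<and> coeffs_poly (arrays u ''A'') (2 * K) = ?E * F" for u :: state
  define RB where "RB u \<longleftrightarrow> RA u \<and> coeffs_poly (arrays u ''B'') (K - 1) = ?D" for u :: state
  define RU where "RU u \<longleftrightarrow> RG u \<and> arrays u ''u'' 0 = cauchy_index ?D (?E * F)" for u :: state
  define RV where "RV u \<longleftrightarrow> RG u \<and> arrays u ''v'' 0 = cauchy_index ?D (?E * F)" for u :: state
  define RA' where "RA' u \<longleftrightarrow> RV u \<and> coeffs_poly (arrays u ''A'') (3 * K) = ?E * (F * F)" for u :: state
  define RB' where "RB' u \<longleftrightarrow> RA' u \<and> coeffs_poly (arrays u ''B'') (K - 1) = ?D" for u :: state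
  define RU' where "RU' u \<longleftrightarrow> RV u \<and> arrays u ''u'' 0 = cauchy_index ?D (?E * (F * F))" for u :: state
  note defs = RD_def RE_def RF_def RG_def RA_def RB_def RU_def RV_def RA'_def RB'_def RU'_def
  have KK: "Suc (K - Suc 0) = K" "Suc (K - 2) = K - Suc 0" using K by auto
  have s1: "spec (rderiv ''D'' ''f'' (ISub (IVar ''K'') (INum 1))) s K RD"
  proof (rule spec_mono[OF spec_rderiv[where n = "K - 1" and B = K] order_refl], goal_cases)
    case (6 u)
    have "J s" using K by (simp add: J_def)
    then have "J u" using 6(2) by (rule J) auto
    then show ?case using 6(1) by (simp add: RD_def KK F_def)
  qed (use K c in \<open>auto simp: same_def\<close>)
  have s2: "spec (rderiv ''E'' ''D'' (ISub (IVar ''K'') (INum 2))) t K RE" if t: "RD t" for t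
  proof (rule spec_mono[OF spec_rderiv[where n = "K - 2" and B = K] order_refl], goal_cases)
    case (6 u)
    then have "J u" using t by (intro J[of t _ _ u]) (auto simp: RD_def)
    then show ?case using t 6 by (simp add: RE_def RD_def KK same_def)
  qed (use K c t in \<open>auto simp: same_def RD_def J_def\<close>)
  have s3: "spec (pmul ''F'' (IMul (INum 2) (IVar ''K'')) ''E'' (ISub (IVar ''K'') (INum 2)) ''f'' (IVar ''K'')) t (2 * K * K) RF"
    if t: "RE t" for t
  proof (rule spec_mono[OF spec_pmul[where n = "2 * K" and ?n1.0 = "K - 2" and ?n2.0 = K and B = "2 * K * K"] order_refl], goal_cases)
    case (6 u)
    then have "J u" using t by (intro J[of t _ _ u]) (auto simp: RE_def RD_def)
    then show ?case using t 6 by (simp add: RE_def RF_def RD_def same_def J_def F_def)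
  qed (use K t in \<open>auto simp: same_def RE_def RD_def J_def\<close>)
  have s4: "spec (pmul ''G'' (IMul (INum 3) (IVar ''K'')) ''F'' (IMul (INum 2) (IVar ''K'')) ''f'' (IVar ''K'')) t (4 * K * K) RG"
    if t: "RF t" for t
  proof (rule spec_mono[OF spec_pmul[where n = "3 * K" and ?n1.0 = "2 * K" and ?n2.0 = K and B = "4 * K * K"] order_refl], goal_cases)
    case (6 u)
    then have "J u" using t by (intro J[of t _ _ u]) (auto simp: RF_def RD_def)
    then show ?case using t 6 by (simp add: RG_def RF_def RD_def same_def J_def F_def mult.assoc)
  qed (use K t in \<open>auto simp: same_def RF_def RD_def J_def\<close>)
  have cp: "coeffs_poly (arrays u y) n = coeffs_poly (arrays t x) n" if "\<forall>i<n. arrays u y i = arrays t x i" for u t x y n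
    using that by (intro coeffs_poly_cong) simp
  have s5: "spec (rcopy ''A'' ''F'' (IMul (INum 2) (IVar ''K''))) t 0 RA" if t: "RG t" for t
  proof (rule spec_mono[OF spec_rcopy[where n = "2 * K"] order_refl], goal_cases)
    case (3 u)
    then have "J u" using t by (intro J[of t _ _ u]) (auto simp: RG_def RF_def RD_def)
    then show ?case using t 3 cp[OF 3(1)] by (simp add: RA_def RG_def RF_def RD_def same_def)
  qed (use K t in \<open>auto simp: same_def RG_def RF_def RD_def J_def\<close>)
  have s6: "spec (rcopy ''B'' ''D'' (ISub (IVar ''K'') (INum 1))) t 0 RB" if t: "RA t" for t
  proof (rule spec_mono[OF spec_rcopy[where n = "K - 1"] order_refl], goal_cases)
    case (3 u)
    then have "J u" using t by (intro J[of t _ _ u]) (auto simp: RA_def RG_def RF_def RD_def)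
    then show ?case using t 3 cp[OF 3(1)] by (simp add: RB_def RA_def RG_def RF_def RD_def same_def)
  qed (use K t in \<open>auto simp: same_def RA_def RG_def RF_def RD_def J_def\<close>)
  have s7: "spec (euclid (IMul (INum 2) (IVar ''K'')) (ISub (IVar ''K'') (INum 1))) t (174 * K * K) RU" if t: "RB t" for t
  proof (rule spec_mono[OF spec_euclid[where nA = "2 * K" and nB = "K - 1"] order_refl], goal_cases)
    case (4) then show ?case using K by (intro euclid_cost) auto
  next
    case (5 u)
    then have "J u" using t by (intro J[of t _ _ u]) (auto simp: RB_def RA_def RG_def RF_def RD_def)
    then show ?case using t 5 by (simp add: RU_def RB_def RA_def RG_def RF_def RD_def same_def)
  next
    case 2
    then show ?case using t by (auto simp: RB_def RA_def)
  qed (use K t sg in \<open>auto simp: same_def RB_def RA_def RG_def RF_def RD_def J_def\<close>)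
  have s8: "spec (RAssign ''v'' (INum 0) (RCell ''u'' (INum 0))) t 0 RV" if t: "RU t" for t
    using t by (simp add: RV_def RU_def RG_def RF_def RD_def J_def)
  have s9: "spec (rcopy ''A'' ''G'' (IMul (INum 3) (IVar ''K''))) t 0 RA'" if t: "RV t" for t
  proof (rule spec_mono[OF spec_rcopy[where n = "3 * K"] order_refl], goal_cases)
    case (3 u)
    then have "J u" using t by (intro J[of t _ _ u]) (auto simp: RV_def RG_def RF_def RD_def)
    then show ?case using t 3 cp[OF 3(1)] by (simp add: RA'_def RV_def RG_def RF_def RD_def same_def)
  qed (use K t in \<open>auto simp: same_def RV_def RG_def RF_def RD_def J_def\<close>)
  have s10: "spec (rcopy ''B'' ''D'' (ISub (IVar ''K'') (INum 1))) t 0 RB'" if t: "RA' t" for t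
  proof (rule spec_mono[OF spec_rcopy[where n = "K - 1"] order_refl], goal_cases)
    case (3 u)
    then have "J u" using t by (intro J[of t _ _ u]) (auto simp: RA'_def RV_def RG_def RF_def RD_def)
    then show ?case using t 3 cp[OF 3(1)] by (simp add: RB'_def RA'_def RV_def RG_def RF_def RD_def same_def)
  qed (use K t in \<open>auto simp: same_def RA'_def RV_def RG_def RF_def RD_def J_def\<close>)
  have s11: "spec (euclid (IMul (INum 3) (IVar ''K'')) (ISub (IVar ''K'') (INum 1))) t (174 * K * K) RU'" if t: "RB' t" for t
  proof (rule spec_mono[OF spec_euclid[where nA = "3 * K" and nB = "K - 1"] order_refl], goal_cases)
    case (4) then show ?case using K by (intro euclid_cost) auto
  next
    case (5 u)
    then have "J u" using t by (intro J[of t _ _ u]) (auto simp: RB'_def RA'_def RV_def RG_def RF_def RD_def)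
    then show ?case using t 5 by (simp add: RU'_def RB'_def RA'_def RV_def RG_def RF_def RD_def same_def)
  next
    case 2
    then show ?case using t by (auto simp: RB'_def RA'_def)
  qed (use K t sg in \<open>auto simp: same_def RB'_def RA'_def RV_def RG_def RF_def RD_def J_def\<close>)
  let ?Q = "\<lambda>u. ivars u ''ok'' = (if cauchy_index ?D (?E * F) = cauchy_index ?D (?E * (F * F)) then ivars s ''ok'' else 0)"
  have s12: "spec (If (REq (RCell ''v'' (INum 0)) (RCell ''u'' (INum 0))) Skip fail) t 1 ?Q" if t: "RU' t" for t
    using t by (simp add: RU'_def RV_def RG_def RF_def RD_def J_def fail_def)
  have "spec critical_value_test s
      (K + (K + (2 * K * K + (4 * K * K + (0 + (0 + (174 * K * K + (0 + (0 + (0 + (174 * K * K + 1))))))))))) ?Q"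
    unfolding critical_value_test_def
    by (rule spec_chain[OF s1], rule spec_chain[OF s2], assumption, rule spec_chain[OF s3], assumption,
        rule spec_chain[OF s4], assumption, rule spec_chain[OF s5], assumption,
        rule spec_chain[OF s6], assumption, rule spec_chain[OF s7], assumption,
        rule spec_chain[OF s8], assumption, rule spec_chain[OF s9], assumption,
        rule spec_chain[OF s10], assumption, rule spec_chain[OF s11], assumption, rule s12, assumption)
  moreover have "K + (K + (2 * K * K + (4 * K * K + (0 + (0 + (174 * K * K + (0 + (0 + (0 + (174 * K * K + 1)))))))))) \<le> 360 * K * K"
  proof -
    define q where "q = K * K"
    have "K \<le> q" "1 \<le> q" using K(2) by (auto simp: q_def)
    then show ?thesis by (simp add: mult.assoc flip: q_def)
  qed
  ultimately show ?thesis by (rule spec_mono)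
qed

lemma spec_nonneg_test:
  assumes K: "ivars s ''K'' = K" "2 \<le> K"
    and c: "\<And>i. i \<le> K \<Longrightarrow> arrays s ''c'' i = real i"
    and sg: "\<And>i. i < 4 * K \<Longrightarrow> arrays s ''sg'' i = (-1) ^ i"
  shows "spec nonneg_test s (400 * K * K) (\<lambda>u. ivars u ''ok'' =
    (if \<forall>x. poly (coeffs_poly (arrays s ''f'') K) x \<ge> 0 then ivars s ''ok'' else 0))"
proof -
  let ?F = "coeffs_poly (arrays s ''f'') K"
  let ?Q = "\<lambda>u. ivars u ''ok'' = (if \<forall>x. poly ?F x \<ge> 0 then ivars s ''ok'' else 0)"
  have KK: "K + (2 + 360 * K * K) \<le> 400 * K * K"
  proof -
    define q where "q = K * K"
    have "K \<le> q" "1 \<le> q" using K(2) by (auto simp: q_def)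
    then show ?thesis by (simp add: mult.assoc flip: q_def)
  qed
  show ?thesis
    unfolding nonneg_test_def
  proof (rule spec_Seq[where ?B1.0 = K and ?B2.0 = "2 + 360 * K * K" and R = "\<lambda>u. ivars u ''lf'' = poly_len ?F"],
      goal_cases)
    case 1
    show ?case by (rule spec_rlen) (use K in \<open>auto simp: same_def\<close>)
  next
    case (2 s1)
    have s1: "arrays s1 = arrays s" "ivars s1 ''K'' = K" "ivars s1 ''ok'' = ivars s ''ok''"
      using 2(2) K by (auto simp: same_def)
    show ?case
    proof (cases "?F = 0")
      case True
      then show ?thesis using 2(1) s1 by simp
    next
      case False
      then have lf: "ivars s1 ''lf'' = Suc (degree ?F)" using 2(1) by (simp add: poly_len_def)
      have dK: "degree ?F < K" using degree_coeffs_poly[of "arrays s ''f''" K] False by simp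
      have lead: "arrays s ''f'' (degree ?F) = lead_coeff ?F" using dK by simp
      have odd: "arrays s ''sg'' (degree ?F) < 0 \<longleftrightarrow> odd (degree ?F)"
        using sg[of "degree ?F"] dK by (cases "even (degree ?F)") auto
      \<comment> \<open>For constant \<open>?F\<close> both second arguments are zero and so are the
        indices, which then agree.\<close>
      have F: "(\<forall>x. poly ?F x \<ge> 0) \<longleftrightarrow> lead_coeff ?F > 0 \<and> even (degree ?F) \<and>
          cauchy_index (pderiv ?F) (pderiv (pderiv ?F) * ?F) = cauchy_index (pderiv ?F) (pderiv (pderiv ?F) * (?F * ?F))"
        using poly_nonneg_iff[OF False] by (cases "pderiv ?F = 0") auto
      have crit: "spec critical_value_test t b (\<lambda>u. ivars u ''ok'' =
          (if cauchy_index (pderiv ?F) (pderiv (pderiv ?F) * ?F) = cauchy_index (pderiv ?F) (pderiv (pderiv ?F) * (?F * ?F))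
           then ivars t ''ok'' else 0))"
        if "arrays t = arrays s" "ivars t ''K'' = K" "360 * K * K \<le> b" for t b
        using spec_mono[OF spec_critical_value_test[of t K] that(3)] that(1,2) K(2) c sg by simp
      let ?t = "s1\<lparr>ivars := (ivars s1)(''ok'' := 0)\<rparr>"
      \<comment> \<open>After a failed sign test the flag is already 0, and the later test either
        keeps it or sets it to 0 again.\<close>
      have bad: "spec critical_value_test t b ?Q"
        if "arrays t = arrays s" "ivars t ''K'' = K" "ivars t ''ok'' = 0" "\<not> (lead_coeff ?F > 0 \<and> even (degree ?F))" "360 * K * K \<le> b" for t b
        by (rule spec_mono[OF crit[OF that(1,2,5)] order_refl]) (use that F in auto)
      have good: "spec critical_value_test s1 b ?Q"
        if "lead_coeff ?F > 0" "even (degree ?F)" "360 * K * K \<le> b" for b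
        by (rule spec_mono[OF crit[OF s1(1,2) that(3)] order_refl]) (use that F s1 in auto)
      show ?thesis
        using lf s1 odd lead bad[of ?t] bad[of "?t\<lparr>ivars := (ivars ?t)(''ok'' := 0)\<rparr>"] good
        by (simp add: fail_def)
    qed
  qed (rule KK)
qed

section \<open>Interpolation\<close>

text \<open>One step of Newton interpolation: \<open>w\<close> is the product of
  \<open>x - i\<close> over the nodes already treated, so adding a multiple of it corrects the value
  at the next node without disturbing the earlier ones.\<close>

definition interp_step :: com where
  "interp_step =
    Seq (reval ''h'' ''f'' (IVar ''K'') (RCell ''c'' (IVar ''ij'')))
    (Seq (reval ''hw'' ''w'' (IAdd (IVar ''K'') (INum 1)) (RCell ''c'' (IVar ''ij'')))
    (Seq (RAssign ''h'' (INum 0) (RDiv (RSub (RCell ''V'' (IAdd (IMul (IVar ''k'') (IVar ''K'')) (IVar ''ij'')))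
        (RCell ''h'' (INum 0))) (RCell ''hw'' (INum 0))))
    (Seq (For ''ik'' (IVar ''K'') (RAssign ''f'' (IVar ''ik'')
        (RAdd (RCell ''f'' (IVar ''ik'')) (RMul (RCell ''h'' (INum 0)) (RCell ''w'' (IVar ''ik''))))))
    (Seq (RAssign ''z'' (INum 0) (RSub (RNum 0) (RCell ''c'' (IVar ''ij''))))
    (Seq (RAssign ''z'' (INum 1) (RNum 1))
    (Seq (pmul ''T'' (IAdd (IVar ''K'') (INum 2)) ''w'' (IAdd (IVar ''K'') (INum 1)) ''z'' (INum 2))
    (rcopy ''w'' ''T'' (IAdd (IVar ''K'') (INum 1)))))))))"

definition interp :: com where
  "interp = Seq (rzero ''f'' (IVar ''K'')) (Seq (rzero ''w'' (IAdd (IVar ''K'') (INum 1)))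
    (Seq (RAssign ''w'' (INum 0) (RNum 1)) (For ''ij'' (IVar ''K'') interp_step)))"

lemma writes_interp_step [simp]:
  "iwrites interp_step = {''ei'', ''ik'', ''zi'', ''ma'', ''mb''}"
  "awrites interp_step = {''h'', ''hw'', ''f'', ''z'', ''T'', ''w''}"
  by (auto simp: interp_step_def)

lemma writes_interp [simp]:
  "iwrites interp = {''ei'', ''ik'', ''zi'', ''ma'', ''mb'', ''ij''}"
  "awrites interp = {''h'', ''hw'', ''f'', ''z'', ''T'', ''w''}"
  by (auto simp: interp_def)

definition nodes :: "nat \<Rightarrow> real poly" where
  "nodes j = (\<Prod>i<j. [:- real i, 1:])"

lemma nodes_Suc: "nodes (Suc j) = nodes j * [:- real j, 1:]"
  by (simp add: nodes_def mult.commute)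

lemma degree_nodes: "degree (nodes j) = j"
  unfolding nodes_def by (subst degree_prod_eq_sum_degree) auto

lemma poly_nodes_eq_0_iff: "poly (nodes j) (real i) = 0 \<longleftrightarrow> i < j"
  by (auto simp: nodes_def poly_prod)

lemma spec_interp_step:
  assumes K: "ivars s ''K'' = K" "ivars s ''ij'' = j" "j < K" "arrays s ''c'' j = real j"
    and w: "coeffs_poly (arrays s ''w'') (Suc K) = nodes j"
  defines "y \<equiv> arrays s ''V'' (ivars s ''k'' * K + j)"
  defines "F \<equiv> coeffs_poly (arrays s ''f'') K"
  shows "spec interp_step s (22 * K) (\<lambda>u. coeffs_poly (arrays u ''w'') (Suc K) = nodes (Suc j) \<and>
    coeffs_poly (arrays u ''f'') K =
      F + Polynomial.smult ((y - poly F (real j)) / poly (nodes j) (real j)) (nodes j))"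
proof -
  let ?d = "(y - poly F (real j)) / poly (nodes j) (real j)"
  define J where "J u \<longleftrightarrow> ivars u ''K'' = K \<and> ivars u ''ij'' = j \<and> ivars u ''k'' = ivars s ''k'' \<and>
    arrays u ''c'' = arrays s ''c'' \<and> arrays u ''V'' = arrays s ''V''" for u :: state
  have J: "J u" if "J t" "same X Y t u" "''K'' \<notin> X" "''ij'' \<notin> X" "''k'' \<notin> X" "''c'' \<notin> Y" "''V'' \<notin> Y" for t u X Y
    using that by (simp add: J_def same_def)
  define R0 where "R0 u \<longleftrightarrow> J u \<and> coeffs_poly (arrays u ''w'') (Suc K) = nodes j" for u :: state
  define R1 where "R1 u \<longleftrightarrow> R0 u \<and> coeffs_poly (arrays u ''f'') K = F" for u :: state
  define R2 where "R2 u \<longleftrightarrow> R1 u \<and> arrays u ''h'' 0 = poly F (real j)" for u :: state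
  define R3 where "R3 u \<longleftrightarrow> R2 u \<and> arrays u ''hw'' 0 = poly (nodes j) (real j)" for u :: state
  define R4 where "R4 u \<longleftrightarrow> R1 u \<and> arrays u ''h'' 0 = ?d" for u :: state
  define R5 where "R5 u \<longleftrightarrow> R0 u \<and> coeffs_poly (arrays u ''f'') K = F + Polynomial.smult ?d (nodes j)" for u :: state
  define R6 where "R6 u \<longleftrightarrow> R5 u \<and> arrays u ''z'' 0 = - real j" for u :: state
  define R7 where "R7 u \<longleftrightarrow> R5 u \<and> coeffs_poly (arrays u ''z'') 2 = [:- real j, 1:]" for u :: state
  define R8 where "R8 u \<longleftrightarrow> R5 u \<and> coeffs_poly (arrays u ''T'') (K + 2) = nodes (Suc j)" for u :: state
  have nz: "poly (nodes j) (real j) \<noteq> 0" by (simp add: poly_nodes_eq_0_iff)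
  have R1s: "R1 s" using K w by (simp add: R1_def R0_def J_def F_def)
  have s1: "spec (reval ''h'' ''f'' (IVar ''K'') (RCell ''c'' (IVar ''ij''))) s (3 * K) R2"
  proof (rule spec_mono[OF spec_reval[where n = K and a = "real j" and B = "3 * K"] order_refl], goal_cases)
    case (5 u)
    have "J u" using R1s 5(2) by (intro J[of s _ _ u]) (auto simp: R1_def R0_def)
    then show ?case using R1s 5 by (simp add: R2_def R1_def R0_def same_def F_def)
  qed (use K in \<open>auto simp: same_def\<close>)
  have s2: "spec (reval ''hw'' ''w'' (IAdd (IVar ''K'') (INum 1)) (RCell ''c'' (IVar ''ij''))) t (3 * K + 3) R3" if t: "R2 t" for t
  proof (rule spec_mono[OF spec_reval[where n = "Suc K" and a = "real j" and B = "3 * K + 3"] order_refl], goal_cases)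
    case (5 u)
    have "J u" using t 5(2) by (intro J[of t _ _ u]) (auto simp: R2_def R1_def R0_def)
    then show ?case using t 5 by (simp add: R3_def R2_def R1_def R0_def same_def)
  qed (use K t in \<open>auto simp: same_def R2_def R1_def R0_def J_def\<close>)
  have s3: "spec (RAssign ''h'' (INum 0) (RDiv (RSub (RCell ''V'' (IAdd (IMul (IVar ''k'') (IVar ''K'')) (IVar ''ij'')))
        (RCell ''h'' (INum 0))) (RCell ''hw'' (INum 0)))) t 2 R4" if t: "R3 t" for t
    using t nz by (simp add: R4_def R3_def R2_def R1_def R0_def J_def y_def)
  have s4: "spec (For ''ik'' (IVar ''K'') (RAssign ''f'' (IVar ''ik'')
        (RAdd (RCell ''f'' (IVar ''ik'')) (RMul (RCell ''h'' (INum 0)) (RCell ''w'' (IVar ''ik'')))))) t (2 * K) R5"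
    if t: "R4 t" for t
  proof (rule spec_For[where I = "\<lambda>i u. \<forall>l<K. arrays u ''f'' l = arrays t ''f'' l + (if l < i then ?d * arrays t ''w'' l else 0)"
        and B = 2 and H = K], goal_cases)
    case (4 i u)
    have "ivars u ''K'' = K" "arrays u ''h'' = arrays t ''h''" "arrays u ''w'' = arrays t ''w''"
      using 4(2) t by (auto simp: same_def R4_def R1_def R0_def J_def)
    then show ?case using 4 t by (auto simp: R4_def less_Suc_eq)
  next
    case (5 u)
    have "J u" using t 5(1) by (intro J[of t _ _ u]) (auto simp: R4_def R1_def R0_def)
    moreover have "arrays u ''w'' = arrays t ''w''" using 5(1) by (simp add: same_def)
    moreover have "coeffs_poly (arrays u ''f'') K = F + Polynomial.smult ?d (nodes j)"
    proof (rule coeffs_poly_eqI)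
      fix l assume "l < K"
      have "coeff (coeffs_poly (arrays t ''w'') (Suc K)) l = coeff (nodes j) l"
        "coeff (coeffs_poly (arrays t ''f'') K) l = coeff F l"
        using t by (simp_all only: R4_def R1_def R0_def)
      then show "arrays u ''f'' l = coeff (F + Polynomial.smult ?d (nodes j)) l"
        using 5(3) \<open>l < K\<close> by simp
    next
      fix l assume "K \<le> l"
      then show "coeff (F + Polynomial.smult ?d (nodes j)) l = 0"
        using degree_nodes[of j] K(3) by (simp add: F_def coeff_eq_0)
    qed
    ultimately show ?case using t by (simp add: R5_def R4_def R1_def R0_def)
  qed (use t in \<open>auto simp: same_def R4_def R1_def R0_def J_def\<close>)
  have s5: "spec (RAssign ''z'' (INum 0) (RSub (RNum 0) (RCell ''c'' (IVar ''ij'')))) t 1 R6" if t: "R5 t" for t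
    using t K by (simp add: R6_def R5_def R0_def J_def)
  have s6: "spec (RAssign ''z'' (INum 1) (RNum 1)) t 0 R7" if t: "R6 t" for t
  proof -
    have "coeffs_poly ((arrays t ''z'')(Suc 0 := 1)) 2 = [:- real j, 1:]"
      using t by (intro coeffs_poly_eqI) (auto simp: R6_def less_2_cases_iff coeff_pCons split: nat.splits)
    then show ?thesis using t by (simp add: R7_def R6_def R5_def R0_def J_def)
  qed
  have s7: "spec (pmul ''T'' (IAdd (IVar ''K'') (INum 2)) ''w'' (IAdd (IVar ''K'') (INum 1)) ''z'' (INum 2)) t (4 * K + 4) R8"
    if t: "R7 t" for t
  proof (rule spec_mono[OF spec_pmul[where n = "K + 2" and ?n1.0 = "Suc K" and ?n2.0 = 2 and B = "4 * K + 4"] order_refl], goal_cases)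
    case (6 u)
    have "J u" using t 6(2) by (intro J[of t _ _ u]) (auto simp: R7_def R5_def R0_def)
    then show ?case using t 6 by (simp add: R8_def R7_def R5_def R0_def same_def nodes_Suc del: mult_pCons_right)
  qed (use K t in \<open>auto simp: same_def R7_def R5_def R0_def J_def\<close>)
  let ?Q = "\<lambda>u. coeffs_poly (arrays u ''w'') (Suc K) = nodes (Suc j) \<and>
    coeffs_poly (arrays u ''f'') K = F + Polynomial.smult ?d (nodes j)"
  \<comment> \<open>\<open>T\<close> was given \<open>K + 2\<close> cells, but the product has
    degree \<open>j + 1 \<le> K\<close>, so \<open>K + 1\<close> cells carry all of it.\<close>
  have s8: "spec (rcopy ''w'' ''T'' (IAdd (IVar ''K'') (INum 1))) t 0 ?Q" if t: "R8 t" for t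
  proof (rule spec_mono[OF spec_rcopy[where n = "Suc K"] order_refl], goal_cases)
    case (3 u)
    have "coeffs_poly (arrays u ''w'') (Suc K) = nodes (Suc j)"
    proof (rule coeffs_poly_eqI)
      fix i assume i: "i < Suc K"
      have "coeff (coeffs_poly (arrays t ''T'') (K + 2)) i = coeff (nodes (Suc j)) i"
        using t by (simp only: R8_def)
      then show "arrays u ''w'' i = coeff (nodes (Suc j)) i" using i 3(1) by simp
    next
      fix i assume "Suc K \<le> i"
      then show "coeff (nodes (Suc j)) i = 0" using degree_nodes[of "Suc j"] K(3) by (simp add: coeff_eq_0)
    qed
    then show ?case using t 3(2) by (simp add: R8_def R5_def same_def)
  qed (use K t in \<open>auto simp: same_def R8_def R5_def R0_def J_def\<close>)
  have "spec interp_step s (3 * K + ((3 * K + 3) + (2 + (2 * K + (1 + (0 + ((4 * K + 4) + 0))))))) ?Q"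
    unfolding interp_step_def
    by (rule spec_chain[OF s1], rule spec_chain[OF s2], assumption, rule spec_chain[OF s3], assumption,
        rule spec_chain[OF s4], assumption, rule spec_chain[OF s5], assumption,
        rule spec_chain[OF s6], assumption, rule spec_chain[OF s7], assumption, rule s8, assumption)
  \<comment> \<open>The costs add up to \<open>12 K + 10\<close>, and \<open>j < K\<close> gives
    \<open>K \<ge> 1\<close>.\<close>
  then show ?thesis by (rule spec_mono) (use K(3) in auto)
qed

lemma spec_interp:
  assumes K: "ivars s ''K'' = K" "1 \<le> K" and c: "\<And>i. i \<le> K \<Longrightarrow> arrays s ''c'' i = real i"
  shows "spec interp s (22 * K * K) (\<lambda>u. \<forall>j<K. poly (coeffs_poly (arrays u ''f'') K) (real j) =
    arrays s ''V'' (ivars s ''k'' * K + j))"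
proof -
  let ?V = "\<lambda>j. arrays s ''V'' (ivars s ''k'' * K + j)"
  define J where "J u \<longleftrightarrow> ivars u ''K'' = K \<and> ivars u ''k'' = ivars s ''k'' \<and>
    arrays u ''c'' = arrays s ''c'' \<and> arrays u ''V'' = arrays s ''V''" for u :: state
  have J: "J u" if "J t" "same X Y t u" "''K'' \<notin> X" "''k'' \<notin> X" "''c'' \<notin> Y" "''V'' \<notin> Y" for t u X Y
    using that by (simp add: J_def same_def)
  define R1 where "R1 u \<longleftrightarrow> J u \<and> (\<forall>i<K. arrays u ''f'' i = 0)" for u :: state
  define R2 where "R2 u \<longleftrightarrow> R1 u \<and> (\<forall>i<Suc K. arrays u ''w'' i = 0)" for u :: state
  define R3 where "R3 u \<longleftrightarrow> R1 u \<and> coeffs_poly (arrays u ''w'') (Suc K) = nodes 0" for u :: state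
  have Js: "J s" using K by (simp add: J_def)
  have s1: "spec (rzero ''f'' (IVar ''K'')) s 0 R1"
  proof (rule spec_mono[OF spec_rzero[where n = K] order_refl], goal_cases)
    case (2 u)
    have "J u" using Js 2(2) by (intro J[of s _ _ u]) auto
    then show ?case using 2 by (simp add: R1_def)
  qed (use K in \<open>auto simp: same_def\<close>)
  have s2: "spec (rzero ''w'' (IAdd (IVar ''K'') (INum 1))) t 0 R2" if t: "R1 t" for t
  proof (rule spec_mono[OF spec_rzero[where n = "Suc K"] order_refl], goal_cases)
    case (2 u)
    have "J u" using t 2(2) by (intro J[of t _ _ u]) (auto simp: R1_def)
    then show ?case using t 2 by (simp add: R2_def R1_def same_def)
  qed (use t in \<open>auto simp: same_def R1_def J_def\<close>)
  have s3: "spec (RAssign ''w'' (INum 0) (RNum 1)) t 0 R3" if t: "R2 t" for t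
  proof -
    have "coeffs_poly ((arrays t ''w'')(0 := 1)) (Suc K) = nodes 0"
      using t by (intro coeffs_poly_eqI) (auto simp: R2_def nodes_def coeff_1)
    then show ?thesis using t by (simp add: R3_def R2_def R1_def J_def)
  qed
  let ?Q = "\<lambda>u. \<forall>j<K. poly (coeffs_poly (arrays u ''f'') K) (real j) = ?V j"
  have s4: "spec (For ''ij'' (IVar ''K'') interp_step) t (22 * K * K) ?Q" if t: "R3 t" for t
  proof (rule spec_For[where I = "\<lambda>j u. coeffs_poly (arrays u ''w'') (Suc K) = nodes j \<and>
        (\<forall>i<j. poly (coeffs_poly (arrays u ''f'') K) (real i) = ?V i)" and B = "22 * K" and H = K], goal_cases)
    case (4 j u)
    have Ju: "J u" using t 4(2) by (intro J[of t _ _ u]) (auto simp: R3_def R1_def)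
    have *: "spec interp_step u (22 * K) (\<lambda>v. coeffs_poly (arrays v ''w'') (Suc K) = nodes (Suc j) \<and>
        coeffs_poly (arrays v ''f'') K = coeffs_poly (arrays u ''f'') K +
          Polynomial.smult ((?V j - poly (coeffs_poly (arrays u ''f'') K) (real j)) / poly (nodes j) (real j)) (nodes j))"
      using spec_interp_step[of u K j] Ju 4 c[of j] by (simp add: J_def)
    show ?case
    proof (rule spec_mono[OF * order_refl], goal_cases)
      case (1 v)
      have nz: "poly (nodes j) (real j) \<noteq> 0" by (simp add: poly_nodes_eq_0_iff)
      have "poly (coeffs_poly (arrays v ''f'') K) (real i) = ?V i" if "i < Suc j" for i
      proof (cases "i = j")
        case True
        then show ?thesis using 1(1) nz by simp
      next
        case False
        then have "poly (nodes j) (real i) = 0" "i < j" using that by (auto simp: poly_nodes_eq_0_iff)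
        then show ?thesis using 1(1) 4(4) by simp
      qed
      then show ?case using 1(1) by simp
    qed
  qed (use t in \<open>auto simp: same_def R3_def R1_def J_def\<close>)
  have "spec interp s (0 + (0 + (0 + 22 * K * K))) ?Q"
    unfolding interp_def
    by (rule spec_chain[OF s1], rule spec_chain[OF s2], assumption, rule spec_chain[OF s3], assumption,
        rule s4, assumption)
  then show ?thesis by simp
qed

section \<open>Sampling the Bezoutian\<close>

text \<open>Multiplies \<open>W\<close> by \<open>x + g\<close> in the first \<open>j\<close> rounds
  and by \<open>1 - g x\<close> afterwards. Each product has a linear factor, so the powers needed
  for one \<open>j\<close> cost only \<open>O(n^2)\<close>.\<close>

definition power_step :: com where
  "power_step =
    Seq (If (ILess (IVar ''k1'') (IVar ''j''))
      (Seq (RAssign ''Y'' (INum 0) (RCell ''c'' (IVar ''g''))) (RAssign ''Y'' (INum 1) (RNum 1)))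
      (Seq (RAssign ''Y'' (INum 0) (RNum 1)) (RAssign ''Y'' (INum 1) (RSub (RNum 0) (RCell ''c'' (IVar ''g''))))))
    (Seq (pmul ''T'' (IAdd (IVar ''k1'') (INum 2)) ''W'' (IAdd (IVar ''k1'') (INum 1)) ''Y'' (INum 2))
    (rcopy ''W'' ''T'' (IAdd (IVar ''k1'') (INum 2))))"

definition pencil_step :: com where
  "pencil_step =
    Seq (RAssign ''W'' (INum 0) (RNum 1))
    (Seq (For ''k1'' (IVar ''n'') power_step)
    (Seq (For ''xi'' (IAdd (IVar ''m'') (INum 1)) (RAssign ''X'' (IVar ''xi'')
       (RCell ''p'' (IAdd (IMul (IVar ''xi'') (IAdd (IVar ''n'') (INum 1))) (IVar ''j'')))))
    (Seq (pmul ''T'' (IAdd (IVar ''N'') (INum 1)) ''X'' (IAdd (IVar ''m'') (INum 1)) ''W'' (IAdd (IVar ''n'') (INum 1)))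
    (For ''xi'' (IAdd (IVar ''N'') (INum 1)) (RAssign ''Q'' (IVar ''xi'')
       (RAdd (RCell ''Q'' (IVar ''xi'')) (RCell ''T'' (IVar ''xi''))))))))"

definition pencil_prog :: com where
  "pencil_prog = Seq (rzero ''Q'' (IAdd (IVar ''N'') (INum 1)))
    (For ''j'' (IAdd (IVar ''n'') (INum 1)) pencil_step)"

lemma writes_power_step [simp]:
  "iwrites power_step = {''zi'', ''ma'', ''mb''}" "awrites power_step = {''Y'', ''T'', ''W''}"
  by (auto simp: power_step_def)

lemma writes_pencil_step [simp]:
  "iwrites pencil_step = {''zi'', ''ma'', ''mb'', ''k1'', ''xi''}"
  "awrites pencil_step = {''Y'', ''T'', ''W'', ''X'', ''Q''}"
  by (auto simp: pencil_step_def)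

lemma writes_pencil_prog [simp]:
  "iwrites pencil_prog = {''zi'', ''ma'', ''mb'', ''k1'', ''xi'', ''j''}"
  "awrites pencil_prog = {''Y'', ''T'', ''W'', ''X'', ''Q''}"
  by (auto simp: pencil_prog_def)

text \<open>The partial product after \<open>k\<close> rounds; for \<open>k = n\<close> and
  \<open>j \<le> n\<close> it is the factor that \<open>pencil\<close> attaches to
  \<open>coeff p j\<close>.\<close>

definition linear_powers :: "real \<Rightarrow> nat \<Rightarrow> nat \<Rightarrow> real poly" where
  "linear_powers g j k = [:g, 1:] ^ min k j * [:1, - g:] ^ (k - j)"

lemma linear_powers_Suc:
  "linear_powers g j (Suc k) = linear_powers g j k * (if k < j then [:g, 1:] else [:1, - g:])"
  by (auto simp: linear_powers_def min_def Suc_diff_le le_Suc_eq mult_ac simp del: mult_pCons_left mult_pCons_right)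

lemma coeffs_poly_2: "a 0 = x \<Longrightarrow> a 1 = y \<Longrightarrow> coeffs_poly a 2 = [:x, y:]"
  by (rule coeffs_poly_eqI) (auto simp: less_2_cases_iff coeff_pCons split: nat.splits)

lemma spec_power_step:
  assumes iv: "ivars s ''k1'' = k" "ivars s ''j'' = j" and c: "arrays s ''c'' (ivars s ''g'') = g"
    and W: "coeffs_poly (arrays s ''W'') (Suc k) = linear_powers g j k"
  shows "spec power_step s (4 * k + 5) (\<lambda>u. coeffs_poly (arrays u ''W'') (Suc (Suc k)) = linear_powers g j (Suc k))"
proof -
  define L where "L = (if k < j then [:g, 1:] else [:1, - g:])"
  define R1 where "R1 u \<longleftrightarrow> ivars u ''k1'' = k \<and> coeffs_poly (arrays u ''W'') (Suc k) = linear_powers g j k \<and>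
    coeffs_poly (arrays u ''Y'') 2 = L" for u :: state
  define R2 where "R2 u \<longleftrightarrow> ivars u ''k1'' = k \<and> coeffs_poly (arrays u ''T'') (k + 2) = linear_powers g j (Suc k)" for u :: state
  have s1: "spec (If (ILess (IVar ''k1'') (IVar ''j''))
      (Seq (RAssign ''Y'' (INum 0) (RCell ''c'' (IVar ''g''))) (RAssign ''Y'' (INum 1) (RNum 1)))
      (Seq (RAssign ''Y'' (INum 0) (RNum 1)) (RAssign ''Y'' (INum 1) (RSub (RNum 0) (RCell ''c'' (IVar ''g'')))))) s 1 R1"
    using iv c W by (auto simp: R1_def L_def intro!: coeffs_poly_2)
  have s2: "spec (pmul ''T'' (IAdd (IVar ''k1'') (INum 2)) ''W'' (IAdd (IVar ''k1'') (INum 1)) ''Y'' (INum 2)) t (4 * k + 4) R2"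
    if t: "R1 t" for t
  proof (rule spec_mono[OF spec_pmul[where n = "k + 2" and ?n1.0 = "Suc k" and ?n2.0 = 2 and B = "4 * k + 4"] order_refl], goal_cases)
    case (6 u)
    then show ?case using t by (simp add: R1_def R2_def same_def linear_powers_Suc flip: L_def)
  qed (use t in \<open>auto simp: same_def R1_def\<close>)
  have s3: "spec (rcopy ''W'' ''T'' (IAdd (IVar ''k1'') (INum 2))) t 0
      (\<lambda>u. coeffs_poly (arrays u ''W'') (Suc (Suc k)) = linear_powers g j (Suc k))" if t: "R2 t" for t
  proof (rule spec_mono[OF spec_rcopy[where n = "k + 2"] order_refl], goal_cases)
    case (3 u)
    then have "coeffs_poly (arrays u ''W'') (k + 2) = coeffs_poly (arrays t ''T'') (k + 2)"
      by (auto simp: coeffs_poly_def)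
    then show ?case using t by (simp add: R2_def)
  qed (use t in \<open>auto simp: same_def R2_def\<close>)
  have "spec power_step s (1 + ((4 * k + 4) + 0))
      (\<lambda>u. coeffs_poly (arrays u ''W'') (Suc (Suc k)) = linear_powers g j (Suc k))"
    unfolding power_step_def
    by (rule spec_chain[OF s1], rule spec_chain[OF s2], assumption, rule s3, assumption)
  then show ?thesis by (simp add: add.commute)
qed

definition pencil_input :: "nat \<Rightarrow> nat \<Rightarrow> real poly poly \<Rightarrow> state \<Rightarrow> bool" where
  "pencil_input n m p s \<longleftrightarrow> ivars s ''n'' = n \<and> ivars s ''m'' = m \<and> ivars s ''N'' = m + n \<and> m \<le> n \<and> 1 \<le> n \<and>
    (\<forall>i\<le>n. \<forall>j\<le>n. arrays s ''p'' (i * (n + 1) + j) = coeff (coeff p j) i) \<and>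
    (\<forall>j. degree (coeff p j) \<le> m)"

lemma pencil_input_same:
  assumes "pencil_input n m p s" "same X Y s t" "''n'' \<notin> X" "''m'' \<notin> X" "''N'' \<notin> X" "''p'' \<notin> Y"
  shows "pencil_input n m p t"
  using assms by (auto simp: pencil_input_def same_def)

lemma spec_pencil_step:
  assumes inp: "pencil_input n m p s" and j: "ivars s ''j'' = j" "j \<le> n"
    and c: "arrays s ''c'' (ivars s ''g'') = g"
  shows "spec pencil_step s (22 * n * n) (\<lambda>u. coeffs_poly (arrays u ''Q'') (Suc (m + n)) =
    coeffs_poly (arrays s ''Q'') (Suc (m + n)) + coeff p j * linear_powers g j n)"
proof -
  let ?N = "m + n"
  have n1: "1 \<le> n" "m \<le> n" using inp by (auto simp: pencil_input_def)
  define J where "J u \<longleftrightarrow> pencil_input n m p u \<and> ivars u ''j'' = j \<and> ivars u ''g'' = ivars s ''g'' \<and>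
    arrays u ''c'' = arrays s ''c'' \<and> arrays u ''Q'' = arrays s ''Q''" for u :: state
  have J: "J u" if "J t" "same X Y t u" "''n'' \<notin> X" "''m'' \<notin> X" "''N'' \<notin> X" "''p'' \<notin> Y" "''j'' \<notin> X" "''g'' \<notin> X" "''c'' \<notin> Y" "''Q'' \<notin> Y" for t u X Y
  proof -
    have "pencil_input n m p u"
      by (rule pencil_input_same[of n m p t X Y u]) (use that in \<open>simp_all add: J_def\<close>)
    then show ?thesis using that by (simp add: J_def same_def)
  qed
  have Jd: "ivars u ''n'' = n" "ivars u ''m'' = m" "ivars u ''N'' = ?N" if "J u" for u
    using that by (auto simp: J_def pencil_input_def)
  define R1 where "R1 u \<longleftrightarrow> J u \<and> arrays u ''W'' 0 = 1" for u :: state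
  define R2 where "R2 u \<longleftrightarrow> J u \<and> coeffs_poly (arrays u ''W'') (Suc n) = linear_powers g j n" for u :: state
  define R3 where "R3 u \<longleftrightarrow> R2 u \<and> coeffs_poly (arrays u ''X'') (Suc m) = coeff p j" for u :: state
  define R4 where "R4 u \<longleftrightarrow> J u \<and> coeffs_poly (arrays u ''T'') (Suc ?N) = coeff p j * linear_powers g j n" for u :: state
  let ?Q = "\<lambda>u. coeffs_poly (arrays u ''Q'') (Suc ?N) = coeffs_poly (arrays s ''Q'') (Suc ?N) + coeff p j * linear_powers g j n"
  have Js: "J s" using inp j by (simp add: J_def)
  have s1: "spec (RAssign ''W'' (INum 0) (RNum 1)) s 0 R1"
    using Js by (simp add: R1_def J_def pencil_input_def)
  have s2: "spec (For ''k1'' (IVar ''n'') power_step) t (9 * n * n) R2" if t: "R1 t" for t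
  proof (rule spec_For[where I = "\<lambda>k u. coeffs_poly (arrays u ''W'') (Suc k) = linear_powers g j k"
        and B = "9 * n" and H = n], goal_cases)
    case (2 u)
    then show ?case using t Jd[of t] by (simp add: R1_def same_def)
  next
    case 3
    show ?case using t by (simp add: R1_def linear_powers_def coeffs_poly_Suc monom_0 one_pCons)
  next
    case (4 k u)
    have "J u" using t 4(2) by (intro J[of t _ _ u]) (auto simp: R1_def)
    then have "spec power_step u (4 * k + 5) (\<lambda>u. coeffs_poly (arrays u ''W'') (Suc (Suc k)) = linear_powers g j (Suc k))"
      using 4 c by (intro spec_power_step) (auto simp: J_def)
    then show ?case by (rule spec_mono) (use 4(1) n1 in auto)
  next
    case (5 u)
    have "J u" using t 5(1) by (intro J[of t _ _ u]) (auto simp: R1_def)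
    then show ?case using 5 by (simp add: R2_def)
  qed auto
  have s3: "spec (For ''xi'' (IAdd (IVar ''m'') (INum 1)) (RAssign ''X'' (IVar ''xi'')
       (RCell ''p'' (IAdd (IMul (IVar ''xi'') (IAdd (IVar ''n'') (INum 1))) (IVar ''j''))))) t 0 R3" if t: "R2 t" for t
  proof (rule spec_For[where I = "\<lambda>k u. \<forall>i<k. arrays u ''X'' i = coeff (coeff p j) i" and B = 0 and H = "Suc m"], goal_cases)
    case (2 u)
    then show ?case using t Jd[of t] by (simp add: R2_def same_def)
  next
    case (4 k u)
    have "J u" using t 4(2) by (intro J[of t _ _ u]) (auto simp: R2_def)
    then have "arrays u ''p'' (k * (n + 1) + j) = coeff (coeff p j) k" "ivars u ''n'' = n" "ivars u ''j'' = j"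
      using 4(1) n1 j by (simp_all add: J_def pencil_input_def)
    then show ?case using 4(3,4) by (simp add: less_Suc_eq)
  next
    case (5 u)
    have Ju: "J u" using t 5(1) by (intro J[of t _ _ u]) (auto simp: R2_def)
    have "degree (coeff p j) \<le> m" using inp by (simp add: pencil_input_def)
    then have "coeffs_poly (arrays u ''X'') (Suc m) = coeff p j"
      using 5(3) by (intro coeffs_poly_eqI) (auto intro!: coeff_eq_0)
    then show ?case using t Ju 5(1) by (simp add: R3_def R2_def same_def)
  qed auto
  have s4: "spec (pmul ''T'' (IAdd (IVar ''N'') (INum 1)) ''X'' (IAdd (IVar ''m'') (INum 1)) ''W'' (IAdd (IVar ''n'') (INum 1))) t (8 * n * n) R4"
    if t: "R3 t" for t
  proof (rule spec_mono[OF spec_pmul[where n = "Suc ?N" and ?n1.0 = "Suc m" and ?n2.0 = "Suc n" and B = "8 * n * n"] order_refl], goal_cases)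
    case 4
    have "2 * Suc m * Suc n \<le> 2 * (2 * n) * (2 * n)" using n1 by (intro mult_le_mono) auto
    also have "2 * (2 * n) * (2 * n) = 8 * n * n" by simp
    finally show ?case .
  next
    case (6 u)
    have "J u" using t 6(2) by (intro J[of t _ _ u]) (auto simp: R3_def R2_def)
    then show ?case using t 6(1) by (simp add: R4_def R3_def R2_def)
  qed (use t Jd[of t] in \<open>auto simp: same_def R3_def R2_def\<close>)
  have s5: "spec (For ''xi'' (IAdd (IVar ''N'') (INum 1)) (RAssign ''Q'' (IVar ''xi'')
       (RAdd (RCell ''Q'' (IVar ''xi'')) (RCell ''T'' (IVar ''xi''))))) t (Suc ?N) ?Q" if t: "R4 t" for t
  proof -
    define l where "l = Suc ?N"
    have "spec (For ''xi'' (IAdd (IVar ''N'') (INum 1)) (RAssign ''Q'' (IVar ''xi'')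
       (RAdd (RCell ''Q'' (IVar ''xi'')) (RCell ''T'' (IVar ''xi''))))) t l
       (\<lambda>u. \<forall>i<l. arrays u ''Q'' i = arrays t ''Q'' i + arrays t ''T'' i)"
    proof (rule spec_For[where I = "\<lambda>k u. \<forall>i. arrays u ''Q'' i = arrays t ''Q'' i + (if i < k then arrays t ''T'' i else 0)"
          and B = 1 and H = l], goal_cases)
      case (2 u)
      then show ?case using t Jd[of t] by (simp add: R4_def same_def l_def)
    next
      case (4 k u)
      then have "arrays u ''T'' = arrays t ''T''" by (simp add: same_def)
      then show ?case using 4(3,4) by (simp add: less_Suc_eq)
    qed simp_all
    then show ?thesis
      unfolding l_def
    proof (rule spec_mono[OF _ order_refl])
      fix u assume *: "\<forall>i<Suc ?N. arrays u ''Q'' i = arrays t ''Q'' i + arrays t ''T'' i"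
      have "coeffs_poly (arrays u ''Q'') (Suc ?N) = coeffs_poly (arrays t ''Q'') (Suc ?N) + coeffs_poly (arrays t ''T'') (Suc ?N)"
        by (rule coeffs_poly_eqI) (use * in simp_all)
      then show "?Q u" using t by (simp add: R4_def J_def)
    qed
  qed
  have "spec pencil_step s (0 + (9 * n * n + (0 + (8 * n * n + Suc ?N)))) ?Q"
    unfolding pencil_step_def
    by (rule spec_chain[OF s1], rule spec_chain[OF s2], assumption, rule spec_chain[OF s3], assumption,
        rule spec_chain[OF s4], assumption, rule s5, assumption)
  moreover have "0 + (9 * n * n + (0 + (8 * n * n + Suc ?N))) \<le> 22 * n * n"
  proof -
    define q where "q = n * n"
    have "n \<le> q" using n1 by (auto simp: q_def)
    then have "Suc ?N \<le> 5 * q" using n1 by linarith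
    then show ?thesis by (simp add: mult.assoc flip: q_def)
  qed
  ultimately show ?thesis by (rule spec_mono)
qed

lemma spec_pencil_prog:
  assumes inp: "pencil_input n m p s" and c: "arrays s ''c'' (ivars s ''g'') = g"
  shows "spec pencil_prog s (44 * n ^ 3) (\<lambda>u. coeffs_poly (arrays u ''Q'') (Suc (m + n)) = pencil n p g)"
proof -
  have n1: "1 \<le> n" using inp by (auto simp: pencil_input_def)
  define R1 where "R1 u \<longleftrightarrow> same {''zi''} {''Q''} s u \<and> (\<forall>i<Suc (m + n). arrays u ''Q'' i = 0)" for u
  have s1: "spec (rzero ''Q'' (IAdd (IVar ''N'') (INum 1))) s 0 R1"
    by (rule spec_mono[OF spec_rzero[where n = "Suc (m + n)"] order_refl])
      (use inp in \<open>auto simp: same_def R1_def pencil_input_def\<close>)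
  have s2: "spec (For ''j'' (IAdd (IVar ''n'') (INum 1)) pencil_step) t (Suc n * (22 * n * n))
      (\<lambda>u. coeffs_poly (arrays u ''Q'') (Suc (m + n)) = pencil n p g)" if t: "R1 t" for t
  proof (rule spec_For[where I = "\<lambda>j u. coeffs_poly (arrays u ''Q'') (Suc (m + n)) = (\<Sum>i<j. coeff p i * linear_powers g i n)"
        and B = "22 * n * n" and H = "Suc n"], goal_cases)
    case (2 u)
    then show ?case using t inp by (simp add: R1_def same_def pencil_input_def)
  next
    case 3
    show ?case using t by (intro coeffs_poly_eqI) (auto simp: R1_def)
  next
    case (4 j u)
    have su: "same {''zi'', ''j'', ''ma'', ''mb'', ''k1'', ''xi''} {''Q'', ''Y'', ''T'', ''W'', ''X''} s u"
      using t 4(2) by (auto simp: R1_def same_def)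
    have "pencil_input n m p u" by (rule pencil_input_same[OF inp su]) auto
    moreover have "arrays u ''c'' (ivars u ''g'') = g" using c su by (simp add: same_def)
    ultimately have "spec pencil_step u (22 * n * n) (\<lambda>v. coeffs_poly (arrays v ''Q'') (Suc (m + n)) =
        coeffs_poly (arrays u ''Q'') (Suc (m + n)) + coeff p j * linear_powers g j n)"
      using 4 by (intro spec_pencil_step) auto
    then show ?case by (rule spec_mono) (use 4 in auto)
  next
    case (5 u)
    have "(\<Sum>i<Suc n. coeff p i * linear_powers g i n) = pencil n p g"
      unfolding pencil_def lessThan_Suc_atMost
      by (rule sum.cong) (auto simp: linear_powers_def min_def mult.assoc)
    then show ?case using 5 by simp
  qed auto
  have "spec pencil_prog s (0 + Suc n * (22 * n * n)) (\<lambda>u. coeffs_poly (arrays u ''Q'') (Suc (m + n)) = pencil n p g)"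
    unfolding pencil_prog_def by (rule spec_chain[OF s1], rule s2)
  moreover have "0 + Suc n * (22 * n * n) \<le> 44 * n ^ 3"
  proof -
    have "Suc n * (22 * n * n) \<le> (2 * n) * (22 * n * n)" using n1 by (intro mult_right_mono) auto
    then show ?thesis by (simp add: power3_eq_cube)
  qed
  ultimately show ?thesis by (rule spec_mono)
qed

text \<open>The matrix is stored in rows of length \<open>2 N\<close>, because by the recursion row \<open>i\<close> is needed up to column
  \<open>2 N - 1 - i\<close>.\<close>

definition bez_prog :: com where
  "bez_prog =
    Seq (rzero ''b'' (IAdd (IMul (INum 2) (IVar ''N'')) (INum 2)))
    (Seq (rzero ''e'' (IAdd (IMul (INum 2) (IVar ''N'')) (INum 2)))
    (Seq (For ''xi'' (IAdd (IVar ''N'') (INum 1)) (Seq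
       (RAssign ''b'' (IVar ''xi'') (RCell ''Q'' (ISub (IVar ''N'') (IVar ''xi''))))
       (RAssign ''e'' (IVar ''xi'') (RMul (RCell ''c'' (ISub (IVar ''N'') (IVar ''xi''))) (RCell ''Q'' (ISub (IVar ''N'') (IVar ''xi'')))))))
    (Seq (For ''xj'' (IMul (INum 2) (IVar ''N''))
       (RAssign ''M'' (IVar ''xj'') (RMul (RCell ''b'' (INum 0)) (RCell ''e'' (IVar ''xj'')))))
    (For ''xi'' (ISub (IVar ''N'') (INum 1)) (For ''xj'' (IMul (INum 2) (IVar ''N''))
       (RAssign ''M'' (IAdd (IMul (IAdd (IVar ''xi'') (INum 1)) (IMul (INum 2) (IVar ''N''))) (IVar ''xj''))
         (RSub (RAdd (RCell ''M'' (IAdd (IMul (IVar ''xi'') (IMul (INum 2) (IVar ''N''))) (IAdd (IVar ''xj'') (INum 1))))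
             (RMul (RCell ''b'' (IAdd (IVar ''xi'') (INum 1))) (RCell ''e'' (IVar ''xj''))))
           (RMul (RCell ''b'' (IAdd (IVar ''xj'') (INum 1))) (RCell ''e'' (IVar ''xi'')))))))))) "

lemma writes_bez_prog [simp]:
  "iwrites bez_prog = {''zi'', ''xi'', ''xj''}" "awrites bez_prog = {''b'', ''e'', ''M''}"
  by (auto simp: bez_prog_def)

text \<open>Distinct cells have distinct addresses as long as the column stays below the row length
  \<open>S\<close>.\<close>

lemma index_eq_iff:
  fixes a b :: nat
  assumes "i < S" "j < S"
  shows "a * S + i = b * S + j \<longleftrightarrow> a = b \<and> i = j"
proof
  assume eq: "a * S + i = b * S + j"
  have "(a * S + i) div S = a" "(b * S + j) div S = b" using assms by auto
  then have "a = b" using eq by simp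
  then show "a = b \<and> i = j" using eq by simp
qed simp

lemma spec_bez_prog:
  assumes N: "ivars s ''N'' = N" "1 \<le> N" and c: "\<And>i. i \<le> N \<Longrightarrow> arrays s ''c'' i = real i"
    and Q: "coeffs_poly (arrays s ''Q'') (Suc N) = q"
  shows "spec bez_prog s (12 * N * N) (\<lambda>u. \<forall>i<N. \<forall>j<N. arrays u ''M'' (i * (2 * N) + j) = bez N q i j)"
proof -
  let ?b = "desc_coeff N q" and ?e = "desc_deriv N q"
  have q: "arrays s ''Q'' i = coeff q i" if "i \<le> N" for i using that by (simp flip: Q)
  \<comment> \<open>The last column reads \<open>b\<close> at index \<open>2 N\<close>, and beyond
    index \<open>N\<close> the arrays must be zero, as \<open>desc_coeff\<close> and
    \<open>desc_deriv\<close> are.\<close>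
  define L where "L = 2 * N + 2"
  define J where "J u \<longleftrightarrow> ivars u ''N'' = N \<and> arrays u ''c'' = arrays s ''c'' \<and> arrays u ''Q'' = arrays s ''Q''" for u :: state
  have J: "J u" if "J t" "same X Y t u" "''N'' \<notin> X" "''c'' \<notin> Y" "''Q'' \<notin> Y" for t u X Y
    using that by (simp add: J_def same_def)
  define R1 where "R1 u \<longleftrightarrow> J u \<and> (\<forall>i<L. arrays u ''b'' i = 0)" for u
  define R2 where "R2 u \<longleftrightarrow> R1 u \<and> (\<forall>i<L. arrays u ''e'' i = 0)" for u
  define R3 where "R3 u \<longleftrightarrow> J u \<and> (\<forall>i<L. arrays u ''b'' i = ?b i \<and> arrays u ''e'' i = ?e i)" for u
  define R4 where "R4 u \<longleftrightarrow> R3 u \<and> (\<forall>j<2 * N. arrays u ''M'' j = bez N q 0 j)" for u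
  have Js: "J s" using N by (simp add: J_def)
  have s1: "spec (rzero ''b'' (IAdd (IMul (INum 2) (IVar ''N'')) (INum 2))) s 0 R1"
  proof (rule spec_mono[OF spec_rzero[where n = L] order_refl], goal_cases)
    case (2 u)
    have "J u" using Js 2(2) by (intro J[of s _ _ u]) auto
    then show ?case using 2 by (simp add: R1_def)
  qed (use N in \<open>auto simp: same_def L_def\<close>)
  have s2: "spec (rzero ''e'' (IAdd (IMul (INum 2) (IVar ''N'')) (INum 2))) t 0 R2" if t: "R1 t" for t
  proof (rule spec_mono[OF spec_rzero[where n = L] order_refl], goal_cases)
    case (2 u)
    have "J u" using t 2(2) by (intro J[of t _ _ u]) (auto simp: R1_def)
    then show ?case using t 2 by (simp add: R2_def R1_def same_def)
  qed (use t in \<open>auto simp: same_def R1_def J_def L_def\<close>)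
  have s3: "spec (For ''xi'' (IAdd (IVar ''N'') (INum 1)) (Seq
       (RAssign ''b'' (IVar ''xi'') (RCell ''Q'' (ISub (IVar ''N'') (IVar ''xi''))))
       (RAssign ''e'' (IVar ''xi'') (RMul (RCell ''c'' (ISub (IVar ''N'') (IVar ''xi''))) (RCell ''Q'' (ISub (IVar ''N'') (IVar ''xi'')))))))
      t (N + 1) R3" if t: "R2 t" for t
  proof (rule spec_For[where I = "\<lambda>k u. \<forall>i<L. arrays u ''b'' i = (if i < k then ?b i else 0) \<and>
        arrays u ''e'' i = (if i < k then ?e i else 0)" and B = 1 and H = "N + 1"], goal_cases)
    case (2 u)
    then show ?case using t by (simp add: same_def R2_def R1_def J_def)
  next
    case 3
    show ?case using t by (simp add: R2_def R1_def)
  next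
    case (4 k u)
    have "J u" using t 4(2) by (intro J[of t _ _ u]) (auto simp: R2_def R1_def)
    then have u: "ivars u ''N'' = N" "arrays u ''Q'' (N - k) = ?b k" "arrays u ''c'' (N - k) * arrays u ''Q'' (N - k) = ?e k"
      using q[of "N - k"] c[of "N - k"] 4(1) by (simp_all add: J_def desc_coeff_def desc_deriv_def)
    have "?e k = real (N - k) * ?b k" by (simp add: desc_deriv_def)
    then show ?case using 4(3,4) u by (simp add: less_Suc_eq)
  next
    case (5 u)
    have "J u" using t 5(1) by (intro J[of t _ _ u]) (auto simp: R2_def R1_def)
    moreover have "?b i = 0" "?e i = 0" if "\<not> i < N + 1" for i
      using that by (simp_all add: desc_coeff_def desc_deriv_def)
    ultimately show ?case using 5(3) by (auto simp: R3_def)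
  qed auto
  have s4: "spec (For ''xj'' (IMul (INum 2) (IVar ''N''))
       (RAssign ''M'' (IVar ''xj'') (RMul (RCell ''b'' (INum 0)) (RCell ''e'' (IVar ''xj''))))) t (2 * N) R4"
    if t: "R3 t" for t
  proof (rule spec_For[where I = "\<lambda>k u. \<forall>j<k. arrays u ''M'' j = bez N q 0 j" and B = 1 and H = "2 * N"], goal_cases)
    case (2 u)
    then show ?case using t by (simp add: same_def R3_def J_def)
  next
    case (4 k u)
    have "arrays u ''b'' = arrays t ''b''" "arrays u ''e'' = arrays t ''e''" using 4(2) by (simp_all add: same_def)
    moreover have "arrays t ''b'' 0 = ?b 0" "arrays t ''e'' k = ?e k" using t 4(1) by (simp_all add: R3_def L_def)
    ultimately show ?case using 4(3,4) by (simp add: less_Suc_eq)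
  next
    case (5 u)
    have "J u" using t 5(1) by (intro J[of t _ _ u]) (auto simp: R3_def)
    then show ?case using t 5 by (simp add: R4_def R3_def same_def)
  qed auto
  let ?S = "2 * N"
  let ?Q = "\<lambda>u. \<forall>i<N. \<forall>j<N. arrays u ''M'' (i * ?S + j) = bez N q i j"
  let ?asg = "RAssign ''M'' (IAdd (IMul (IAdd (IVar ''xi'') (INum 1)) (IMul (INum 2) (IVar ''N''))) (IVar ''xj''))
         (RSub (RAdd (RCell ''M'' (IAdd (IMul (IVar ''xi'') (IMul (INum 2) (IVar ''N''))) (IAdd (IVar ''xj'') (INum 1))))
             (RMul (RCell ''b'' (IAdd (IVar ''xi'') (INum 1))) (RCell ''e'' (IVar ''xj''))))
           (RMul (RCell ''b'' (IAdd (IVar ''xj'') (INum 1))) (RCell ''e'' (IVar ''xi''))))"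
  have s5: "spec (For ''xi'' (ISub (IVar ''N'') (INum 1)) (For ''xj'' (IMul (INum 2) (IVar ''N'')) ?asg)) t (N * (2 * N * 4)) ?Q"
    if t: "R4 t" for t
  \<comment> \<open>Correctness is claimed only for \<open>i + j < 2 N\<close>: the loop fills whole
    rows, and the last column is computed from a cell beyond the end of the previous row.\<close>
  proof (rule spec_For[where I = "\<lambda>k u. \<forall>i\<le>k. \<forall>j. i + j < ?S \<longrightarrow> arrays u ''M'' (i * ?S + j) = bez N q i j"
        and B = "2 * N * 4" and H = "N - 1"], goal_cases)
    case (2 u)
    then show ?case using t by (simp add: same_def R4_def R3_def J_def)
  next
    case 3
    show ?case using t by (simp add: R4_def)
  next
    case (4 k u)
    have u: "J u" "arrays u ''b'' = arrays t ''b''" "arrays u ''e'' = arrays t ''e''"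
      using t 4(2) by (auto intro!: J[of t _ _ u] simp: R4_def R3_def) (auto simp: same_def)
    show ?case
    proof (rule spec_For[where I = "\<lambda>l v. (\<forall>i\<le>k. \<forall>j. i + j < ?S \<longrightarrow> arrays v ''M'' (i * ?S + j) = bez N q i j) \<and>
          (\<forall>j<l. Suc k + j < ?S \<longrightarrow> arrays v ''M'' (Suc k * ?S + j) = bez N q (Suc k) j)" and B = 4 and H = ?S], goal_cases)
      case (2 v)
      then show ?case using u by (simp add: same_def J_def)
    next
      case 3
      show ?case using 4(4) by simp
    next
      case (4 l v)
      have v: "J v" "arrays v ''b'' = arrays t ''b''" "arrays v ''e'' = arrays t ''e''" "ivars v ''xi'' = k"
        using u 4(2) \<open>ivars u ''xi'' = k\<close> by (auto intro!: J[of u _ _ v]) (auto simp: same_def)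
      have kN: "k < N" using \<open>k < N - 1\<close> by simp
      define x where "x = rval (RSub (RAdd (RCell ''M'' (IAdd (IMul (IVar ''xi'') (IMul (INum 2) (IVar ''N''))) (IAdd (IVar ''xj'') (INum 1))))
             (RMul (RCell ''b'' (IAdd (IVar ''xi'') (INum 1))) (RCell ''e'' (IVar ''xj''))))
           (RMul (RCell ''b'' (IAdd (IVar ''xj'') (INum 1))) (RCell ''e'' (IVar ''xi'')))) v"
      have x: "x = bez N q (Suc k) l" if "Suc k + l < ?S"
      proof -
        have "arrays v ''M'' (k * ?S + Suc l) = bez N q k (Suc l)"
          by (rule 4(4)[THEN conjunct1, rule_format]) (use that in auto)
        moreover have "arrays t ''b'' (Suc k) = ?b (Suc k)" "arrays t ''e'' k = ?e k"
          "arrays t ''b'' (Suc l) = ?b (Suc l)" "arrays t ''e'' l = ?e l"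
          using t that kN by (simp_all add: R4_def R3_def L_def)
        ultimately show ?thesis using v 4(3) by (simp add: x_def J_def)
      qed
      let ?M = "(arrays v ''M'')(Suc k * ?S + l := x)"
      have old: "?M (i * ?S + j) = arrays v ''M'' (i * ?S + j)" if "i \<le> k" "i + j < ?S" for i j
        using index_eq_iff[of j ?S l i "Suc k"] that 4(1) by simp
      have new: "?M (Suc k * ?S + j) = (if j = l then x else arrays v ''M'' (Suc k * ?S + j))" for j
        by simp
      have inv: "(\<forall>i\<le>k. \<forall>j. i + j < ?S \<longrightarrow> ?M (i * ?S + j) = bez N q i j) \<and>
          (\<forall>j<Suc l. Suc k + j < ?S \<longrightarrow> ?M (Suc k * ?S + j) = bez N q (Suc k) j)"
        using old new 4(4) x by (simp add: less_Suc_eq del: bezoutian.simps fun_upd_apply)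
      have "spec ?asg v 4 (\<lambda>w. (arrays w ''M'') = ?M)"
        using v 4(3) by (simp add: x_def J_def)
      then show ?case
        by (rule spec_mono) (use inv in \<open>auto simp del: bezoutian.simps fun_upd_apply\<close>)
    next
      case (5 v)
      then show ?case by (auto simp: le_Suc_eq simp del: bezoutian.simps)
    qed auto
  next
    case (5 u)
    then show ?case using N(2) by (auto simp del: bezoutian.simps)
  next
    case 6
    show ?case by (intro mult_right_mono) auto
  qed auto
  have "spec bez_prog s (0 + (0 + ((N + 1) + (2 * N + N * (2 * N * 4))))) ?Q"
    unfolding bez_prog_def
    by (rule spec_chain[OF s1], rule spec_chain[OF s2], assumption, rule spec_chain[OF s3], assumption,
        rule spec_chain[OF s4], assumption, rule s5, assumption)
  moreover have "0 + (0 + ((N + 1) + (2 * N + N * (2 * N * 4)))) \<le> 12 * N * N"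
  proof -
    define r where "r = N * N"
    have "N \<le> r" using N(2) by (auto simp: r_def)
    moreover have "N * (2 * N * 4) = 8 * r" "12 * N * N = 12 * r" by (simp_all add: r_def)
    ultimately show ?thesis using N(2) by linarith
  qed
  ultimately show ?thesis by (rule spec_mono)
qed

section \<open>Elimination\<close>

abbreviation M_index :: "iexp \<Rightarrow> iexp \<Rightarrow> iexp" where
  "M_index i j \<equiv> IAdd (IMul i (IMul (INum 2) (IVar ''N''))) j"

definition pivot_row_test :: com where
  "pivot_row_test = For ''xj'' (IVar ''N'') (If (ILess (IVar ''cc'') (IVar ''xj''))
     (If (REq (RCell ''M'' (M_index (IVar ''cc'') (IVar ''xj''))) (RNum 0)) Skip fail) Skip)"

text \<open>This works in place because only cells with both indices above \<open>cc\<close> are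
  written; the pivot row and the pivot column stay intact while they are being read.\<close>

definition schur_update :: com where
  "schur_update = For ''xi'' (IVar ''N'') (If (ILess (IVar ''cc'') (IVar ''xi''))
     (For ''xj'' (IVar ''N'') (If (ILess (IVar ''cc'') (IVar ''xj''))
       (RAssign ''M'' (M_index (IVar ''xi'') (IVar ''xj''))
         (RSub (RCell ''M'' (M_index (IVar ''xi'') (IVar ''xj'')))
           (RDiv (RMul (RCell ''M'' (M_index (IVar ''xi'') (IVar ''cc''))) (RCell ''M'' (M_index (IVar ''cc'') (IVar ''xj''))))
             (RCell ''M'' (M_index (IVar ''cc'') (IVar ''cc'')))))) Skip)) Skip)"

text \<open>A zero pivot skips the update, in agreement with \<open>schur\<close> and
  \<open>x / 0 = 0\<close>. Elimination goes on after a failure; the flag \<open>ok\<close>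
  remembers it, so the values in \<open>V\<close> matter only if every test succeeds.\<close>

definition elim_step :: com where
  "elim_step =
    Seq (If (RLess (RCell ''M'' (M_index (IVar ''cc'') (IVar ''cc''))) (RNum 0)) fail Skip)
    (Seq (If (REq (RCell ''M'' (M_index (IVar ''cc'') (IVar ''cc''))) (RNum 0)) pivot_row_test schur_update)
    (Seq (RAssign ''d'' (INum 0) (RMul (RCell ''d'' (INum 0)) (RCell ''M'' (M_index (IVar ''cc'') (IVar ''cc'')))))
    (RAssign ''V'' (IAdd (IMul (IVar ''cc'') (IVar ''K'')) (IVar ''g'')) (RCell ''d'' (INum 0)))))"

definition elim_prog :: com where
  "elim_prog = Seq (RAssign ''d'' (INum 0) (RNum 1)) (For ''cc'' (IVar ''N'') elim_step)"

lemma writes_pivot_row_test [simp]: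
  "iwrites pivot_row_test = {''xj'', ''ok''}" "awrites pivot_row_test = {}"
  by (auto simp: pivot_row_test_def)

lemma writes_schur_update [simp]:
  "iwrites schur_update = {''xi'', ''xj''}" "awrites schur_update = {''M''}"
  by (auto simp: schur_update_def)

lemma writes_elim_step [simp]:
  "iwrites elim_step = {''xi'', ''xj'', ''ok''}" "awrites elim_step = {''M'', ''d'', ''V''}"
  by (auto simp: elim_step_def)

lemma writes_elim_prog [simp]:
  "iwrites elim_prog = {''xi'', ''xj'', ''ok'', ''cc''}" "awrites elim_prog = {''M'', ''d'', ''V''}"
  by (auto simp: elim_prog_def)

definition entry :: "nat \<Rightarrow> state \<Rightarrow> nat \<Rightarrow> nat \<Rightarrow> real" where
  "entry N s i j = arrays s ''M'' (i * (2 * N) + j)"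

lemma entry_same: "same X Y s t \<Longrightarrow> ''M'' \<notin> Y \<Longrightarrow> entry N t = entry N s"
  by (simp add: entry_def[abs_def] same_def)

lemma entry_ivars [simp]: "entry N (s\<lparr>ivars := f\<rparr>) = entry N s"
  by (simp add: entry_def[abs_def])

lemma entry_arrays_other [simp]:
  "v \<noteq> ''M'' \<Longrightarrow> entry N (s\<lparr>arrays := (arrays s)(v := f)\<rparr>) = entry N s"
  by (simp add: entry_def[abs_def])

lemma entry_update:
  assumes "j < N" "l < N"
  shows "entry N (s\<lparr>arrays := (arrays s)(''M'' := (arrays s ''M'')(k * (2 * N) + l := x))\<rparr>) i j =
    (if i = k \<and> j = l then x else entry N s i j)"
  using index_eq_iff[of j "2 * N" l i k] assms by (simp add: entry_def)

lemma spec_pivot_row_test: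
  assumes "ivars s ''N'' = N" "ivars s ''cc'' = c"
  shows "spec pivot_row_test s N (\<lambda>u. ivars u ''ok'' =
    (if \<forall>j<N. c < j \<longrightarrow> entry N s c j = 0 then ivars s ''ok'' else 0))"
  unfolding pivot_row_test_def
proof (rule spec_For[where I = "\<lambda>k u. ivars u ''ok'' = (if \<forall>j<k. c < j \<longrightarrow> entry N s c j = 0 then ivars s ''ok'' else 0)"
      and B = 1 and H = N], goal_cases)
  case (4 i t)
  have "ivars t ''N'' = N" "ivars t ''cc'' = c" "arrays t = arrays s"
    using 4(2) assms by (auto simp: same_def fail_def)
  then show ?case using 4(3,4) by (auto simp: fail_def entry_def less_Suc_eq)
qed (use assms in \<open>auto simp: same_def fail_def\<close>)

lemma spec_schur_update:
  assumes "ivars s ''N'' = N" "ivars s ''cc'' = c" "c < N" and p: "entry N s c c \<noteq> 0"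
  shows "spec schur_update s (3 * N * N) (\<lambda>u. \<forall>i<N. \<forall>j<N. entry N u i j =
    (if c < i \<and> c < j then entry N s i j - entry N s i c * entry N s c j / entry N s c c else entry N s i j))"
proof -
  define E where "E = entry N s"
  define E' where "E' i j = E i j - E i c * E c j / E c c" for i j
  have "spec schur_update s (3 * N * N) (\<lambda>u. \<forall>i<N. \<forall>j<N. entry N u i j = (if c < i \<and> c < j then E' i j else E i j))"
    unfolding schur_update_def
  proof (rule spec_For[where I = "\<lambda>k u. \<forall>i<N. \<forall>j<N. entry N u i j = (if i < k \<and> c < i \<and> c < j then E' i j else E i j)"
        and B = "3 * N" and H = N], goal_cases)
    case 3
    show ?case by (simp add: E_def)
  next
    case (4 k u)
    note k = \<open>k < N\<close>
    have u: "ivars u ''N'' = N" "ivars u ''cc'' = c" "ivars u ''xi'' = k"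
      using 4(2,3) assms by (auto simp: same_def)
    note inv = 4(4)[rule_format]
    show ?case
    proof (cases "c < k")
      case False
      have "entry N u i j = (if i < Suc k \<and> c < i \<and> c < j then E' i j else E i j)" if "i < N" "j < N" for i j
        using inv[OF that] False by (auto simp: less_Suc_eq)
      then show ?thesis using u False by simp
    next
      case True
      have "spec (For ''xj'' (IVar ''N'') (If (ILess (IVar ''cc'') (IVar ''xj''))
       (RAssign ''M'' (M_index (IVar ''xi'') (IVar ''xj''))
         (RSub (RCell ''M'' (M_index (IVar ''xi'') (IVar ''xj'')))
           (RDiv (RMul (RCell ''M'' (M_index (IVar ''xi'') (IVar ''cc''))) (RCell ''M'' (M_index (IVar ''cc'') (IVar ''xj''))))
             (RCell ''M'' (M_index (IVar ''cc'') (IVar ''cc'')))))) Skip)) u (3 * N)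
        (\<lambda>v. \<forall>i<N. \<forall>j<N. entry N v i j = (if i < Suc k \<and> c < i \<and> c < j then E' i j else E i j))"
      proof (rule spec_For[where I = "\<lambda>l v. \<forall>i<N. \<forall>j<N. entry N v i j =
            (if (i < k \<or> i = k \<and> j < l) \<and> c < i \<and> c < j then E' i j else E i j)" and B = 3 and H = N], goal_cases)
        case (2 v)
        then show ?case using u by (simp add: same_def)
      next
        case 3
        show ?case using inv by simp
      next
        case (4 l v)
        note l = \<open>l < N\<close>
        have v: "ivars v ''N'' = N" "ivars v ''cc'' = c" "ivars v ''xi'' = k" "ivars v ''xj'' = l"
          using 4(2,3) u by (auto simp: same_def)
        note iv = 4(4)[rule_format]
        have cells: "entry N v k l = E k l" "entry N v k c = E k c" "entry N v c l = E c l" "entry N v c c = E c c"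
          using iv k l assms(3) True by simp_all
        have step: "(if (i < k \<or> i = k \<and> j < Suc l) \<and> c < i \<and> c < j then E' i j else E i j) =
            (if i = k \<and> j = l \<and> c < l then E' k l else
              if (i < k \<or> i = k \<and> j < l) \<and> c < i \<and> c < j then E' i j else E i j)" for i j
          using True by (auto simp: less_Suc_eq)
        show ?case
        proof (cases "c < l")
          case False
          then show ?thesis unfolding step using iv v by simp
        next
          case c_l: True
          have val: "entry N v k l - entry N v k c * entry N v c l / entry N v c c = E' k l"
            unfolding cells E'_def ..
          have "entry N (v\<lparr>arrays := (arrays v)(''M'' := (arrays v ''M'')(k * (2 * N) + l := E' k l))\<rparr>) i j =
              (if i = k \<and> j = l \<and> c < l then E' k l else
              if (i < k \<or> i = k \<and> j < l) \<and> c < i \<and> c < j then E' i j else E i j)" if "i < N" "j < N" for i j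
          proof (cases "i = k \<and> j = l")
            case True
            then have "i = k" "j = l" by auto
            then show ?thesis using c_l unfolding entry_def by simp
          next
            case False
            then have "\<not> (i = k \<and> j = l \<and> c < l)" by blast
            with False show ?thesis
              by (simp only: entry_update[OF that(2) l] iv[OF that] if_False)
          qed
          moreover have "arrays v ''M'' (c * (2 * N) + c) \<noteq> 0"
            using p cells(4) by (simp add: entry_def E_def)
          ultimately show ?thesis
            unfolding step using v c_l val by (simp add: entry_def[symmetric])
        qed
      next
        case (5 v)
        have "(if (i < k \<or> i = k \<and> j < N) \<and> c < i \<and> c < j then E' i j else E i j) =
            (if i < Suc k \<and> c < i \<and> c < j then E' i j else E i j)" if "j < N" for i j
          using that by (auto simp: less_Suc_eq)
        then show ?case using 5(3) by simp
      qed auto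
      then show ?thesis using u True by simp
    qed
  qed (use assms in \<open>auto simp: same_def\<close>)
  then show ?thesis unfolding E'_def E_def .
qed

text \<open>\<open>S\<close> is the trailing block that starts at row and column \<open>c\<close>;
  the step leaves its Schur complement one row and one column further on.\<close>

lemma spec_elim_step:
  assumes iv: "ivars s ''N'' = N" "ivars s ''cc'' = c" "c < N" "ivars s ''K'' = K" "ivars s ''g'' = g"
    and S: "\<And>i j. i < N - c \<Longrightarrow> j < N - c \<Longrightarrow> entry N s (c + i) (c + j) = S i j"
  shows "spec elim_step s (7 * N * N) (\<lambda>u.
    ivars u ''ok'' = (if S 0 0 \<ge> 0 \<and> (S 0 0 = 0 \<longrightarrow> (\<forall>j<N - c. S 0 j = 0)) then ivars s ''ok'' else 0) \<and>
    (\<forall>i<N - Suc c. \<forall>j<N - Suc c. entry N u (Suc c + i) (Suc c + j) = schur S i j) \<and>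
    arrays u ''d'' 0 = arrays s ''d'' 0 * S 0 0 \<and>
    arrays u ''V'' = (arrays s ''V'')(c * K + g := arrays s ''d'' 0 * S 0 0))"
    (is "spec _ _ _ ?Q")
proof -
  define J where "J u \<longleftrightarrow> ivars u ''N'' = N \<and> ivars u ''cc'' = c \<and> ivars u ''K'' = K \<and> ivars u ''g'' = g \<and>
    arrays u ''d'' = arrays s ''d'' \<and> arrays u ''V'' = arrays s ''V''" for u :: state
  have J: "J u" if "J t" "same X Y t u" "''N'' \<notin> X" "''cc'' \<notin> X" "''K'' \<notin> X" "''g'' \<notin> X" "''d'' \<notin> Y" "''V'' \<notin> Y" for t u X Y
    using that by (simp add: J_def same_def)
  define ok1 where "ok1 = (if S 0 0 \<ge> 0 then ivars s ''ok'' else 0)"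
  define ok2 where "ok2 = (if S 0 0 = 0 \<longrightarrow> (\<forall>j<N - c. S 0 j = 0) then ok1 else 0)"
  have Scc: "entry N s c c = S 0 0" using S[of 0 0] iv(3) by simp
  define R1 where "R1 u \<longleftrightarrow> J u \<and> entry N u = entry N s \<and> ivars u ''ok'' = ok1" for u
  define R2 where "R2 u \<longleftrightarrow> J u \<and> entry N u c c = S 0 0 \<and> ivars u ''ok'' = ok2 \<and>
    (\<forall>i<N - Suc c. \<forall>j<N - Suc c. entry N u (Suc c + i) (Suc c + j) = schur S i j)" for u
  define R3 where "R3 u \<longleftrightarrow> ivars u ''cc'' = c \<and> ivars u ''K'' = K \<and> ivars u ''g'' = g \<and> ivars u ''ok'' = ok2 \<and>
    (\<forall>i<N - Suc c. \<forall>j<N - Suc c. entry N u (Suc c + i) (Suc c + j) = schur S i j) \<and>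
    arrays u ''d'' 0 = arrays s ''d'' 0 * S 0 0 \<and> arrays u ''V'' = arrays s ''V''" for u
  have s1: "spec (If (RLess (RCell ''M'' (M_index (IVar ''cc'') (IVar ''cc''))) (RNum 0)) fail Skip) s 1 R1"
  proof -
    have "arrays s ''M'' (c * (2 * N) + c) = S 0 0" using Scc unfolding entry_def .
    then show ?thesis using iv by (simp add: R1_def J_def fail_def ok1_def)
  qed
  have s2: "spec (If (REq (RCell ''M'' (M_index (IVar ''cc'') (IVar ''cc''))) (RNum 0)) pivot_row_test schur_update) t
      (1 + 3 * N * N) R2" if t: "R1 t" for t
  proof (cases "S 0 0 = 0")
    case True
    have Jt: "J t" "entry N t = entry N s" "ivars t ''ok'' = ok1" using t by (auto simp: R1_def)
    have "entry N t c c = 0" using Jt(2) Scc True by simp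
    then have z: "arrays t ''M'' (c * (2 * N) + c) = 0" unfolding entry_def .
    have row: "(\<forall>j<N. c < j \<longrightarrow> entry N t c j = 0) \<longleftrightarrow> (\<forall>j<N - c. S 0 j = 0)"
    proof
      assume L: "\<forall>j<N. c < j \<longrightarrow> entry N t c j = 0"
      show "\<forall>j<N - c. S 0 j = 0"
      proof (intro allI impI)
        fix j assume j: "j < N - c"
        show "S 0 j = 0"
        proof (cases "j = 0")
          case False
          then have "entry N t c (c + j) = 0" using L j by simp
          then show ?thesis using S[of 0 j] j Jt(2) by simp
        qed (use True in simp)
      qed
    next
      assume R: "\<forall>j<N - c. S 0 j = 0"
      show "\<forall>j<N. c < j \<longrightarrow> entry N t c j = 0"
      proof (intro allI impI)
        fix j assume j: "j < N" "c < j"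
        then show "entry N t c j = 0" using S[of 0 "j - c"] R Jt(2) by simp
      qed
    qed
    have "spec pivot_row_test t N (\<lambda>u. ivars u ''ok'' = (if \<forall>j<N. c < j \<longrightarrow> entry N t c j = 0 then ivars t ''ok'' else 0))"
      using Jt by (intro spec_pivot_row_test) (auto simp: J_def)
    then have "spec pivot_row_test t (3 * N * N) R2"
    proof (rule spec_mono)
      show "N \<le> 3 * N * N" using iv(3) by simp
      fix u assume ok: "ivars u ''ok'' = (if \<forall>j<N. c < j \<longrightarrow> entry N t c j = 0 then ivars t ''ok'' else 0)"
        and su: "same (iwrites pivot_row_test) (awrites pivot_row_test) t u"
      have "J u" using Jt(1) su by (intro J[of t _ _ u]) auto
      moreover have e: "entry N u = entry N s" using entry_same[OF su] Jt(2) by simp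
      moreover have "entry N s (Suc c + i) (Suc c + j) = schur S i j" if "i < N - Suc c" "j < N - Suc c" for i j
        using S[of "Suc i" "Suc j"] that True by (simp add: schur_def)
      moreover have "ivars u ''ok'' = ok2"
        unfolding ok2_def ok row Jt(3) by (simp only: True simp_thms)
      ultimately show "R2 u" using Scc by (simp add: R2_def)
    qed
    then show ?thesis using Jt(1) z by (simp add: J_def)
  next
    case False
    have Jt: "J t" "entry N t = entry N s" "ivars t ''ok'' = ok1" using t by (auto simp: R1_def)
    have "entry N t c c \<noteq> 0" using Jt(2) Scc False by simp
    then have z: "arrays t ''M'' (c * (2 * N) + c) \<noteq> 0" unfolding entry_def .
    have "spec schur_update t (3 * N * N) (\<lambda>u. \<forall>i<N. \<forall>j<N. entry N u i j =
      (if c < i \<and> c < j then entry N t i j - entry N t i c * entry N t c j / entry N t c c else entry N t i j))"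
      using Jt Scc False iv(3) by (intro spec_schur_update) (auto simp: J_def)
    then have "spec schur_update t (3 * N * N) R2"
    proof (rule spec_mono)
      fix u assume E: "\<forall>i<N. \<forall>j<N. entry N u i j =
          (if c < i \<and> c < j then entry N t i j - entry N t i c * entry N t c j / entry N t c c else entry N t i j)"
        and su: "same (iwrites schur_update) (awrites schur_update) t u"
      have "J u" using Jt(1) su by (intro J[of t _ _ u]) auto
      moreover have "ivars u ''ok'' = ok1" using su Jt(3) by (simp add: same_def)
      moreover have "entry N u (Suc c + i) (Suc c + j) = schur S i j" if "i < N - Suc c" "j < N - Suc c" for i j
        using S[of "Suc i" "Suc j"] S[of "Suc i" 0] S[of 0 "Suc j"] S[of 0 0] that E Jt(2) by (simp add: schur_def)
      ultimately show "R2 u" using E iv(3) Jt(2) Scc False by (simp add: R2_def ok2_def)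
    qed simp
    then show ?thesis using Jt(1) z by (simp add: J_def)
  qed
  have s3: "spec (RAssign ''d'' (INum 0) (RMul (RCell ''d'' (INum 0)) (RCell ''M'' (M_index (IVar ''cc'') (IVar ''cc''))))) t 1 R3"
    if t: "R2 t" for t
  proof -
    have "entry N t c c = S 0 0" using t by (simp add: R2_def)
    then have "arrays t ''M'' (c * (2 * N) + c) = S 0 0" unfolding entry_def .
    then show ?thesis using t by (simp add: R2_def R3_def J_def)
  qed
  have s4: "spec (RAssign ''V'' (IAdd (IMul (IVar ''cc'') (IVar ''K'')) (IVar ''g'')) (RCell ''d'' (INum 0))) t 0 ?Q"
    if t: "R3 t" for t
  proof -
    have "ok2 = (if S 0 0 \<ge> 0 \<and> (S 0 0 = 0 \<longrightarrow> (\<forall>j<N - c. S 0 j = 0)) then ivars s ''ok'' else 0)"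
    proof -
      have "(if a then if b then x else y else y) = (if b \<and> a then x else y)" for a b and x y :: nat
        by simp
      then show ?thesis unfolding ok2_def ok1_def .
    qed
    then show ?thesis using t by (simp add: R3_def)
  qed
  have "spec elim_step s (1 + ((1 + 3 * N * N) + (1 + 0))) ?Q"
    unfolding elim_step_def
    by (rule spec_chain[OF s1], rule spec_chain[OF s2], assumption, rule spec_chain[OF s3], assumption,
        rule s4, assumption)
  moreover have "1 + ((1 + 3 * N * N) + (1 + 0)) \<le> 7 * N * N"
  proof -
    define r where "r = N * N"
    have "1 \<le> r" using iv(3) by (simp add: r_def)
    then show ?thesis by (simp add: mult.assoc flip: r_def)
  qed
  ultimately show ?thesis by (rule spec_mono)
qed

text \<open>Row \<open>c\<close> of \<open>V\<close> collects products of \<open>c + 1\<close>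
  pivots, which are the minors of order \<open>c + 1\<close> once elimination succeeds. Column
  \<open>g\<close> belongs to this sample; the last clause protects the other samples.\<close>

lemma spec_elim_prog:
  assumes iv: "ivars s ''N'' = N" "ivars s ''K'' = K" "ivars s ''g'' = g" "g < K"
    and B: "\<And>i j. i < N \<Longrightarrow> j < N \<Longrightarrow> entry N s i j = B i j"
  shows "spec elim_prog s (7 * N * N * N) (\<lambda>u.
    ivars u ''ok'' = (if elimination_psd N B then ivars s ''ok'' else 0) \<and>
    (\<forall>c<N. arrays u ''V'' (c * K + g) = (\<Prod>i<Suc c. (schur ^^ i) B 0 0)) \<and>
    (\<forall>c h. h < K \<longrightarrow> h \<noteq> g \<longrightarrow> arrays u ''V'' (c * K + h) = arrays s ''V'' (c * K + h)))"
    (is "spec _ _ _ ?Q")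
proof -
  define s0 where "s0 = s\<lparr>arrays := (arrays s)(''d'' := (arrays s ''d'')(0 := 1))\<rparr>"
  let ?cond = "\<lambda>c. (schur ^^ c) B 0 0 \<ge> 0 \<and> ((schur ^^ c) B 0 0 = 0 \<longrightarrow> (\<forall>j<N - c. (schur ^^ c) B 0 j = 0))"
  have "spec (For ''cc'' (IVar ''N'') elim_step) s0 (7 * N * N * N) ?Q"
  proof (rule spec_For[where B = "7 * N * N" and H = N and I = "\<lambda>c u.
      ivars u ''ok'' = (if \<forall>i<c. ?cond i then ivars s ''ok'' else 0) \<and>
      (\<forall>i<N - c. \<forall>j<N - c. entry N u (c + i) (c + j) = (schur ^^ c) B i j) \<and>
      arrays u ''d'' 0 = (\<Prod>i<c. (schur ^^ i) B 0 0) \<and>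
      (\<forall>i<c. arrays u ''V'' (i * K + g) = (\<Prod>j<Suc i. (schur ^^ j) B 0 0)) \<and>
      (\<forall>i h. h < K \<longrightarrow> h \<noteq> g \<longrightarrow> arrays u ''V'' (i * K + h) = arrays s ''V'' (i * K + h))"], goal_cases)
    case (2 u)
    then show ?case using iv by (simp add: same_def s0_def)
  next
    case 3
    show ?case using B by (simp add: s0_def entry_def)
  next
    case (4 c u)
    define S where "S = (schur ^^ c) B"
    have u: "ivars u ''N'' = N" "ivars u ''cc'' = c" "ivars u ''K'' = K" "ivars u ''g'' = g"
      using 4(2,3) iv by (auto simp: same_def s0_def)
    have step: "spec elim_step u (7 * N * N) (\<lambda>v.
        ivars v ''ok'' = (if S 0 0 \<ge> 0 \<and> (S 0 0 = 0 \<longrightarrow> (\<forall>j<N - c. S 0 j = 0)) then ivars u ''ok'' else 0) \<and>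
        (\<forall>i<N - Suc c. \<forall>j<N - Suc c. entry N v (Suc c + i) (Suc c + j) = schur S i j) \<and>
        arrays v ''d'' 0 = arrays u ''d'' 0 * S 0 0 \<and>
        arrays v ''V'' = (arrays u ''V'')(c * K + g := arrays u ''d'' 0 * S 0 0))"
      using 4(1,4) u by (intro spec_elim_step) (auto simp: S_def)
    show ?case
    proof (rule spec_mono[OF step order_refl], goal_cases)
      case (1 v)
      define P where "P i \<longleftrightarrow> ?cond i" for i
      have "ivars v ''ok'' = (if P c then ivars u ''ok'' else 0)"
        unfolding P_def using 1(1)[unfolded S_def] by (rule conjunct1)
      moreover have "ivars u ''ok'' = (if \<forall>i<c. P i then ivars s ''ok'' else 0)"
        unfolding P_def using 4(4) by (rule conjunct1)
      moreover have "(\<forall>i<Suc c. P i) \<longleftrightarrow> (\<forall>i<c. P i) \<and> P c" using less_Suc_eq by metis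
      ultimately have "ivars v ''ok'' = (if \<forall>i<Suc c. P i then ivars s ''ok'' else 0)"
        by (cases "P c"; cases "\<forall>i<c. P i") (simp_all only: if_True if_False simp_thms)
      then have ok: "ivars v ''ok'' = (if \<forall>i<Suc c. ?cond i then ivars s ''ok'' else 0)"
        unfolding P_def .
      have d: "arrays v ''d'' 0 = (\<Prod>i<Suc c. (schur ^^ i) B 0 0)"
        using 1(1) 4(4) by (simp add: S_def)
      have V: "arrays v ''V'' = (arrays u ''V'')(c * K + g := (\<Prod>i<Suc c. (schur ^^ i) B 0 0))"
        using 1(1) 4(4) by (simp add: S_def)
      have V1: "arrays v ''V'' (i * K + g) = (\<Prod>j<Suc i. (schur ^^ j) B 0 0)" if "i < Suc c" for i
        using 4(4) that iv(4) unfolding V by (auto simp: less_Suc_eq simp del: prod.lessThan_Suc)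
      have V2: "arrays v ''V'' (i * K + h) = arrays s ''V'' (i * K + h)" if "h < K" "h \<noteq> g" for i h
        using 4(4) that iv(4) index_eq_iff[of h K g i c] unfolding V by simp
      have ent: "entry N v (Suc c + i) (Suc c + j) = (schur ^^ Suc c) B i j" if "i < N - Suc c" "j < N - Suc c" for i j
        using 1(1) that by (simp add: S_def)
      show ?case using ok d V1 V2 ent by (simp del: prod.lessThan_Suc funpow.simps add_Suc)
    qed
  next
    case (5 u)
    then show ?case unfolding elimination_psd_iff by (simp del: prod.lessThan_Suc)
  qed auto
  then show ?thesis
    unfolding elim_prog_def by (simp add: s0_def)
qed

section \<open>Preprocessing\<close>

text \<open>Powers of \<open>x\<close> are visited in ascending order, so the last nonzero
  coefficient decides. The flag \<open>nz\<close> is kept because \<open>m = 0\<close> does not tell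
  the zero polynomial from one that is free of \<open>x\<close>.\<close>

definition find_x_degree :: com where
  "find_x_degree = Seq (IAssign ''m'' (INum 0)) (Seq (IAssign ''nz'' (INum 0))
     (For ''xi'' (IAdd (IVar ''n'') (INum 1)) (For ''xj'' (IAdd (IVar ''n'') (INum 1))
       (If (REq (RCell ''p'' (IAdd (IMul (IVar ''xi'') (IAdd (IVar ''n'') (INum 1))) (IVar ''xj''))) (RNum 0)) Skip
         (Seq (IAssign ''m'' (IVar ''xi'')) (IAssign ''nz'' (INum 1)))))))"

lemma writes_find_x_degree [simp]:
  "iwrites find_x_degree = {''m'', ''nz'', ''xi'', ''xj''}" "awrites find_x_degree = {}"
  by (auto simp: find_x_degree_def)

definition has_coeffs :: "nat \<Rightarrow> real poly poly \<Rightarrow> state \<Rightarrow> bool" where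
  "has_coeffs n p s \<longleftrightarrow> ivars s ''n'' = n \<and>
    (\<forall>i\<le>n. \<forall>j\<le>n. arrays s ''p'' (i * (n + 1) + j) = coeff (coeff p j) i)"

lemma has_coeffs_same:
  "has_coeffs n p s \<Longrightarrow> same X Y s t \<Longrightarrow> ''n'' \<notin> X \<Longrightarrow> ''p'' \<notin> Y \<Longrightarrow> has_coeffs n p t"
  by (simp add: has_coeffs_def same_def)

lemma spec_find_x_degree:
  assumes inp: "has_coeffs n p s" and p: "p \<in> bipolys n"
  shows "spec find_x_degree s (Suc n * Suc n) (\<lambda>u. if p = 0 then ivars u ''nz'' = 0
    else ivars u ''nz'' = 1 \<and> ivars u ''m'' = x_degree p)"
proof -
  define row where "row i \<longleftrightarrow> (\<exists>j\<le>n. coeff (coeff p j) i \<noteq> 0)" for i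
  define Inv where "Inv k z m \<longleftrightarrow> (if z = (0::nat) then \<forall>i<k. \<not> row i
    else z = 1 \<and> row m \<and> (\<forall>i<k. row i \<longrightarrow> i \<le> m))" for k z m
  define s0 where "s0 = s\<lparr>ivars := (ivars s)(''m'' := 0, ''nz'' := 0)\<rparr>"
  have p_s0: "has_coeffs n p s0" using inp by (simp add: has_coeffs_def s0_def)
  have dp: "degree p \<le> n" and dc: "\<And>j. degree (coeff p j) \<le> n" using p by (auto simp: bipolys_def)
  have "spec (For ''xi'' (IAdd (IVar ''n'') (INum 1)) (For ''xj'' (IAdd (IVar ''n'') (INum 1))
       (If (REq (RCell ''p'' (IAdd (IMul (IVar ''xi'') (IAdd (IVar ''n'') (INum 1))) (IVar ''xj''))) (RNum 0)) Skip
         (Seq (IAssign ''m'' (IVar ''xi'')) (IAssign ''nz'' (INum 1)))))) s0 (Suc n * Suc n)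
       (\<lambda>u. Inv (Suc n) (ivars u ''nz'') (ivars u ''m''))"
  proof (rule spec_For[where I = "\<lambda>k u. Inv k (ivars u ''nz'') (ivars u ''m'')" and B = "Suc n" and H = "Suc n"], goal_cases)
    case (2 u)
    then show ?case using p_s0 by (simp add: same_def has_coeffs_def)
  next
    case 3
    show ?case by (simp add: Inv_def s0_def)
  next
    case (4 k u)
    have pu: "has_coeffs n p u" using p_s0 4(2) by (rule has_coeffs_same) auto
    note k = \<open>k < Suc n\<close>
    \<comment> \<open>Inside row \<open>k\<close>: the rows before it are settled, and
      \<open>l\<close> coefficients of row \<open>k\<close> have been seen.\<close>
    define In where "In l z m \<longleftrightarrow> (if z = (0::nat) then (\<forall>i<k. \<not> row i) \<and> (\<forall>j<l. coeff (coeff p j) k = 0)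
      else z = 1 \<and> row m \<and> (\<forall>i<k. row i \<longrightarrow> i \<le> m) \<and> ((\<exists>j<l. coeff (coeff p j) k \<noteq> 0) \<longrightarrow> m = k))" for l z m
    show ?case
    proof (rule spec_For[where I = "\<lambda>l v. In l (ivars v ''nz'') (ivars v ''m'')" and B = 1 and H = "Suc n"], goal_cases)
      case (2 v)
      then show ?case using pu by (simp add: same_def has_coeffs_def)
    next
      case 3
      show ?case using 4(4) unfolding Inv_def In_def by (cases "ivars u ''nz'' = 0") simp_all
    next
      case (4 l v)
      have pv: "has_coeffs n p v" using pu 4(2) by (rule has_coeffs_same) auto
      have xi: "ivars v ''xi'' = k" using 4(2) \<open>ivars u ''xi'' = k\<close> by (simp add: same_def)
      have cell: "arrays v ''p'' (k * Suc n + l) = coeff (coeff p l) k" "ivars v ''n'' = n"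
        using pv k 4(1) by (simp_all add: has_coeffs_def)
      have stay: "In (Suc l) z m" if "In l z m" "coeff (coeff p l) k = 0" for z m
        using that less_Suc_eq unfolding In_def by metis
      have set: "In (Suc l) 1 k" if "In l z m" "coeff (coeff p l) k \<noteq> 0" for z m
      proof -
        have "row k" unfolding row_def using that(2) 4(1) by (intro exI[of _ l]) simp
        then show ?thesis by (simp add: In_def)
      qed
      show ?case
      proof (cases "coeff (coeff p l) k = 0")
        case True
        then show ?thesis using cell xi 4(3) stay[OF 4(4)] by simp
      next
        case False
        then show ?thesis using cell xi 4(3) set[OF 4(4)] by simp
      qed
    next
      case (5 v)
      have "In (Suc n) z m \<Longrightarrow> Inv (Suc k) z m" for z m
        unfolding In_def Inv_def row_def[of k] less_Suc_eq_le[of _ n]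
        by (auto simp: less_Suc_eq row_def split: if_splits)
      then show ?case using 5(3) by simp
    qed auto
  qed auto
  then have "spec find_x_degree s (Suc n * Suc n) (\<lambda>u. Inv (Suc n) (ivars u ''nz'') (ivars u ''m''))"
    unfolding find_x_degree_def by (simp add: s0_def)
  then show ?thesis
  proof (rule spec_mono[OF _ order_refl])
    fix u assume I: "Inv (Suc n) (ivars u ''nz'') (ivars u ''m'')"
    show "if p = 0 then ivars u ''nz'' = 0 else ivars u ''nz'' = 1 \<and> ivars u ''m'' = x_degree p"
    proof (cases "p = 0")
      case True
      then have "\<not> row i" for i by (simp add: row_def)
      then show ?thesis using I True by (simp add: Inv_def split: if_splits)
    next
      case False
      obtain j where j: "j \<le> degree p" "coeff (coeff p j) (x_degree p) \<noteq> 0" using x_degree_attained[OF False] .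
      have r: "row (x_degree p)" unfolding row_def using j dp by (intro exI[of _ j]) simp
      have "x_degree p \<le> n" using le_degree[OF j(2)] dc[of j] by simp
      then have *: "ivars u ''nz'' = 1" "row (ivars u ''m'')" "x_degree p \<le> ivars u ''m''"
        using I r by (auto simp: Inv_def split: if_splits)
      then obtain j' where "coeff (coeff p j') (ivars u ''m'') \<noteq> 0" by (auto simp: row_def)
      then have "ivars u ''m'' \<le> x_degree p" using le_degree degree_coeff_le_x_degree order_trans by blast
      then show ?thesis using False * by simp
    qed
  qed
qed

text \<open>\<open>K = 2 n N + 1\<close> is one more than the degree bound of the minors, so
  \<open>K\<close> values determine each of them. The tables reach up to \<open>4 K\<close> because
  \<open>euclid\<close> looks up parities of degree sums below the total length of its two
  polynomials.\<close>

definition setup_tables :: com where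
  "setup_tables = Seq (IAssign ''N'' (IAdd (IVar ''m'') (IVar ''n'')))
    (Seq (IAssign ''K'' (IAdd (IMul (IMul (INum 2) (IVar ''n'')) (IVar ''N'')) (INum 1)))
    (Seq (RAssign ''c'' (INum 0) (RNum 0)) (Seq (RAssign ''sg'' (INum 0) (RNum 1))
    (For ''xi'' (IMul (INum 4) (IVar ''K'')) (Seq
      (RAssign ''c'' (IAdd (IVar ''xi'') (INum 1)) (RAdd (RCell ''c'' (IVar ''xi'')) (RNum 1)))
      (RAssign ''sg'' (IAdd (IVar ''xi'') (INum 1)) (RSub (RNum 0) (RCell ''sg'' (IVar ''xi'')))))))))"

lemma writes_setup_tables [simp]:
  "iwrites setup_tables = {''N'', ''K'', ''xi''}" "awrites setup_tables = {''c'', ''sg''}"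
  by (auto simp: setup_tables_def)

definition tables :: "nat \<Rightarrow> nat \<Rightarrow> state \<Rightarrow> bool" where
  "tables N K s \<longleftrightarrow> ivars s ''N'' = N \<and> ivars s ''K'' = K \<and>
    (\<forall>i\<le>4 * K. arrays s ''c'' i = real i \<and> arrays s ''sg'' i = (-1) ^ i)"

lemma tables_same:
  "tables N K s \<Longrightarrow> same X Y s t \<Longrightarrow> ''N'' \<notin> X \<Longrightarrow> ''K'' \<notin> X \<Longrightarrow> ''c'' \<notin> Y \<Longrightarrow> ''sg'' \<notin> Y \<Longrightarrow> tables N K t"
  by (simp add: tables_def same_def)

lemma spec_setup_tables:
  assumes "ivars s ''m'' = m" "ivars s ''n'' = n"
  shows "spec setup_tables s (8 * (2 * n * (m + n) + 1)) (tables (m + n) (2 * n * (m + n) + 1))"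
proof -
  define K where "K = 2 * n * (m + n) + 1"
  define s0 where "s0 = s\<lparr>ivars := (ivars s)(''N'' := m + n, ''K'' := K),
    arrays := (arrays s)(''c'' := (arrays s ''c'')(0 := 0), ''sg'' := (arrays s ''sg'')(0 := 1))\<rparr>"
  have "spec (For ''xi'' (IMul (INum 4) (IVar ''K'')) (Seq
      (RAssign ''c'' (IAdd (IVar ''xi'') (INum 1)) (RAdd (RCell ''c'' (IVar ''xi'')) (RNum 1)))
      (RAssign ''sg'' (IAdd (IVar ''xi'') (INum 1)) (RSub (RNum 0) (RCell ''sg'' (IVar ''xi'')))))) s0 (8 * K) (tables (m + n) K)"
  proof (rule spec_For[where I = "\<lambda>k u. \<forall>i\<le>k. arrays u ''c'' i = real i \<and> arrays u ''sg'' i = (-1) ^ i"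
        and B = 2 and H = "4 * K"], goal_cases)
    case (2 u)
    then show ?case by (simp add: same_def s0_def)
  next
    case (4 k u)
    then show ?case by (simp add: le_Suc_eq)
  next
    case (5 u)
    then show ?case by (simp add: tables_def same_def s0_def)
  qed (auto simp: s0_def)
  then show ?thesis
    unfolding setup_tables_def using assms by (simp add: s0_def K_def)
qed

text \<open>Complex arithmetic in pairs of reals: \<open>ur\<close> and \<open>ui\<close> tabulate
  the real and imaginary parts of the powers of \<open>\<i>\<close>, each obtained from the previous
  one by a quarter turn.\<close>

definition ii_test :: com where
  "ii_test = Seq (RAssign ''ur'' (INum 0) (RNum 1)) (Seq (RAssign ''ui'' (INum 0) (RNum 0))
    (Seq (For ''xi'' (IMul (INum 2) (IVar ''n'')) (Seq
       (RAssign ''ur'' (IAdd (IVar ''xi'') (INum 1)) (RSub (RNum 0) (RCell ''ui'' (IVar ''xi''))))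
       (RAssign ''ui'' (IAdd (IVar ''xi'') (INum 1)) (RCell ''ur'' (IVar ''xi'')))))
    (Seq (RAssign ''r'' (INum 0) (RNum 0)) (Seq (RAssign ''r'' (INum 1) (RNum 0))
    (Seq (For ''xi'' (IAdd (IVar ''n'') (INum 1)) (For ''xj'' (IAdd (IVar ''n'') (INum 1)) (Seq
       (RAssign ''r'' (INum 0) (RAdd (RCell ''r'' (INum 0)) (RMul
         (RCell ''p'' (IAdd (IMul (IVar ''xi'') (IAdd (IVar ''n'') (INum 1))) (IVar ''xj'')))
         (RCell ''ur'' (IAdd (IVar ''xi'') (IVar ''xj''))))))
       (RAssign ''r'' (INum 1) (RAdd (RCell ''r'' (INum 1)) (RMul
         (RCell ''p'' (IAdd (IMul (IVar ''xi'') (IAdd (IVar ''n'') (INum 1))) (IVar ''xj'')))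
         (RCell ''ui'' (IAdd (IVar ''xi'') (IVar ''xj'')))))))))
    (If (REq (RCell ''r'' (INum 0)) (RNum 0)) (If (REq (RCell ''r'' (INum 1)) (RNum 0)) fail Skip) Skip))))))"

lemma writes_ii_test [simp]:
  "iwrites ii_test = {''xi'', ''xj'', ''ok''}" "awrites ii_test = {''ur'', ''ui'', ''r''}"
  by (auto simp: ii_test_def fail_def)

lemma complex_eval2_ii:
  assumes "p \<in> bipolys n"
  shows "complex_eval2 p \<i> \<i> = (\<Sum>i<Suc n. \<Sum>j<Suc n. of_real (coeff (coeff p j) i) * \<i> ^ (i + j))"
proof -
  have dp: "degree p \<le> n" and dc: "\<And>j. degree (coeff p j) \<le> n" using assms by (auto simp: bipolys_def)
  have "poly (cpoly (coeff p j)) \<i> = (\<Sum>i\<le>n. of_real (coeff (coeff p j) i) * \<i> ^ i)" for j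
  proof -
    have "poly (cpoly (coeff p j)) \<i> = (\<Sum>i\<le>degree (coeff p j). of_real (coeff (coeff p j) i) * \<i> ^ i)"
      by (simp add: poly_altdef coeff_map_poly)
    also have "\<dots> = (\<Sum>i\<le>n. of_real (coeff (coeff p j) i) * \<i> ^ i)"
      using dc[of j] by (intro sum.mono_neutral_left) (auto simp: coeff_eq_0)
    finally show ?thesis .
  qed
  then have "complex_eval2 p \<i> \<i> = (\<Sum>j\<le>n. \<Sum>i\<le>n. of_real (coeff (coeff p j) i) * \<i> ^ (i + j))"
    by (simp add: complex_eval2_sum[OF dp] sum_distrib_right power_add mult.assoc)
  also have "\<dots> = (\<Sum>i\<le>n. \<Sum>j\<le>n. of_real (coeff (coeff p j) i) * \<i> ^ (i + j))" by (rule sum.swap)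
  finally show ?thesis by (simp only: lessThan_Suc_atMost)
qed

lemma spec_ii_test:
  assumes inp: "has_coeffs n p s" and p: "p \<in> bipolys n" and n: "1 \<le> n"
  shows "spec ii_test s (20 * n * n) (\<lambda>u. ivars u ''ok'' = (if complex_eval2 p \<i> \<i> \<noteq> 0 then ivars s ''ok'' else 0))"
    (is "spec _ _ _ ?Q")
proof -
  define J where "J u \<longleftrightarrow> has_coeffs n p u \<and> ivars u ''ok'' = ivars s ''ok''" for u
  have J: "J u" if "J t" "same X Y t u" "''n'' \<notin> X" "''ok'' \<notin> X" "''p'' \<notin> Y" for t u X Y
    using that has_coeffs_same[of n p t X Y u] by (simp add: J_def same_ivars)
  have Jn: "ivars u ''n'' = n" if "J u" for u using that by (simp add: J_def has_coeffs_def)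
  define c where "c i j = complex_of_real (coeff (coeff p j) i) * \<i> ^ (i + j)" for i j
  define s0 where "s0 = s\<lparr>arrays := (arrays s)(''ur'' := (arrays s ''ur'')(0 := 1), ''ui'' := (arrays s ''ui'')(0 := 0))\<rparr>"
  define R1 where "R1 u \<longleftrightarrow> J u \<and> (\<forall>i\<le>2 * n. Complex (arrays u ''ur'' i) (arrays u ''ui'' i) = \<i> ^ i)" for u
  define R2 where "R2 u \<longleftrightarrow> R1 u \<and> arrays u ''r'' 0 = 0" for u
  define R3 where "R3 u \<longleftrightarrow> R1 u \<and> arrays u ''r'' 0 = 0 \<and> arrays u ''r'' 1 = 0" for u
  define R4 where "R4 u \<longleftrightarrow> J u \<and> Complex (arrays u ''r'' 0) (arrays u ''r'' 1) = (\<Sum>i<Suc n. \<Sum>j<Suc n. c i j)" for u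
  have J0: "J s0" using inp by (simp add: J_def has_coeffs_def s0_def)
  have s1: "spec (For ''xi'' (IMul (INum 2) (IVar ''n'')) (Seq
       (RAssign ''ur'' (IAdd (IVar ''xi'') (INum 1)) (RSub (RNum 0) (RCell ''ui'' (IVar ''xi''))))
       (RAssign ''ui'' (IAdd (IVar ''xi'') (INum 1)) (RCell ''ur'' (IVar ''xi''))))) s0 (2 * n) R1"
  proof (rule spec_For[where I = "\<lambda>k u. \<forall>i\<le>k. Complex (arrays u ''ur'' i) (arrays u ''ui'' i) = \<i> ^ i"
        and B = 1 and H = "2 * n"], goal_cases)
    case (2 u)
    then show ?case using Jn[OF J0] by (simp add: same_def)
  next
    case 3
    show ?case by (simp add: s0_def complex_eq_iff)
  next
    case (4 k u)
    have "Complex (- arrays u ''ui'' k) (arrays u ''ur'' k) = \<i> * Complex (arrays u ''ur'' k) (arrays u ''ui'' k)"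
      by (simp add: complex_eq_iff)
    also have "\<dots> = \<i> ^ Suc k" using 4(4) by simp
    finally show ?case using 4(3,4) by (simp add: le_Suc_eq)
  next
    case (5 u)
    have "J u" using J0 5(1) by (rule J) auto
    then show ?case using 5(3) by (simp add: R1_def)
  qed auto
  have s2: "spec (RAssign ''r'' (INum 0) (RNum 0)) t 0 R2" if t: "R1 t" for t
    using t by (simp add: R2_def R1_def J_def has_coeffs_def)
  have s3: "spec (RAssign ''r'' (INum 1) (RNum 0)) t 0 R3" if t: "R2 t" for t
    using t by (simp add: R3_def R2_def R1_def J_def has_coeffs_def)
  let ?body = "Seq
       (RAssign ''r'' (INum 0) (RAdd (RCell ''r'' (INum 0)) (RMul
         (RCell ''p'' (IAdd (IMul (IVar ''xi'') (IAdd (IVar ''n'') (INum 1))) (IVar ''xj'')))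
         (RCell ''ur'' (IAdd (IVar ''xi'') (IVar ''xj''))))))
       (RAssign ''r'' (INum 1) (RAdd (RCell ''r'' (INum 1)) (RMul
         (RCell ''p'' (IAdd (IMul (IVar ''xi'') (IAdd (IVar ''n'') (INum 1))) (IVar ''xj'')))
         (RCell ''ui'' (IAdd (IVar ''xi'') (IVar ''xj''))))))"
  let ?r = "\<lambda>u. Complex (arrays u ''r'' 0) (arrays u ''r'' 1)"
  have s4: "spec (For ''xi'' (IAdd (IVar ''n'') (INum 1)) (For ''xj'' (IAdd (IVar ''n'') (INum 1)) ?body)) t
      (Suc n * (Suc n * 4)) R4" if t: "R3 t" for t
  proof (rule spec_For[where I = "\<lambda>k u. ?r u = (\<Sum>i<k. \<Sum>j<Suc n. c i j)" and B = "Suc n * 4" and H = "Suc n"], goal_cases)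
    case (2 u)
    then show ?case using t Jn[of t] by (simp add: same_def R3_def R1_def)
  next
    case 3
    show ?case using t by (simp add: R3_def complex_eq_iff)
  next
    case (4 k u)
    have Ju: "J u" using t 4(2) by (intro J[of t _ _ u]) (auto simp: R3_def R1_def)
    have tab: "arrays u ''ur'' = arrays t ''ur''" "arrays u ''ui'' = arrays t ''ui''" using 4(2) by (simp_all add: same_def)
    note k = \<open>k < Suc n\<close>
    show ?case
    proof (rule spec_For[where I = "\<lambda>l v. ?r v = (\<Sum>i<k. \<Sum>j<Suc n. c i j) + (\<Sum>j<l. c k j)" and B = 4 and H = "Suc n"], goal_cases)
      case (2 v)
      then show ?case using Jn[OF Ju] by (simp add: same_def)
    next
      case 3
      show ?case using 4(4) by simp
    next
      case (4 l v)
      have Jv: "J v" using Ju 4(2) by (rule J) auto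
      have v: "ivars v ''xi'' = k" "ivars v ''n'' = n" "arrays v ''ur'' = arrays t ''ur''" "arrays v ''ui'' = arrays t ''ui''"
        using 4(2) \<open>ivars u ''xi'' = k\<close> tab Jn[OF Jv] by (simp_all add: same_def)
      have cell: "arrays v ''p'' (k * Suc n + l) = coeff (coeff p l) k"
        using Jv k 4(1) by (simp add: J_def has_coeffs_def)
      have "Complex (arrays t ''ur'' (k + l)) (arrays t ''ui'' (k + l)) = \<i> ^ (k + l)"
        using t k 4(1) by (simp add: R3_def R1_def)
      then have "c k l = Complex (coeff (coeff p l) k * arrays t ''ur'' (k + l)) (coeff (coeff p l) k * arrays t ''ui'' (k + l))"
        unfolding c_def by (simp add: complex_eq_iff flip: \<open>Complex _ _ = \<i> ^ (k + l)\<close>)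
      then have eq: "Complex (arrays v ''r'' 0 + coeff (coeff p l) k * arrays t ''ur'' (k + l))
          (arrays v ''r'' 1 + coeff (coeff p l) k * arrays t ''ui'' (k + l)) = ?r v + c k l"
        by (simp add: complex_eq_iff)
      have "spec ?body v 4 (\<lambda>w. ?r w = ?r v + c k l)"
        unfolding eq[symmetric] using v cell 4(3) by simp
      then show ?case
      proof (rule spec_mono[OF _ order_refl])
        fix w assume "?r w = ?r v + c k l"
        then show "?r (w\<lparr>ivars := (ivars w)(''xj'' := Suc l)\<rparr>) = (\<Sum>i<k. \<Sum>j<Suc n. c i j) + (\<Sum>j<Suc l. c k j)"
          unfolding 4(4) sum.lessThan_Suc[of "c k"] by (simp del: sum.lessThan_Suc add: add.assoc)
      qed
    next
      case (5 v)
      then show ?case by simp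
    qed auto
  next
    case (5 u)
    have "J u" using t 5(1) by (intro J[of t _ _ u]) (auto simp: R3_def R1_def)
    then show ?case using 5(3) by (simp add: R4_def)
  qed auto
  have s5: "spec (If (REq (RCell ''r'' (INum 0)) (RNum 0)) (If (REq (RCell ''r'' (INum 1)) (RNum 0)) fail Skip) Skip) t 2 ?Q"
    if t: "R4 t" for t
  proof -
    have "complex_eval2 p \<i> \<i> = Complex (arrays t ''r'' 0) (arrays t ''r'' 1)"
      using t unfolding complex_eval2_ii[OF p] R4_def c_def by (simp only:)
    then have "complex_eval2 p \<i> \<i> = 0 \<longleftrightarrow> arrays t ''r'' 0 = 0 \<and> arrays t ''r'' 1 = 0"
      by (simp add: complex_eq_iff)
    moreover have "ivars t ''ok'' = ivars s ''ok''" using t by (simp add: R4_def J_def)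
    ultimately show ?thesis by (simp add: fail_def)
  qed
  have "spec (Seq (For ''xi'' (IMul (INum 2) (IVar ''n'')) (Seq
       (RAssign ''ur'' (IAdd (IVar ''xi'') (INum 1)) (RSub (RNum 0) (RCell ''ui'' (IVar ''xi''))))
       (RAssign ''ui'' (IAdd (IVar ''xi'') (INum 1)) (RCell ''ur'' (IVar ''xi'')))))
    (Seq (RAssign ''r'' (INum 0) (RNum 0)) (Seq (RAssign ''r'' (INum 1) (RNum 0))
    (Seq (For ''xi'' (IAdd (IVar ''n'') (INum 1)) (For ''xj'' (IAdd (IVar ''n'') (INum 1)) ?body))
    (If (REq (RCell ''r'' (INum 0)) (RNum 0)) (If (REq (RCell ''r'' (INum 1)) (RNum 0)) fail Skip) Skip))))) s0
    (2 * n + (0 + (0 + (Suc n * (Suc n * 4) + 2)))) ?Q"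
    by (rule spec_chain[OF s1], rule spec_chain[OF s2], assumption, rule spec_chain[OF s3], assumption,
        rule spec_chain[OF s4], assumption, rule s5, assumption)
  then have "spec ii_test s (2 * n + (0 + (0 + (Suc n * (Suc n * 4) + 2)))) ?Q"
    unfolding ii_test_def by (simp add: s0_def)
  moreover have "2 * n + (0 + (0 + (Suc n * (Suc n * 4) + 2))) \<le> 20 * n * n"
  proof -
    define q where "q = n * n"
    have "Suc n * (Suc n * 4) \<le> (2 * n) * (2 * n * 4)" using n by (intro mult_mono) auto
    also have "\<dots> = 16 * q" by (simp add: q_def)
    finally have "Suc n * (Suc n * 4) \<le> 16 * q" .
    moreover have "n \<le> q" using n by (simp add: q_def)
    moreover have "20 * n * n = 20 * q" by (simp add: q_def)
    ultimately show ?thesis using n by linarith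
  qed
  ultimately show ?thesis by (rule spec_mono)
qed

section \<open>The stability program\<close>

definition sample_prog :: com where
  "sample_prog = For ''g'' (IVar ''K'') (Seq pencil_prog (Seq bez_prog elim_prog))"

definition sample_ivars :: "string set" where
  "sample_ivars = {''zi'', ''ma'', ''mb'', ''k1'', ''xi'', ''j'', ''xj'', ''ok'', ''cc''}"

definition sample_arrays :: "string set" where
  "sample_arrays = {''Y'', ''T'', ''W'', ''X'', ''Q'', ''b'', ''e'', ''M'', ''d'', ''V''}"

lemma writes_sample [simp]:
  "iwrites (Seq pencil_prog (Seq bez_prog elim_prog)) = sample_ivars"
  "awrites (Seq pencil_prog (Seq bez_prog elim_prog)) = sample_arrays"
  by (auto simp: sample_ivars_def sample_arrays_def)

lemma writes_sample_prog [simp]: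
  "iwrites sample_prog = insert ''g'' sample_ivars" "awrites sample_prog = sample_arrays"
  unfolding sample_prog_def writes_For writes_sample by (rule refl)+

lemma spec_sample:
  assumes inp: "pencil_input n m p s" and tab: "tables (m + n) K s" and g: "ivars s ''g'' = g" "g < K"
    and NK: "m + n \<le> K"
  defines "B \<equiv> bez (m + n) (pencil n p (real g))"
  shows "spec (Seq pencil_prog (Seq bez_prog elim_prog)) s (148 * n ^ 3) (\<lambda>u.
    ivars u ''ok'' = (if elimination_psd (m + n) B then ivars s ''ok'' else 0) \<and>
    (\<forall>c<m + n. arrays u ''V'' (c * K + g) = (\<Prod>i<Suc c. (schur ^^ i) B 0 0)) \<and>
    (\<forall>c h. h < K \<longrightarrow> h \<noteq> g \<longrightarrow> arrays u ''V'' (c * K + h) = arrays s ''V'' (c * K + h)))"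
    (is "spec _ _ _ ?Q")
proof -
  define N where "N = m + n"
  have n1: "1 \<le> n" "m \<le> n" using inp by (auto simp: pencil_input_def)
  have N1: "1 \<le> N" "N \<le> 2 * n" using n1 by (auto simp: N_def)
  define J where "J u \<longleftrightarrow> tables N K u \<and> ivars u ''g'' = g \<and> ivars u ''ok'' = ivars s ''ok'' \<and> arrays u ''V'' = arrays s ''V''" for u
  have J: "J u" if "J t" "same X Y t u" "''N'' \<notin> X" "''K'' \<notin> X" "''g'' \<notin> X" "''ok'' \<notin> X" "''c'' \<notin> Y" "''sg'' \<notin> Y" "''V'' \<notin> Y" for t u X Y
    using that tables_same[of N K t X Y u] by (simp add: J_def same_ivars same_arrays)
  define R1 where "R1 u \<longleftrightarrow> J u \<and> coeffs_poly (arrays u ''Q'') (Suc N) = pencil n p (real g)" for u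
  define R2 where "R2 u \<longleftrightarrow> J u \<and> (\<forall>i<N. \<forall>j<N. arrays u ''M'' (i * (2 * N) + j) = B i j)" for u
  have Js: "J s" using tab g by (simp add: J_def N_def)
  have cg: "arrays s ''c'' (ivars s ''g'') = real g" using tab g by (simp add: tables_def)
  have s1: "spec pencil_prog s (44 * n ^ 3) R1"
    using spec_pencil_prog[OF inp cg]
  proof (rule spec_mono[OF _ order_refl])
    fix u assume u: "coeffs_poly (arrays u ''Q'') (Suc (m + n)) = pencil n p (real g)"
      "same (iwrites pencil_prog) (awrites pencil_prog) s u"
    have "J u" using Js u(2) by (rule J) auto
    then show "R1 u" using u(1) by (simp add: R1_def N_def)
  qed
  have s2: "spec bez_prog t (12 * N * N) R2" if t: "R1 t" for t
  proof -
    have Jt: "ivars t ''N'' = N" "\<And>i. i \<le> N \<Longrightarrow> arrays t ''c'' i = real i" "coeffs_poly (arrays t ''Q'') (Suc N) = pencil n p (real g)"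
      using t NK by (auto simp: R1_def J_def tables_def N_def)
    show ?thesis
      using spec_bez_prog[OF Jt(1) N1(1) Jt(2,3)]
    proof (rule spec_mono[OF _ order_refl])
      fix u assume u: "\<forall>i<N. \<forall>j<N. arrays u ''M'' (i * (2 * N) + j) = bez N (pencil n p (real g)) i j"
        "same (iwrites bez_prog) (awrites bez_prog) t u"
      have "J t" using t by (simp add: R1_def)
      then have "J u" using u(2) by (rule J) auto
      then show "R2 u" using u(1) by (simp add: R2_def B_def N_def)
    qed
  qed
  have s3: "spec elim_prog t (7 * N * N * N) ?Q" if t: "R2 t" for t
  proof -
    have Jt: "ivars t ''N'' = N" "ivars t ''K'' = K" "ivars t ''g'' = g" "ivars t ''ok'' = ivars s ''ok''" "arrays t ''V'' = arrays s ''V''"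
      using t by (auto simp: R2_def J_def tables_def)
    have "entry N t i j = B i j" if "i < N" "j < N" for i j
      using t that by (simp add: R2_def entry_def)
    from spec_elim_prog[OF Jt(1-3) g(2) this] show ?thesis
      unfolding Jt(4,5) N_def .
  qed
  have "spec (Seq pencil_prog (Seq bez_prog elim_prog)) s (44 * n ^ 3 + (12 * N * N + 7 * N * N * N)) ?Q"
    by (rule spec_chain[OF s1], rule spec_chain[OF s2], assumption, rule s3, assumption)
  \<comment> \<open>With \<open>N \<le> 2 n\<close> the constant is
    \<open>44 + 12 * 4 + 7 * 8\<close>.\<close>
  moreover have "44 * n ^ 3 + (12 * N * N + 7 * N * N * N) \<le> 148 * n ^ 3"
  proof -
    have "N * N \<le> (2 * n) * (2 * n)" using N1 by (intro mult_mono) auto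
    moreover have "N * N * N \<le> (2 * n) * (2 * n) * (2 * n)" using N1 by (intro mult_mono) auto
    moreover have "(2 * n) * (2 * n) * (2 * n) = 8 * n ^ 3" by (simp add: power3_eq_cube)
    moreover have "(2 * n) * (2 * n) \<le> 4 * n ^ 3" using n1 by (simp add: power3_eq_cube)
    ultimately show ?thesis by linarith
  qed
  ultimately show ?thesis by (rule spec_mono)
qed

lemma spec_sample_prog:
  assumes inp: "pencil_input n m p s" and tab: "tables (m + n) K s" and NK: "m + n \<le> K"
  defines "B \<equiv> \<lambda>g. bez (m + n) (pencil n p (real g))"
  shows "spec sample_prog s (148 * n ^ 3 * K) (\<lambda>u.
    ivars u ''ok'' = (if \<forall>g<K. elimination_psd (m + n) (B g) then ivars s ''ok'' else 0) \<and>
    (\<forall>g<K. \<forall>c<m + n. arrays u ''V'' (c * K + g) = (\<Prod>i<Suc c. (schur ^^ i) (B g) 0 0)))"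
  unfolding sample_prog_def
proof (rule spec_For[where B = "148 * n ^ 3" and H = K and I = "\<lambda>k u.
    ivars u ''ok'' = (if \<forall>g<k. elimination_psd (m + n) (B g) then ivars s ''ok'' else 0) \<and>
    (\<forall>g<k. \<forall>c<m + n. arrays u ''V'' (c * K + g) = (\<Prod>i<Suc c. (schur ^^ i) (B g) 0 0))"], goal_cases)
  case 1
  show ?case by (simp add: sample_ivars_def)
next
  case (2 u)
  then show ?case using tab by (simp add: same_def tables_def sample_ivars_def)
next
  case 3
  show ?case by simp
next
  case (4 k u)
  have iu: "pencil_input n m p u" using inp 4(2) by (rule pencil_input_same) (auto simp: sample_ivars_def sample_arrays_def)
  have tu: "tables (m + n) K u" using tab 4(2) by (rule tables_same) (auto simp: sample_ivars_def sample_arrays_def)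
  show ?case
  proof (rule spec_mono[OF spec_sample[OF iu tu 4(3,1) NK] order_refl], goal_cases)
    case (1 v)
    define P where "P g \<longleftrightarrow> elimination_psd (m + n) (B g)" for g
    have "ivars v ''ok'' = (if P k then ivars u ''ok'' else 0)"
      unfolding P_def B_def using 1(1) by (rule conjunct1)
    moreover have "ivars u ''ok'' = (if \<forall>i<k. P i then ivars s ''ok'' else 0)"
      unfolding P_def using 4(4) by (rule conjunct1)
    moreover have "(\<forall>i<Suc k. P i) \<longleftrightarrow> (\<forall>i<k. P i) \<and> P k" using less_Suc_eq by metis
    ultimately have ok: "ivars v ''ok'' = (if \<forall>i<Suc k. P i then ivars s ''ok'' else 0)"
      by (cases "P k"; cases "\<forall>i<k. P i") (simp_all only: if_True if_False simp_thms)
    have V: "arrays v ''V'' (c * K + g) = (\<Prod>i<Suc c. (schur ^^ i) (B g) 0 0)" if "g < Suc k" "c < m + n" for g c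
    proof (cases "g = k")
      case True
      then show ?thesis using 1(1)[THEN conjunct2, THEN conjunct1, rule_format, OF that(2)] by (simp only: B_def)
    next
      case False
      then have "g < k" using that(1) by simp
      then have "arrays v ''V'' (c * K + g) = arrays u ''V'' (c * K + g)"
        using 1(1)[THEN conjunct2, THEN conjunct2, rule_format, of g c] 4(1) by simp
      then show ?thesis
        using 4(4)[THEN conjunct2, rule_format, OF \<open>g < k\<close> that(2)] by (simp only:)
    qed
    show ?case using ok V unfolding P_def by (simp del: prod.lessThan_Suc)
  qed
next
  case (5 u)
  from 5(3) show ?case .
next
  case 6
  show ?case by simp
qed

section \<open>Nonnegativity of the interpolated minors\<close>

definition final_prog :: com where
  "final_prog = For ''k'' (IVar ''N'') (Seq interp nonneg_test)"

definition final_ivars :: "string set" where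
  "final_ivars = {''ei'', ''ik'', ''zi'', ''ma'', ''mb'', ''ij''} \<union> nonneg_ivars"

definition final_arrays :: "string set" where
  "final_arrays = {''h'', ''hw'', ''f'', ''z'', ''T'', ''w''} \<union> nonneg_arrays"

lemma writes_final [simp]:
  "iwrites (Seq interp nonneg_test) = final_ivars" "awrites (Seq interp nonneg_test) = final_arrays"
  by (simp_all add: final_ivars_def final_arrays_def)

text \<open>If elimination has failed, the stored values need not be those of a minor, so the
  verdict is phrased for arbitrary values; at most one polynomial of degree below \<open>K\<close>
  interpolates them.\<close>

definition interpolant_nonneg :: "nat \<Rightarrow> (nat \<Rightarrow> real) \<Rightarrow> bool" where
  "interpolant_nonneg K y \<longleftrightarrow> (\<forall>F. (\<forall>i\<ge>K. coeff F i = 0) \<and> (\<forall>j<K. poly F (real j) = y j) \<longrightarrow>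
     (\<forall>x. poly F x \<ge> 0))"

lemma interpolant_nonneg_iff:
  assumes "\<And>i. i \<ge> K \<Longrightarrow> coeff F i = 0" "\<And>j. j < K \<Longrightarrow> poly F (real j) = y j"
  shows "interpolant_nonneg K y \<longleftrightarrow> (\<forall>x. poly F x \<ge> 0)"
proof -
  have "G = F" if "\<And>i. i \<ge> K \<Longrightarrow> coeff G i = 0" "\<And>j. j < K \<Longrightarrow> poly G (real j) = y j" for G
  proof -
    have "G - F = 0"
      by (rule zero_poly_if_many_roots[of "real ` {..<K}"])
        (use assms that in \<open>auto simp: card_image\<close>)
    then show ?thesis by simp
  qed
  then show ?thesis unfolding interpolant_nonneg_def using assms by blast
qed

lemma spec_final_step:
  assumes tab: "tables N K s" and K: "2 \<le> K"
  shows "spec (Seq interp nonneg_test) s (422 * K * K) (\<lambda>u. ivars u ''ok'' =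
    (if interpolant_nonneg K (\<lambda>j. arrays s ''V'' (ivars s ''k'' * K + j)) then ivars s ''ok'' else 0))"
proof -
  let ?y = "\<lambda>j. arrays s ''V'' (ivars s ''k'' * K + j)"
  have sK: "ivars s ''K'' = K" "\<And>i. i \<le> K \<Longrightarrow> arrays s ''c'' i = real i" using tab by (auto simp: tables_def)
  have "spec interp s (22 * K * K) (\<lambda>u. \<forall>j<K. poly (coeffs_poly (arrays u ''f'') K) (real j) = ?y j)"
    using K by (intro spec_interp sK) auto
  then show ?thesis
  proof (rule spec_Seq[where ?B2.0 = "400 * K * K"])
    fix t assume F: "\<forall>j<K. poly (coeffs_poly (arrays t ''f'') K) (real j) = ?y j"
      and st: "same (iwrites interp) (awrites interp) s t"
    have tt: "tables N K t" using tab st by (rule tables_same) auto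
    have ok: "ivars t ''ok'' = ivars s ''ok''" using st by (simp add: same_def)
    have "spec nonneg_test t (400 * K * K) (\<lambda>u. ivars u ''ok'' =
        (if \<forall>x. poly (coeffs_poly (arrays t ''f'') K) x \<ge> 0 then ivars t ''ok'' else 0))"
      using tt K by (intro spec_nonneg_test) (auto simp: tables_def)
    moreover have "interpolant_nonneg K ?y \<longleftrightarrow> (\<forall>x. poly (coeffs_poly (arrays t ''f'') K) x \<ge> 0)"
      using F by (intro interpolant_nonneg_iff) auto
    ultimately show "spec nonneg_test t (400 * K * K) (\<lambda>u. ivars u ''ok'' =
        (if interpolant_nonneg K ?y then ivars s ''ok'' else 0))"
      by (simp only: ok)
  qed simp
qed

lemma spec_final_prog:
  assumes tab: "tables N K s" and K: "2 \<le> K"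
  shows "spec final_prog s (422 * K * K * N) (\<lambda>u. ivars u ''ok'' =
    (if \<forall>c<N. interpolant_nonneg K (\<lambda>j. arrays s ''V'' (c * K + j)) then ivars s ''ok'' else 0))"
  unfolding final_prog_def
proof (rule spec_For[where B = "422 * K * K" and H = N and I = "\<lambda>k u. ivars u ''ok'' =
    (if \<forall>c<k. interpolant_nonneg K (\<lambda>j. arrays s ''V'' (c * K + j)) then ivars s ''ok'' else 0)"], goal_cases)
  case 1
  show ?case by (simp add: final_ivars_def nonneg_ivars_def)
next
  case (2 u)
  then show ?case using tab by (simp add: same_def tables_def final_ivars_def nonneg_ivars_def)
next
  case 3
  show ?case by simp
next
  case (4 k u)
  have tu: "tables N K u"
    using tab 4(2) by (rule tables_same) (auto simp: final_ivars_def final_arrays_def nonneg_ivars_def nonneg_arrays_def)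
  have V: "arrays u ''V'' = arrays s ''V''"
    using 4(2) by (simp add: same_def final_arrays_def nonneg_arrays_def)
  show ?case
  proof (rule spec_mono[OF spec_final_step[OF tu K] order_refl], goal_cases)
    case (1 v)
    define P where "P c \<longleftrightarrow> interpolant_nonneg K (\<lambda>j. arrays s ''V'' (c * K + j))" for c
    have "ivars v ''ok'' = (if P k then ivars u ''ok'' else 0)"
      using 1(1) unfolding P_def V 4(3) .
    moreover have "ivars u ''ok'' = (if \<forall>i<k. P i then ivars s ''ok'' else 0)"
      unfolding P_def using 4(4) .
    moreover have "(\<forall>i<Suc k. P i) \<longleftrightarrow> (\<forall>i<k. P i) \<and> P k" using less_Suc_eq by metis
    ultimately have "ivars v ''ok'' = (if \<forall>i<Suc k. P i then ivars s ''ok'' else 0)"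
      by (cases "P k"; cases "\<forall>i<k. P i") (simp_all only: if_True if_False simp_thms)
    then show ?case unfolding P_def by simp
  qed
next
  case (5 u)
  from 5(3) show ?case .
next
  case 6
  show ?case by simp
qed

text \<open>The zero polynomial is stable by definition and is answered at once. In the other branch
  every test only ever clears \<open>ok\<close>, so the tests simply follow each other.\<close>

definition stability_program :: com where
  "stability_program = Seq find_x_degree (If (ILess (INum 0) (IVar ''nz''))
     (Seq setup_tables (Seq (IAssign ''ok'' (INum 1)) (Seq ii_test (Seq sample_prog (Seq final_prog
       (IAssign ''answer'' (IVar ''ok'')))))))
     (IAssign ''answer'' (INum 1)))"

text \<open>The stored pivot products are minors only where elimination succeeds. The interpolants
  are therefore identified with the minors under the second conjunct, which suffices to make the two
  conjunctions equivalent.\<close>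

lemma stable_iff_checks:
  assumes p: "p \<in> bipolys n" "p \<noteq> 0" and m: "m = x_degree p" and K: "K = 2 * n * (m + n) + 1"
    and psd: "\<And>g c. g < K \<Longrightarrow> c < m + n \<Longrightarrow> V (c * K + g) = (\<Prod>i<Suc c. (schur ^^ i) (bez (m + n) (pencil n p (real g))) 0 0)"
  shows "real_stable p \<longleftrightarrow> complex_eval2 p \<i> \<i> \<noteq> 0 \<and>
    (\<forall>g<K. elimination_psd (m + n) (bez (m + n) (pencil n p (real g)))) \<and>
    (\<forall>c<m + n. interpolant_nonneg K (\<lambda>j. V (c * K + j)))"
proof -
  let ?N = "m + n"
  let ?B = "\<lambda>g. bez ?N (pencil n p (real g))"
  have e: "elimination_psd ?N (?B g) \<longleftrightarrow> psd ?N (?B g)" for g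
    by (rule psd_iff_elimination_psd[OF symm_bezoutian, symmetric])
  have nn: "interpolant_nonneg K (\<lambda>j. V (c * K + j)) \<longleftrightarrow> (\<forall>x. pencil_minor n p (Suc c) x \<ge> 0)"
    if "\<forall>g<K. elimination_psd ?N (?B g)" "c < ?N" for c
  proof -
    obtain F where F: "degree F \<le> 2 * n * Suc c" "\<And>x. pencil_minor n p (Suc c) x = poly F x"
      using poly_fun_pencil_minor[of n "Suc c" p] unfolding poly_fun_def by blast
    have "2 * n * Suc c \<le> 2 * n * ?N" using that(2) by (intro mult_le_mono2) simp
    then have "degree F < K" using F(1) K by linarith
    moreover have "poly F (real j) = V (c * K + j)" if j: "j < K" for j
      unfolding F(2)[symmetric] pencil_minor_def m[symmetric]
      using leading_minor_eq_prod_pivots[OF symm_bezoutian, of ?N _ _ "Suc c"] \<open>\<forall>g<K. elimination_psd ?N (?B g)\<close> j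
        psd[OF j \<open>c < ?N\<close>] \<open>c < ?N\<close> by simp
    ultimately have "interpolant_nonneg K (\<lambda>j. V (c * K + j)) \<longleftrightarrow> (\<forall>x. poly F x \<ge> 0)"
      by (intro interpolant_nonneg_iff) (auto simp: coeff_eq_0)
    then show ?thesis by (simp add: F(2))
  qed
  have zero: "pencil_minor n p 0 g \<ge> 0" for g by (simp add: pencil_minor_def)
  have all: "(\<forall>k\<le>?N. \<forall>g. pencil_minor n p k g \<ge> 0) \<longleftrightarrow> (\<forall>c<?N. \<forall>g. pencil_minor n p (Suc c) g \<ge> 0)"
  proof
    assume R: "\<forall>c<?N. \<forall>g. pencil_minor n p (Suc c) g \<ge> 0"
    show "\<forall>k\<le>?N. \<forall>g. pencil_minor n p k g \<ge> 0"
    proof (intro allI impI)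
      fix k g assume "k \<le> ?N"
      then show "pencil_minor n p k g \<ge> 0" using R zero by (cases k) auto
    qed
  qed simp
  have "2 * n * (x_degree p + n) < K" using K m by simp
  from stable_iff_minors[OF p this] have "real_stable p \<longleftrightarrow> complex_eval2 p \<i> \<i> \<noteq> 0 \<and>
      (\<forall>g<K. elimination_psd ?N (?B g)) \<and> (\<forall>c<?N. \<forall>x. pencil_minor n p (Suc c) x \<ge> 0)"
    unfolding m[symmetric] e all .
  then show ?thesis using nn by blast
qed

text \<open>\<open>K \<le> 5 n^2\<close> and \<open>m + n \<le> 2 n\<close> turn the dominant term
  into \<open>422 * 25 * 2 = 21100\<close> times \<open>n^5\<close>; sampling adds
  \<open>740 n^5\<close>, and the quadratic terms add at most \<open>64 n^5\<close>.\<close>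

lemma cost_bound:
  fixes n :: nat
  assumes "1 \<le> n" "m \<le> n" "K = 2 * n * (m + n) + 1"
  shows "Suc n * Suc n + (8 * K + (20 * n * n + (148 * n ^ 3 * K + 422 * K * K * (m + n)))) \<le> 22000 * n ^ 5"
proof -
  have n2: "1 \<le> n ^ 2" using assms(1) by simp
  have "2 * n * (m + n) \<le> 2 * n * (2 * n)" using assms(2) by (intro mult_le_mono2) simp
  also have "\<dots> = 4 * n ^ 2" by (simp add: power2_eq_square)
  finally have K: "K \<le> 5 * n ^ 2" using assms(3) n2 by linarith
  have p: "n ^ 2 \<le> n ^ 5" using assms(1) by (intro power_increasing) auto
  have "Suc n * Suc n \<le> (2 * n) * (2 * n)" using assms(1) by (intro mult_mono) auto
  then have a: "Suc n * Suc n \<le> 4 * n ^ 2" by (simp add: power2_eq_square)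
  have b: "20 * n * n = 20 * n ^ 2" by (simp add: power2_eq_square)
  have "148 * n ^ 3 * K \<le> 148 * n ^ 3 * (5 * n ^ 2)" using K by (intro mult_le_mono2)
  also have "\<dots> = 740 * n ^ 5" by (simp add: power_add[symmetric])
  finally have c: "148 * n ^ 3 * K \<le> 740 * n ^ 5" .
  have "422 * K * K * (m + n) \<le> 422 * (5 * n ^ 2) * (5 * n ^ 2) * (2 * n)"
    using K assms(2) by (intro mult_le_mono) auto
  also have "\<dots> = 21100 * n ^ 5" by (simp add: power2_eq_square power_numeral_reduce)
  finally have d: "422 * K * K * (m + n) \<le> 21100 * n ^ 5" .
  show ?thesis using K p a b c d by linarith
qed

lemma spec_stability_program:
  assumes n: "1 \<le> n" and p: "p \<in> bipolys n"
  shows "spec stability_program (input_state n p) (22000 * n ^ 5)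
    (\<lambda>u. ivars u ''answer'' = (if real_stable p then 1 else 0))"
    (is "spec _ _ _ ?Q")
proof -
  let ?s = "input_state n p"
  define m where "m = x_degree p"
  define K where "K = 2 * n * (m + n) + 1"
  let ?N = "m + n"
  let ?B = "\<lambda>g. bez ?N (pencil n p (real g))"
  have inp: "has_coeffs n p ?s"
    by (simp add: has_coeffs_def input_state_def del: mult_Suc_right)
  have dc: "degree (coeff p j) \<le> n" for j using p by (auto simp: bipolys_def)
  have mn: "m \<le> n"
  proof (cases "p = 0")
    case False
    then obtain j where "coeff (coeff p j) m \<noteq> 0" using x_degree_attained unfolding m_def by metis
    then show ?thesis using le_degree dc order_trans by blast
  qed (simp add: m_def x_degree_def)
  have K2: "2 \<le> K" "?N \<le> K"
  proof -
    have "1 * ?N \<le> 2 * n * ?N" using n by (intro mult_le_mono1) simp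
    then have "?N + 1 \<le> K" unfolding K_def by simp
    then show "2 \<le> K" "?N \<le> K" using n by simp_all
  qed
  have "spec stability_program ?s (Suc n * Suc n + (8 * K + (20 * n * n + (148 * n ^ 3 * K + 422 * K * K * ?N)))) ?Q"
    unfolding stability_program_def
  proof (rule spec_Seq[OF spec_find_x_degree[OF inp p] _ order_refl])
    fix s1 assume z: "if p = 0 then ivars s1 ''nz'' = 0 else ivars s1 ''nz'' = 1 \<and> ivars s1 ''m'' = x_degree p"
      and ss: "same (iwrites find_x_degree) (awrites find_x_degree) ?s s1"
    have h1: "has_coeffs n p s1" using inp ss by (rule has_coeffs_same) auto
    show "spec (If (ILess (INum 0) (IVar ''nz''))
       (Seq setup_tables (Seq (IAssign ''ok'' (INum 1)) (Seq ii_test (Seq sample_prog (Seq final_prog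
         (IAssign ''answer'' (IVar ''ok'')))))))
       (IAssign ''answer'' (INum 1))) s1 (8 * K + (20 * n * n + (148 * n ^ 3 * K + 422 * K * K * ?N))) ?Q"
    proof (cases "p = 0")
      case True
      then show ?thesis using z by (simp add: real_stable_def)
    next
      case False
      have m1: "ivars s1 ''nz'' = 1" "ivars s1 ''m'' = m" using z False by (auto simp: m_def)
      define J where "J u \<longleftrightarrow> pencil_input n m p u \<and> has_coeffs n p u \<and> tables ?N K u" for u
      have J: "J u" if "J t" "same X Y t u" "''n'' \<notin> X" "''m'' \<notin> X" "''N'' \<notin> X" "''K'' \<notin> X" "''p'' \<notin> Y" "''c'' \<notin> Y" "''sg'' \<notin> Y" for t u X Y
        using that pencil_input_same[of n m p t X Y u] has_coeffs_same[of n p t X Y u] tables_same[of ?N K t X Y u]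
        by (simp add: J_def)
      define ii where "ii \<longleftrightarrow> complex_eval2 p \<i> \<i> \<noteq> 0"
      define ps where "ps \<longleftrightarrow> (\<forall>g<K. elimination_psd ?N (?B g))"
      define RV where "RV V \<longleftrightarrow> (\<forall>g<K. \<forall>c<?N. V (c * K + g) = (\<Prod>i<Suc c. (schur ^^ i) (?B g) 0 0))" for V
      define R2 where "R2 u \<longleftrightarrow> J u \<and> ivars u ''ok'' = 1" for u
      define R3 where "R3 u \<longleftrightarrow> J u \<and> ivars u ''ok'' = (if ii then 1 else 0)" for u
      define R4 where "R4 u \<longleftrightarrow> J u \<and> ivars u ''ok'' = (if ps then if ii then 1 else 0 else 0) \<and> RV (arrays u ''V'')" for u
      define R5 where "R5 u \<longleftrightarrow> ivars u ''ok'' = (if real_stable p then 1 else 0)" for u :: state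
      have s1: "spec setup_tables s1 (8 * K) J"
      proof -
        have "ivars s1 ''n'' = n" using h1 by (simp add: has_coeffs_def)
        from spec_setup_tables[OF m1(2) this, folded K_def] show ?thesis
        proof (rule spec_mono[OF _ order_refl])
          fix t assume t: "tables ?N K t" "same (iwrites setup_tables) (awrites setup_tables) s1 t"
          have ht: "has_coeffs n p t" using h1 t(2) by (rule has_coeffs_same) auto
          moreover have "ivars t ''m'' = m" "ivars t ''N'' = ?N" using t m1(2) by (simp_all add: same_def tables_def)
          moreover have "degree (coeff p j) \<le> m" for j unfolding m_def by (rule degree_coeff_le_x_degree)
          ultimately have "pencil_input n m p t" using n mn by (simp add: pencil_input_def has_coeffs_def)
          then show "J t" using ht t(1) by (simp add: J_def)
        qed
      qed
      have s2: "spec (IAssign ''ok'' (INum 1)) t 0 R2" if t: "J t" for t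
        using J[OF t, of "{''ok''}" "{}" "t\<lparr>ivars := (ivars t)(''ok'' := 1)\<rparr>"] by (simp add: R2_def same_def)
      have s3: "spec ii_test t (20 * n * n) R3" if t: "R2 t" for t
      proof -
        have "has_coeffs n p t" "J t" "ivars t ''ok'' = 1" using t by (auto simp: R2_def J_def)
        show ?thesis
        proof (rule spec_mono[OF spec_ii_test[OF \<open>has_coeffs n p t\<close> p n] order_refl], goal_cases)
          case (1 u)
          have "J u" using \<open>J t\<close> 1(2) by (rule J) auto
          then show ?case using 1(1) \<open>ivars t ''ok'' = 1\<close> by (simp add: R3_def ii_def)
        qed
      qed
      have s4: "spec sample_prog t (148 * n ^ 3 * K) R4" if t: "R3 t" for t
      proof -
        have t': "pencil_input n m p t" "tables ?N K t" "J t" "ivars t ''ok'' = (if ii then 1 else 0)"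
          using t by (auto simp: R3_def J_def)
        show ?thesis
        proof (rule spec_mono[OF spec_sample_prog[OF t'(1,2) K2(2)] order_refl], goal_cases)
          case (1 u)
          have "J u" using t'(3) 1(2) by (rule J) (auto simp: sample_ivars_def sample_arrays_def)
          moreover have "ivars u ''ok'' = (if ps then if ii then 1 else 0 else 0)"
            using 1(1)[THEN conjunct1] unfolding t'(4) ps_def .
          moreover have "RV (arrays u ''V'')" using 1(1)[THEN conjunct2] unfolding RV_def .
          ultimately show ?case by (simp only: R4_def)
        qed
      qed
      have s5: "spec final_prog t (422 * K * K * ?N) R5" if t: "R4 t" for t
      proof -
        have t': "tables ?N K t" "ivars t ''ok'' = (if ps then if ii then 1 else 0 else 0)" "RV (arrays t ''V'')"
          using t by (auto simp only: R4_def J_def)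
        have "real_stable p \<longleftrightarrow> ii \<and> ps \<and> (\<forall>c<?N. interpolant_nonneg K (\<lambda>j. arrays t ''V'' (c * K + j)))"
          unfolding ii_def ps_def using t'(3) unfolding RV_def
          by (intro stable_iff_checks[OF p False m_def K_def]) blast
        then show ?thesis
          using spec_final_prog[OF t'(1) K2(1)] unfolding R5_def[abs_def] t'(2)
          by (cases ii; cases ps; cases "\<forall>c<?N. interpolant_nonneg K (\<lambda>j. arrays t ''V'' (c * K + j))")
            (simp_all only: if_True if_False simp_thms if_cancel)
      qed
      have s6: "spec (IAssign ''answer'' (IVar ''ok'')) t 0 ?Q" if t: "R5 t" for t
        using t by (simp add: R5_def)
      have "spec (Seq setup_tables (Seq (IAssign ''ok'' (INum 1)) (Seq ii_test (Seq sample_prog (Seq final_prog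
         (IAssign ''answer'' (IVar ''ok''))))))) s1 (8 * K + (0 + (20 * n * n + (148 * n ^ 3 * K + (422 * K * K * ?N + 0))))) ?Q"
        by (rule spec_chain[OF s1], rule spec_chain[OF s2], assumption, rule spec_chain[OF s3], assumption,
            rule spec_chain[OF s4], assumption, rule spec_chain[OF s5], assumption, rule s6, assumption)
      then show ?thesis unfolding spec_If using m1(1) by simp
    qed
  qed
  then show ?thesis by (rule spec_mono) (use cost_bound[OF n mn K_def] in auto)
qed

theorem theorem1p1:
  shows "\<exists>(A :: com) (C :: real). \<forall>n \<ge> 1. \<forall>p \<in> bipolys n.
           \<exists>k t. run A (input_state n p) k t \<and>
                 ivars t ''answer'' = (if real_stable p then 1 else 0) \<and>
                 real k \<le> C * real n ^ 5"
proof (intro exI[of _ stability_program] exI[of _ "22000::real"] allI impI ballI)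
  fix n :: nat and p assume "1 \<le> n" "p \<in> bipolys n"
  then obtain k t where "run stability_program (input_state n p) k t" "k \<le> 22000 * n ^ 5"
    "ivars t ''answer'' = (if real_stable p then 1 else 0)"
    using spec_stability_program unfolding spec_def by blast
  moreover from this(2) have "real k \<le> real (22000 * n ^ 5)" by (simp only: of_nat_le_iff)
  ultimately show "\<exists>k t. run stability_program (input_state n p) k t \<and>
      ivars t ''answer'' = (if real_stable p then 1 else 0) \<and> real k \<le> 22000 * real n ^ 5"
    by (intro exI[of _ k] exI[of _ t]) simp
qed

end
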